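(* Let $p\in[0,1/2]$ satisfy $p\ge 100/n$, let $G_0$ be any graph on the vertex set $\{1,\dots,n\}$, let $G_{\mathrm{rand}}\sim\mathbb G(n,p)$ and $G=G_0\triangle G_{\mathrm{rand}}$. Then with high probability every connected component of $D(G,\mathcal V^*\phi_G)$ has $O(\log n)$ vertices.
   Context: $\mathbb G(n,p)$ is the random graph on $\{1,\dots,n\}$ with each edge independently present with probability $p$; "with high probability" means with probability tending to $1$ as $n\to\infty$; $\triangle$ is symmetric difference of edge sets. 2-dimensional Weisfeiler--Leman: for $f:V(G)^2\to\Omega$, $(2\mathcal R)f(u,v)=(f(u,v),(d_{\omega_1,\omega_2}(u,v))_{(\omega_1,\omega_2)})$ with $d_{\omega_1,\omega_2}(u,v)$ the number of $w$ with $(f(u,w),f(w,v))=(\omega_1,\omega_2)$; iterating until the partition of $V(G)^2$ stabilises gives $(2\mathcal R)^*f$. $\phi_G:V(G)^2\to\{0,1,\star\}$ is given by $\phi_G(u,v)=1$ if $uv$ is an edge, $\phi_G(u,u)=\star$ (a fixed third symbol), and $0$ otherwise; $\mathcal V^*\phi_G$ is the vertex colouring $v\mapsto(2\mathcal R)^*\phi_G(v,v)$. Disparity graph: for a vertex colouring $c$, $M(G,c)$ contains, for each (possibly equal) pair of colours $\omega,\omega'$, all possible edges between colour $\omega$ and colour $\omega'$ if at least half of them are edges of $G$, and none otherwise; $D(G,c)=M(G,c)\triangle G$. *)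

theory Defs
  imports "HOL-Probability.Probability" "HOL-Library.Multiset"
begin

text \<open>Simple graphs are given by a vertex set \<open>V\<close> and a set of two-element subsets of \<open>V\<close>.\<close>

definition all_edges :: "'v set \<Rightarrow> 'v set set" where
  "all_edges V = {e. e \<subseteq> V \<and> card e = 2}"

definition connected_comp :: "'v set \<Rightarrow> 'v set set \<Rightarrow> 'v \<Rightarrow> 'v set" where
  "connected_comp V E v = {w \<in> V. (v, w) \<in> {(x, y). {x, y} \<in> E}\<^sup>*}"

definition connected_comps :: "'v set \<Rightarrow> 'v set set \<Rightarrow> 'v set set" where
  "connected_comps V E = connected_comp V E ` V"

definition random_graph :: "nat \<Rightarrow> real \<Rightarrow> nat set set pmf" where
  "random_graph n p =
     map_pmf (\<lambda>b. {e \<in> all_edges {1..n}. b e})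
       (Pi_pmf (all_edges {1..n}) False (\<lambda>_. bernoulli_pmf p))"

text \<open>
  Each refinement step replaces the colour set \<open>\<Omega>\<close> by a larger one: the new colour of \<open>(u, v)\<close> is
  the old colour together with the counts \<open>d\<^sub>\<omega>\<^sub>1\<^sub>\<omega>\<^sub>2(u, v)\<close>. The type below collects the colours of
  all stages. The family of counts is stored as a multiset of pairs of colours; the multiplicity
  of \<open>(\<omega>\<^sub>1, \<omega>\<^sub>2)\<close> in it is \<open>d\<^sub>\<omega>\<^sub>1\<^sub>\<omega>\<^sub>2(u, v)\<close>.
\<close>

datatype 'c wl_colour =
  Init 'c
| Refined "'c wl_colour" "('c wl_colour \<times> 'c wl_colour) multiset"

definition wl_step ::
  "'v set \<Rightarrow> ('v \<Rightarrow> 'v \<Rightarrow> 'c wl_colour) \<Rightarrow> 'v \<Rightarrow> 'v \<Rightarrow> 'c wl_colour" where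
  "wl_step V f u v = Refined (f u v) (image_mset (\<lambda>w. (f u w, f w v)) (mset_set V))"

lemma count_image_mset_wl_step:
  assumes "finite V"
  shows "count (image_mset (\<lambda>w. (f u w, f w v)) (mset_set V)) (\<omega>1, \<omega>2)
           = card {w \<in> V. (f u w, f w v) = (\<omega>1, \<omega>2)}"
proof -
  have "(\<lambda>w. (f u w, f w v)) -` {(\<omega>1, \<omega>2)} \<inter> V = {w \<in> V. (f u w, f w v) = (\<omega>1, \<omega>2)}"
    by auto
  then show ?thesis
    using assms by (simp add: count_image_mset)
qed

definition same_partition ::
  "'v set \<Rightarrow> ('v \<Rightarrow> 'v \<Rightarrow> 'a) \<Rightarrow> ('v \<Rightarrow> 'v \<Rightarrow> 'b) \<Rightarrow> bool" where
  "same_partition V f g \<longleftrightarrow>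
     (\<forall>u\<in>V. \<forall>v\<in>V. \<forall>u'\<in>V. \<forall>v'\<in>V. f u v = f u' v' \<longleftrightarrow> g u v = g u' v')"

definition wl_iter :: "'v set \<Rightarrow> ('v \<Rightarrow> 'v \<Rightarrow> 'c) \<Rightarrow> nat \<Rightarrow> 'v \<Rightarrow> 'v \<Rightarrow> 'c wl_colour" where
  "wl_iter V f t = (wl_step V ^^ t) (\<lambda>u v. Init (f u v))"

text \<open>
  For finite \<open>V\<close> the partitions of \<open>V \<times> V\<close> get successively finer, so a stable stage exists.
\<close>

definition wl_stable :: "'v set \<Rightarrow> ('v \<Rightarrow> 'v \<Rightarrow> 'c) \<Rightarrow> 'v \<Rightarrow> 'v \<Rightarrow> 'c wl_colour" where
  "wl_stable V f =
     wl_iter V f (LEAST t. same_partition V (wl_iter V f t) (wl_iter V f (Suc t)))"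

datatype pair_kind = Non_Edge | Edge | Diagonal

definition phi :: "'v set set \<Rightarrow> 'v \<Rightarrow> 'v \<Rightarrow> pair_kind" where
  "phi E u v = (if u = v then Diagonal else if {u, v} \<in> E then Edge else Non_Edge)"

definition wl_vertex_colouring :: "'v set \<Rightarrow> 'v set set \<Rightarrow> 'v \<Rightarrow> pair_kind wl_colour" where
  "wl_vertex_colouring V E v = wl_stable V (phi E) v v"

definition edges_between :: "'v set \<Rightarrow> ('v \<Rightarrow> 'c) \<Rightarrow> 'c \<Rightarrow> 'c \<Rightarrow> 'v set set" where
  "edges_between V c \<omega> \<omega>' = {e \<in> all_edges V. \<exists>u v. e = {u, v} \<and> c u = \<omega> \<and> c v = \<omega>'}"

definition majority_graph :: "'v set \<Rightarrow> 'v set set \<Rightarrow> ('v \<Rightarrow> 'c) \<Rightarrow> 'v set set" where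
  "majority_graph V E c =
     \<Union> {edges_between V c \<omega> \<omega>' | \<omega> \<omega>'.
          card (edges_between V c \<omega> \<omega>') \<le> 2 * card (edges_between V c \<omega> \<omega>' \<inter> E)}"

definition disparity_graph :: "'v set \<Rightarrow> 'v set set \<Rightarrow> ('v \<Rightarrow> 'c) \<Rightarrow> 'v set set" where
  "disparity_graph V E c = sym_diff (majority_graph V E c) E"

end

(*
  Only the equitability of the stable colouring c is used. It makes a component of the disparity graph with
  at least one edge lie in the closure T of a single pair of like-coloured vertices, where one repeatedly adds
  each vertex that distinguishes two like-coloured vertices of the current set. Since a random graph may be
  written as the symmetric difference of a denser one and one of density 100 / n, we may take p = 100 / n.

  If s = |T| <= n / 300, explore T from its generating pair. A step either follows a random
  edge or decides the status of a vertex that distinguishes in G0 two vertices found so far. In the end every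
  other vertex outside T is joined in G0 in the same way to each vertex of T and a like-coloured mate of it, so it
  does not meet T in exactly one random edge. Summing over all explorations, such a T exists with probability at
  most exp (- 50 s).

  If T is larger, at least n / 300 vertices have a mate. Coarsen the colour classes into a bounded number of labels,
  keeping the large classes (or, if these cover less than half of the vertices with a mate, the largest of the remaining
  ones) intact. In an intact class all vertices have equally many neighbours in each label, and already the
  parities of these numbers agree with probability so small that it beats the number of labellings.
*)

theory Submission
  imports Defs "HOL-Real_Asymp.Real_Asymp"
begin

subsection \<open>The stable colouring is equitable\<close>

text \<open>The colouring depends on the random edges, so both cases take a union bound over
  witnesses that do not mention it, and the obstacle is the number of witnesses. There are about
  (n/s)^s sets of size s, too many for a gain of exp (- 66 s) when s is small. Exploration pays for
  its own branching: following a random edge offers n choices of probability p each, and n p = 100.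
  Parities are used because a symmetric difference of edge sets adds degrees mod 2, so
  \<open>G0\<close> only shifts the prescribed values. If the smallest intact class has size
  \<beta>, there are about (n/\<beta>)^s labellings with n/\<beta> unbounded, while parities alone
  gain only exp (- const s): rows may have no random edge leaving the intact classes. Hence few such
  edges are excluded first, uniformly over pairs of sets instead of labellings; otherwise many
  random edges must pair up inside fibres of size at most 2 \<beta>, and this gains a power of
  n/\<beta>. With a bounded number of labels only constants matter, and parities are weighed against
  the entropy of the label distribution.\<close>

definition equitable :: "'v set \<Rightarrow> 'v set set \<Rightarrow> ('v \<Rightarrow> 'c) \<Rightarrow> bool" where
  "equitable V E c \<longleftrightarrow> (\<forall>u\<in>V. \<forall>v\<in>V. c u = c v \<longrightarrow>
     (\<forall>\<omega>. card {w\<in>V. {u, w} \<in> E \<and> c w = \<omega>} = card {w\<in>V. {v, w} \<in> E \<and> c w = \<omega>}))"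

lemma wl_iter_Suc: "wl_iter V f (Suc t) = wl_step V (wl_iter V f t)"
  by (simp add: wl_iter_def)

lemma wl_iter_refines:
  "wl_iter V f (Suc t) u v = wl_iter V f (Suc t) u' v' \<Longrightarrow> wl_iter V f t u v = wl_iter V f t u' v'"
  by (simp add: wl_iter_Suc wl_step_def)

lemma wl_iter_determines_initial:
  "wl_iter V f t u v = wl_iter V f t u' v' \<Longrightarrow> f u v = f u' v'"
  by (induction t) (auto simp: wl_iter_def wl_step_def)

text \<open>While the partition still changes, the number of colours used on pairs increases
  strictly, and it is bounded by the number of pairs. This gives meaning to the \<open>LEAST\<close>
  in \<open>wl_stable\<close>.\<close>

lemma wl_iter_stabilises:
  assumes "finite V"
  shows "\<exists>t. same_partition V (wl_iter V f t) (wl_iter V f (Suc t))"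
proof (rule ccontr)
  assume neg: "\<not> ?thesis"
  define N where "N t = card ((\<lambda>(u, v). wl_iter V f t u v) ` (V \<times> V))" for t
  have step: "N t < N (Suc t)" for t
  proof -
    let ?g = "\<lambda>(u, v). wl_iter V f t u v" and ?h = "\<lambda>(u, v). wl_iter V f (Suc t) u v"
    \<comment> \<open>\<open>\<pi>\<close> forgets the last refinement; if it were injective on the
      colours in use, that refinement would have split nothing.\<close>
    define \<pi> where "\<pi> x = (case x of Refined y m \<Rightarrow> y)" for x :: "'b wl_colour"
    have \<pi>: "?g x = \<pi> (?h x)" for x
      by (cases x) (simp add: \<pi>_def wl_iter_Suc wl_step_def)
    have im: "?g ` (V \<times> V) = \<pi> ` (?h ` (V \<times> V))"
      unfolding image_image by (rule image_cong) (use \<pi> in auto)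
    have "\<not> inj_on \<pi> (?h ` (V \<times> V))"
    proof
      assume inj: "inj_on \<pi> (?h ` (V \<times> V))"
      have "same_partition V (wl_iter V f t) (wl_iter V f (Suc t))"
        unfolding same_partition_def
      proof (intro ballI iffI)
        fix u v u' v'
        assume V: "u \<in> V" "v \<in> V" "u' \<in> V" "v' \<in> V"
          and "wl_iter V f t u v = wl_iter V f t u' v'"
        then have "\<pi> (?h (u, v)) = \<pi> (?h (u', v'))"
          using \<pi>[of "(u, v)"] \<pi>[of "(u', v')"] by simp
        then have "?h (u, v) = ?h (u', v')"
          by (rule inj_onD[OF inj]) (use V in auto)
        then show "wl_iter V f (Suc t) u v = wl_iter V f (Suc t) u' v'" by simp
      qed (rule wl_iter_refines)
      then show False using neg by blast
    qed
    then have "card (\<pi> ` (?h ` (V \<times> V))) < card (?h ` (V \<times> V))"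
      using assms by (metis card_image_le eq_card_imp_inj_on finite_SigmaI finite_imageI le_neq_implies_less)
    then show ?thesis unfolding N_def im .
  qed
  have "t \<le> N t" for t
    by (induction t) (use step in \<open>auto simp: Suc_le_eq intro: le_less_trans\<close>)
  moreover have "N t \<le> card (V \<times> V)" for t
    unfolding N_def using assms by (intro card_image_le) auto
  ultimately have "Suc (card (V \<times> V)) \<le> card (V \<times> V)" using le_trans by blast
  then show False by simp
qed

lemma wl_stable_step:
  assumes "finite V" "u \<in> V" "v \<in> V" "u' \<in> V" "v' \<in> V"
    "wl_stable V f u v = wl_stable V f u' v'"
  shows "image_mset (\<lambda>w. (wl_stable V f u w, wl_stable V f w v)) (mset_set V)
       = image_mset (\<lambda>w. (wl_stable V f u' w, wl_stable V f w v')) (mset_set V)"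
proof -
  define t where "t = (LEAST t. same_partition V (wl_iter V f t) (wl_iter V f (Suc t)))"
  have "same_partition V (wl_iter V f t) (wl_iter V f (Suc t))"
    unfolding t_def using wl_iter_stabilises[OF assms(1)] by (rule LeastI_ex)
  moreover have f: "wl_stable V f = wl_iter V f t" unfolding wl_stable_def t_def ..
  ultimately have "wl_iter V f (Suc t) u v = wl_iter V f (Suc t) u' v'"
    using assms unfolding same_partition_def by metis
  then show ?thesis unfolding f by (simp add: wl_iter_Suc wl_step_def)
qed

lemma wl_stable_determines_initial:
  "wl_stable V f u v = wl_stable V f u' v' \<Longrightarrow> f u v = f u' v'"
  unfolding wl_stable_def by (rule wl_iter_determines_initial)

text \<open>The choice w = v contributes the pair (f u v, f v v) to the counts. The symbol
  \<open>Diagonal\<close> recorded in f v v forces any vertex that realises this pair at (u', v') to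
  be v' itself.\<close>

lemma wl_stable_determines_second:
  assumes "finite V" "u \<in> V" "v \<in> V" "u' \<in> V" "v' \<in> V"
    "wl_stable V (phi E) u v = wl_stable V (phi E) u' v'"
  shows "wl_stable V (phi E) v v = wl_stable V (phi E) v' v'"
proof -
  let ?f = "wl_stable V (phi E)"
  have "(?f u v, ?f v v) \<in># image_mset (\<lambda>w. (?f u w, ?f w v)) (mset_set V)"
    using assms(1,3) by simp
  then have "(?f u v, ?f v v) \<in># image_mset (\<lambda>w. (?f u' w, ?f w v')) (mset_set V)"
    using wl_stable_step[OF assms] by simp
  then obtain w where "w \<in> V" and w: "?f w v' = ?f v v" using assms by auto
  from w have "phi E w v' = phi E v v" by (rule wl_stable_determines_initial)
  then have "w = v'" by (simp add: phi_def split: if_splits)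
  then show ?thesis using w by simp
qed

lemma not_loop_edge: "E \<subseteq> all_edges V \<Longrightarrow> {u, v} \<in> E \<Longrightarrow> u \<noteq> v"
  by (auto simp: all_edges_def)

lemma equitable_wl_vertex_colouring:
  assumes "finite V" "E \<subseteq> all_edges V"
  shows "equitable V E (wl_vertex_colouring V E)"
  unfolding equitable_def
proof (intro ballI impI allI)
  fix u v \<omega>
  let ?f = "wl_stable V (phi E)" and ?c = "wl_vertex_colouring V E"
  assume uv: "u \<in> V" "v \<in> V" "?c u = ?c v"
  then have "?f u u = ?f v v" by (simp add: wl_vertex_colouring_def)
  from wl_stable_step[OF assms(1) uv(1,1,2,2) this]
  have "image_mset fst (image_mset (\<lambda>w. (?f u w, ?f w u)) (mset_set V))
      = image_mset fst (image_mset (\<lambda>w. (?f v w, ?f w v)) (mset_set V))" by simp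
  then have eq: "image_mset (?f u) (mset_set V) = image_mset (?f v) (mset_set V)"
    by (simp add: image_mset.compositionality comp_def)
  \<comment> \<open>Whether (x, w) is an edge with w of colour \<open>\<omega>\<close> can be read
    off the stable colour of the pair. \<open>S\<close> collects those colours, so degrees become
    counts in a single multiset.\<close>
  define S where "S = {?f x w |x w. x \<in> V \<and> w \<in> V \<and> phi E x w = Edge \<and> ?c w = \<omega>}"
  have S: "?f x w \<in> S \<longleftrightarrow> {x, w} \<in> E \<and> x \<noteq> w \<and> ?c w = \<omega>" if "x \<in> V" "w \<in> V" for x w
  proof
    assume "?f x w \<in> S"
    then obtain y z where yz: "y \<in> V" "z \<in> V" "phi E y z = Edge" "?c z = \<omega>" "?f x w = ?f y z"
      unfolding S_def by auto
    have "phi E x w = phi E y z" using wl_stable_determines_initial[OF yz(5)] .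
    moreover have "?c w = ?c z"
      using wl_stable_determines_second[OF assms(1) that yz(1,2,5)] by (simp add: wl_vertex_colouring_def)
    ultimately show "{x, w} \<in> E \<and> x \<noteq> w \<and> ?c w = \<omega>"
      using yz by (auto simp: phi_def split: if_splits)
  qed (use that in \<open>auto simp: S_def phi_def\<close>)
  have cnt: "card {w\<in>V. ?f x w \<in> S} = size (filter_mset (\<lambda>y. y \<in> S) (image_mset (?f x) (mset_set V)))"
    for x using assms by (simp add: filter_mset_image_mset filter_mset_mset_set)
  have S': "{w\<in>V. {x, w} \<in> E \<and> ?c w = \<omega>} = {w\<in>V. ?f x w \<in> S}" if "x \<in> V" for x
    using S[OF that] not_loop_edge[OF assms(2)] by blast
  show "card {w\<in>V. {u, w} \<in> E \<and> ?c w = \<omega>} = card {w\<in>V. {v, w} \<in> E \<and> ?c w = \<omega>}"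
    unfolding S'[OF uv(1)] S'[OF uv(2)] cnt eq ..
qed

subsection \<open>The disparity graph of an equitable colouring\<close>

lemma disparity_subset_all_edges:
  "E \<subseteq> all_edges V \<Longrightarrow> disparity_graph V E c \<subseteq> all_edges V"
  by (auto simp: disparity_graph_def majority_graph_def edges_between_def)

definition majority_pair :: "'v set \<Rightarrow> 'v set set \<Rightarrow> ('v \<Rightarrow> 'c) \<Rightarrow> 'c \<Rightarrow> 'c \<Rightarrow> bool" where
  "majority_pair V E c \<omega> \<omega>' \<longleftrightarrow>
     card (edges_between V c \<omega> \<omega>') \<le> 2 * card (edges_between V c \<omega> \<omega>' \<inter> E)"

lemma edges_between_commute: "edges_between V c \<omega> \<omega>' = edges_between V c \<omega>' \<omega>"
  unfolding edges_between_def by (auto simp: insert_commute)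

lemma pair_in_edges_between_iff:
  assumes "u \<in> V" "v \<in> V" "u \<noteq> v"
  shows "{u, v} \<in> edges_between V c \<omega> \<omega>' \<longleftrightarrow> c u = \<omega> \<and> c v = \<omega>' \<or> c v = \<omega> \<and> c u = \<omega>'"
  using assms by (auto simp: edges_between_def all_edges_def doubleton_eq_iff)

lemma majority_graph_iff:
  assumes "u \<in> V" "v \<in> V" "u \<noteq> v"
  shows "{u, v} \<in> majority_graph V E c \<longleftrightarrow> majority_pair V E c (c u) (c v)"
proof
  assume "{u, v} \<in> majority_graph V E c"
  then obtain \<omega> \<omega>' where "{u, v} \<in> edges_between V c \<omega> \<omega>'" "majority_pair V E c \<omega> \<omega>'"
    by (auto simp: majority_graph_def majority_pair_def)
  then show "majority_pair V E c (c u) (c v)"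
    using pair_in_edges_between_iff[OF assms] edges_between_commute
    unfolding majority_pair_def by metis
next
  assume "majority_pair V E c (c u) (c v)"
  then show "{u, v} \<in> majority_graph V E c"
    using pair_in_edges_between_iff[OF assms, of c "c u" "c v"]
    by (auto simp: majority_graph_def majority_pair_def)
qed

lemma disparity_graph_iff:
  assumes "u \<in> V" "v \<in> V" "u \<noteq> v"
  shows "{u, v} \<in> disparity_graph V E c \<longleftrightarrow> ({u, v} \<in> E) \<noteq> majority_pair V E c (c u) (c v)"
  using majority_graph_iff[OF assms, of E c] by (auto simp: disparity_graph_def)

text \<open>Between two fixed classes the disparity graph is either \<open>E\<close> or its
  complement, so a degree is kept or subtracted from the class size, with the vertex itself
  discounted when both classes coincide.\<close>

lemma disparity_graph_equitable:
  assumes fin: "finite V" and E: "E \<subseteq> all_edges V" and eq: "equitable V E c"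
  shows "equitable V (disparity_graph V E c) c"
  unfolding equitable_def
proof (intro ballI impI allI)
  fix u v \<omega> assume uv: "u \<in> V" "v \<in> V" "c u = c v"
  let ?D = "disparity_graph V E c"
  have E_eq: "card {w\<in>V. {u, w} \<in> E \<and> c w = \<omega>} = card {w\<in>V. {v, w} \<in> E \<and> c w = \<omega>}"
    using eq uv unfolding equitable_def by blast
  have loop: "{x, x} \<notin> E" "{x, x} \<notin> ?D" for x
    using E disparity_subset_all_edges[OF E, of c] by (auto simp: all_edges_def)
  have D: "{w\<in>V. {x, w} \<in> ?D \<and> c w = \<omega>} =
    (if majority_pair V E c (c x) \<omega> then ({w\<in>V. c w = \<omega>} - {x}) - {w\<in>V. {x, w} \<in> E \<and> c w = \<omega>}
     else {w\<in>V. {x, w} \<in> E \<and> c w = \<omega>})" if "x \<in> V" for x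
    using disparity_graph_iff[OF that, of _ E c] loop[of x] by (auto; metis)
  have card: "card (({w\<in>V. c w = \<omega>} - {x}) - {w\<in>V. {x, w} \<in> E \<and> c w = \<omega>}) =
     (card {w\<in>V. c w = \<omega>} - (if c x = \<omega> then 1 else 0)) - card {w\<in>V. {x, w} \<in> E \<and> c w = \<omega>}"
    if "x \<in> V" for x
  proof -
    have "{w\<in>V. {x, w} \<in> E \<and> c w = \<omega>} \<subseteq> {w\<in>V. c w = \<omega>} - {x}"
      using loop(1)[of x] by auto
    then have "card (({w\<in>V. c w = \<omega>} - {x}) - {w\<in>V. {x, w} \<in> E \<and> c w = \<omega>}) =
       card ({w\<in>V. c w = \<omega>} - {x}) - card {w\<in>V. {x, w} \<in> E \<and> c w = \<omega>}"
      using fin by (intro card_Diff_subset) auto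
    then show ?thesis using that by (simp add: card_Diff_singleton_if)
  qed
  show "card {w\<in>V. {u, w} \<in> ?D \<and> c w = \<omega>} = card {w\<in>V. {v, w} \<in> ?D \<and> c w = \<omega>}"
    unfolding D[OF uv(1)] D[OF uv(2)] using E_eq uv by (simp add: card)
qed

lemma card_edges_between_disparity:
  assumes "finite V"
  shows "2 * card (edges_between V c \<omega> \<omega>' \<inter> disparity_graph V E c) \<le> card (edges_between V c \<omega> \<omega>')"
proof -
  let ?B = "edges_between V c \<omega> \<omega>'"
  have "?B \<subseteq> Pow V" by (auto simp: edges_between_def all_edges_def)
  then have finB: "finite ?B" using assms finite_subset by blast
  have iff: "e \<in> disparity_graph V E c \<longleftrightarrow> (e \<in> E) \<noteq> majority_pair V E c \<omega> \<omega>'" if "e \<in> ?B" for e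
  proof -
    from that obtain u v where e: "e = {u, v}" "c u = \<omega>" "c v = \<omega>'" "e \<in> all_edges V"
      by (auto simp: edges_between_def)
    then have "u \<in> V" "v \<in> V" "u \<noteq> v" by (auto simp: all_edges_def)
    then show ?thesis using disparity_graph_iff[of u V v E c] e by simp
  qed
  show ?thesis
  proof (cases "majority_pair V E c \<omega> \<omega>'")
    case True
    then have "?B \<inter> disparity_graph V E c = ?B - ?B \<inter> E" using iff by auto
    then have "card (?B \<inter> disparity_graph V E c) = card ?B - card (?B \<inter> E)"
      using finB by (simp add: card_Diff_subset_Int Int_assoc[symmetric])
    then show ?thesis using True by (simp add: majority_pair_def)
  next
    case False
    then have "?B \<inter> disparity_graph V E c = ?B \<inter> E" using iff by auto
    then show ?thesis using False by (simp add: majority_pair_def)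
  qed
qed

text \<open>Regularity turns an average into a bound for every vertex: all vertices of the class of
  v have equally many neighbours in \<open>\<omega>\<close>, and at most half of the edges between
  the two classes lie in the disparity graph.\<close>

lemma disparity_graph_half:
  assumes fin: "finite V" and E: "E \<subseteq> all_edges V" and eq: "equitable V E c" and v: "v \<in> V"
  shows "2 * card {w\<in>V. {v, w} \<in> disparity_graph V E c \<and> c w = \<omega>} \<le> card {w\<in>V. c w = \<omega>}"
proof -
  let ?D = "disparity_graph V E c"
  let ?B = "edges_between V c (c v) \<omega>"
  let ?C = "{w\<in>V. c w = \<omega>}" and ?C' = "{u\<in>V. c u = c v}"
  \<comment> \<open>An edge inside a single class is counted from both of its ends.\<close>
  define m :: nat where "m = (if c v = \<omega> then 2 else 1)"
  have "?B \<subseteq> Pow V" by (auto simp: edges_between_def all_edges_def)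
  then have finB: "finite ?B" using fin finite_subset by blast
  have pairs: "card {(u, w). u \<in> ?C' \<and> w \<in> ?C \<and> {u, w} \<in> S} = m * card S" if S: "S \<subseteq> ?B" for S
  proof -
    have finS: "finite S" using S finB finite_subset by blast
    have "{(u, w). u \<in> ?C' \<and> w \<in> ?C \<and> {u, w} \<in> S} =
        (\<Union>e\<in>S. {(u, w). u \<in> ?C' \<and> w \<in> ?C \<and> {u, w} = e})" by auto
    also have "card \<dots> = (\<Sum>e\<in>S. card {(u, w). u \<in> ?C' \<and> w \<in> ?C \<and> {u, w} = e})"
    proof (rule card_UN_disjoint)
      show "\<forall>e\<in>S. finite {(u, w). u \<in> ?C' \<and> w \<in> ?C \<and> {u, w} = e}"
        using fin by (auto intro: finite_subset[of _ "V \<times> V"])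
    qed (use finS in auto)
    also have "\<dots> = (\<Sum>e\<in>S. m)"
    proof (rule sum.cong)
      fix e assume "e \<in> S"
      then obtain x y where e: "e = {x, y}" "c x = c v" "c y = \<omega>" "e \<in> all_edges V"
        using S by (auto simp: edges_between_def)
      then have xy: "x \<in> V" "y \<in> V" "x \<noteq> y" by (auto simp: all_edges_def)
      have "{(u, w). u \<in> ?C' \<and> w \<in> ?C \<and> {u, w} = e} = (if c v = \<omega> then {(x, y), (y, x)} else {(x, y)})"
        using e xy by (auto simp: doubleton_eq_iff)
      then show "card {(u, w). u \<in> ?C' \<and> w \<in> ?C \<and> {u, w} = e} = m"
        using xy by (simp add: m_def)
    qed simp
    finally show ?thesis by simp
  qed
  let ?d = "card {w\<in>V. {v, w} \<in> ?D \<and> c w = \<omega>}"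
  have D: "?D \<subseteq> all_edges V" using disparity_subset_all_edges[OF E] .
  have "card {w\<in>V. {u, w} \<in> ?D \<and> c w = \<omega>} = ?d" if "u \<in> ?C'" for u
    using disparity_graph_equitable[OF fin E eq] v that unfolding equitable_def by blast
  then have "(\<Sum>u\<in>?C'. card {w\<in>V. {u, w} \<in> ?D \<and> c w = \<omega>}) = (\<Sum>u\<in>?C'. ?d)"
    by (rule sum.cong[OF refl])
  then have "card ?C' * ?d = (\<Sum>u\<in>?C'. card {w\<in>V. {u, w} \<in> ?D \<and> c w = \<omega>})" by simp
  also have "\<dots> = card (SIGMA u:?C'. {w\<in>V. {u, w} \<in> ?D \<and> c w = \<omega>})"
    using fin by (intro card_SigmaI[symmetric]) auto
  also have "(SIGMA u:?C'. {w\<in>V. {u, w} \<in> ?D \<and> c w = \<omega>})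
      = {(u, w). u \<in> ?C' \<and> w \<in> ?C \<and> {u, w} \<in> ?B \<inter> ?D}"
  proof -
    have "{u, w} \<in> ?B" if "c u = c v" "c w = \<omega>" "{u, w} \<in> ?D" for u w
      using D that unfolding edges_between_def by blast
    then show ?thesis by blast
  qed
  also have "card \<dots> = m * card (?B \<inter> ?D)" by (rule pairs) auto
  finally have "2 * (card ?C' * ?d) = m * (2 * card (?B \<inter> ?D))" by simp
  also have "\<dots> \<le> m * card ?B"
    using card_edges_between_disparity[OF fin, of c "c v" \<omega> E] by simp
  also have "\<dots> = card {(u, w). u \<in> ?C' \<and> w \<in> ?C \<and> {u, w} \<in> ?B}" by (rule pairs[symmetric]) simp
  also have "\<dots> \<le> card (?C' \<times> ?C)" using fin by (intro card_mono) auto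
  finally have "card ?C' * (2 * ?d) \<le> card ?C' * card ?C" by (simp add: card_cartesian_product)
  moreover have "card ?C' > 0" using v fin by (auto simp: card_gt_0_iff)
  ultimately show ?thesis by simp
qed

subsection \<open>Closures of pairs\<close>

definition colour_closed :: "'v set \<Rightarrow> ('v \<Rightarrow> 'v \<Rightarrow> bool) \<Rightarrow> ('v \<Rightarrow> 'c) \<Rightarrow> 'v set \<Rightarrow> bool" where
  "colour_closed V D c C \<longleftrightarrow> (\<forall>b\<in>C. \<forall>b'\<in>C. c b = c b' \<longrightarrow> (\<forall>u\<in>V - C. D b u = D b' u))"

definition pair_closure :: "'v set \<Rightarrow> ('v \<Rightarrow> 'v \<Rightarrow> bool) \<Rightarrow> ('v \<Rightarrow> 'c) \<Rightarrow> 'v \<Rightarrow> 'v \<Rightarrow> 'v set" where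
  "pair_closure V D c a a' = \<Inter> {C. C \<subseteq> V \<and> a \<in> C \<and> a' \<in> C \<and> colour_closed V D c C}"

context
  fixes V :: "'v set" and D :: "'v \<Rightarrow> 'v \<Rightarrow> bool" and c :: "'v \<Rightarrow> 'c"
begin

lemma pair_closure_least:
  "C \<subseteq> V \<Longrightarrow> a \<in> C \<Longrightarrow> a' \<in> C \<Longrightarrow> colour_closed V D c C \<Longrightarrow> pair_closure V D c a a' \<subseteq> C"
  by (auto simp: pair_closure_def)

lemma pair_closure_props:
  assumes "a \<in> V" "a' \<in> V"
  shows "pair_closure V D c a a' \<subseteq> V" "a \<in> pair_closure V D c a a'" "a' \<in> pair_closure V D c a a'"
    "colour_closed V D c (pair_closure V D c a a')"
proof -
  have "colour_closed V D c V" by (auto simp: colour_closed_def)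
  then show "pair_closure V D c a a' \<subseteq> V" using assms by (intro pair_closure_least) auto
  show "a \<in> pair_closure V D c a a'" "a' \<in> pair_closure V D c a a'" by (auto simp: pair_closure_def)
  show "colour_closed V D c (pair_closure V D c a a')"
    unfolding pair_closure_def colour_closed_def by blast
qed

lemma pair_closure_mono:
  assumes "a \<in> V" "a' \<in> V" "b \<in> pair_closure V D c a a'" "b' \<in> pair_closure V D c a a'"
  shows "pair_closure V D c b b' \<subseteq> pair_closure V D c a a'"
  by (rule pair_closure_least[OF pair_closure_props(1)[OF assms(1,2)] assms(3,4)
        pair_closure_props(4)[OF assms(1,2)]])

lemma pair_closure_split:
  assumes "a \<in> V" "a' \<in> V" "c a = c a'" "u \<in> V" "D a u \<noteq> D a' u"
  shows "u \<in> pair_closure V D c a a'"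
  using pair_closure_props[OF assms(1,2)] assms unfolding colour_closed_def by blast

context
  assumes fin: "finite V"
    and sym: "\<And>u v. D u v \<Longrightarrow> D v u"
    and dom: "\<And>u v. D u v \<Longrightarrow> u \<in> V"
    and reg: "\<And>u v \<omega>. u \<in> V \<Longrightarrow> v \<in> V \<Longrightarrow> c u = c v \<Longrightarrow>
                card {w\<in>V. D u w \<and> c w = \<omega>} = card {w\<in>V. D v w \<and> c w = \<omega>}"
    and half: "\<And>v \<omega>. v \<in> V \<Longrightarrow> 2 * card {w\<in>V. D v w \<and> c w = \<omega>} \<le> card {w\<in>V. c w = \<omega>}"
begin

text \<open>Regularity turns a one-sided difference of neighbourhoods into a two-sided one.\<close>

lemma regular_exchange:
  assumes "u \<in> V" "v \<in> V" "c u = c v" "D u w" "\<not> D v w"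
  obtains w' where "w' \<in> V" "c w' = c w" "D v w'" "\<not> D u w'"
proof (rule ccontr)
  assume *: "\<not> thesis"
  have w: "w \<in> V" using assms(4) sym dom by blast
  have "{x\<in>V. D v x \<and> c x = c w} \<subset> {x\<in>V. D u x \<and> c x = c w}"
    using * that assms w by blast
  then have "card {x\<in>V. D v x \<and> c x = c w} < card {x\<in>V. D u x \<and> c x = c w}"
    using fin by (intro psubset_card_mono) auto
  then show False using reg[OF assms(1-3), of "c w"] by simp
qed

text \<open>Each of the two pairs is separated by both members of the other, so each closure
  contains the generators of the other.\<close>

lemma pair_closure_crossed:
  assumes "v \<in> V" "v' \<in> V" "c v = c v'" "c u = c u'"
    and "D v u" "\<not> D v' u" "D v' u'" "\<not> D v u'"
  shows "pair_closure V D c v v' = pair_closure V D c u u'"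
proof -
  have V: "u \<in> V" "u' \<in> V" using assms sym dom by blast+
  have "u \<in> pair_closure V D c v v'" "u' \<in> pair_closure V D c v v'"
    using assms V by (auto intro!: pair_closure_split)
  moreover have "v \<in> pair_closure V D c u u'" "v' \<in> pair_closure V D c u u'"
    using assms V sym by (auto intro!: pair_closure_split)
  ultimately show ?thesis using assms V by (intro equalityI pair_closure_mono) auto
qed

text \<open>The members of the closure that have a mate form a closed set: if u separates two
  like-coloured ones, exchange gives another vertex of the colour of u that separates them the other
  way round and so lies in the closure too. Minimality does the rest.\<close>

lemma mate_in_pair_closure:
  assumes a: "a \<in> V" "a' \<in> V" "c a = c a'" "a \<noteq> a'" and b: "b \<in> pair_closure V D c a a'"
  shows "\<exists>b'\<in>pair_closure V D c a a'. b' \<noteq> b \<and> c b' = c b"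
proof -
  let ?C = "pair_closure V D c a a'"
  let ?I = "{b\<in>?C. \<exists>b'\<in>?C. b' \<noteq> b \<and> c b' = c b}"
  note C = pair_closure_props[OF a(1,2)]
  have *: "u \<in> ?I" if h: "x \<in> ?I" "y \<in> ?I" "c x = c y" "u \<in> V" "D x u" "\<not> D y u" for x y u
  proof -
    have xy: "x \<in> V" "y \<in> V" "x \<in> ?C" "y \<in> ?C" using h C(1) by auto
    obtain u' where u': "u' \<in> V" "c u' = c u" "D y u'" "\<not> D x u'"
      using regular_exchange[OF xy(1,2) h(3,5,6)] by blast
    have "u \<in> ?C" "u' \<in> ?C" using C(4) xy h u' unfolding colour_closed_def by blast+
    moreover have "u' \<noteq> u" using u' h by auto
    ultimately show ?thesis using u' by auto
  qed
  have "colour_closed V D c ?I"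
    unfolding colour_closed_def
  proof (intro ballI impI)
    fix x y u assume h: "x \<in> ?I" "y \<in> ?I" "c x = c y" "u \<in> V - ?I"
    show "D x u = D y u"
    proof (rule ccontr)
      assume "D x u \<noteq> D y u"
      then consider "D x u" "\<not> D y u" | "D y u" "\<not> D x u" by blast
      then have "u \<in> ?I" using *[OF h(1,2,3)] *[OF h(2,1) h(3)[symmetric]] h(4) by cases blast+
      then show False using h(4) by blast
    qed
  qed
  moreover have "a \<in> ?I" "a' \<in> ?I" using a C by auto
  ultimately have "?C \<subseteq> ?I" using C(1) by (intro pair_closure_least) auto
  then show ?thesis using b by blast
qed

text \<open>A pair with largest closure among those starting in the component \<open>X\<close> generates all of \<open>X\<close>:
  the vertices occurring first in a generating pair are closed under \<open>D\<close>.\<close>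

lemma component_in_pair_closure:
  assumes X: "X \<subseteq> V" and Xclosed: "\<And>u v. u \<in> X \<Longrightarrow> D u v \<Longrightarrow> v \<in> X"
    and conn: "\<And>Y. Y \<subseteq> X \<Longrightarrow> Y \<noteq> {} \<Longrightarrow> (\<And>u v. u \<in> Y \<Longrightarrow> D u v \<Longrightarrow> v \<in> Y) \<Longrightarrow> Y = X"
    and edge: "x \<in> X" "D x y"
  shows "\<exists>a a'. a \<in> X \<and> a' \<in> V \<and> a \<noteq> a' \<and> c a = c a' \<and> X \<subseteq> pair_closure V D c a a'"
proof -
  \<comment> \<open>Only the first vertex of a pair is confined to \<open>X\<close>: the mates
    produced by exchange may lie in other components.\<close>
  define P where "P = {(a, a'). a \<in> X \<and> a' \<in> V \<and> a \<noteq> a' \<and> c a = c a'}"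
  have finP: "finite P" using fin X by (intro finite_subset[of P "V \<times> V"]) (auto simp: P_def)
  have y: "y \<in> V" using edge sym dom by blast
  have xV: "x \<in> V" using edge X by auto
  have "P \<noteq> {}"
  proof
    assume "P = {}"
    then have "w = x" if "w \<in> V" "c w = c x" for w
      using that edge(1) unfolding P_def by force
    then have *: "{w\<in>V. c w = c x} = {x}" using xV by auto
    \<comment> \<open>If x were alone in its colour, y would be joined to that whole class, more
      than the half allowed.\<close>
    have "{w\<in>V. D y w \<and> c w = c x} = {x}" using * edge sym xV by auto
    then show False using half[OF y, of "c x"] * by simp
  qed
  define m where "m = Max ((\<lambda>(a, a'). card (pair_closure V D c a a')) ` P)"
  have m_max: "card (pair_closure V D c a a') \<le> m" if "(a, a') \<in> P" for a a'
    unfolding m_def using that finP by (intro Max_ge) force+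
  have "m \<in> (\<lambda>(a, a'). card (pair_closure V D c a a')) ` P"
    unfolding m_def using finP \<open>P \<noteq> {}\<close> by (intro Max_in) auto
  then obtain a a' where aP: "(a, a') \<in> P" and am: "card (pair_closure V D c a a') = m" by auto
  define C where "C = pair_closure V D c a a'"
  have aV: "a \<in> V" "a' \<in> V" using aP X by (auto simp: P_def)
  have finC: "finite C" using pair_closure_props(1)[OF aV] fin finite_subset unfolding C_def by blast
  have maximal: "pair_closure V D c u u' = C" if "(u, u') \<in> P" "C \<subseteq> pair_closure V D c u u'" for u u'
  proof -
    have "u \<in> V" "u' \<in> V" using that X by (auto simp: P_def)
    then have "finite (pair_closure V D c u u')" using pair_closure_props(1) fin finite_subset by blast
    then show ?thesis using card_seteq[OF _ that(2)] m_max[OF that(1)] am by (simp add: C_def)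
  qed
  define Y where "Y = {v\<in>X. \<exists>v'. (v, v') \<in> P \<and> pair_closure V D c v v' = C}"
  have "Y = X"
  proof (rule conn)
    show "Y \<subseteq> X" by (auto simp: Y_def)
    show "Y \<noteq> {}" using aP by (auto simp: Y_def C_def P_def)
    fix v u assume v: "v \<in> Y" and vu: "D v u"
    obtain v' where v': "(v, v') \<in> P" "pair_closure V D c v v' = C" using v by (auto simp: Y_def)
    have vX: "v \<in> X" using v by (simp add: Y_def)
    have V: "v \<in> V" "v' \<in> V" "u \<in> V" "c v = c v'"
      using v' X dom[OF sym[OF vu]] by (auto simp: P_def)
    have uX: "u \<in> X" using Xclosed vX vu .
    show "u \<in> Y"
    proof (cases "D v' u")
      case False
      then obtain u' where u': "u' \<in> V" "c u' = c u" "D v' u'" "\<not> D v u'"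
        using regular_exchange[OF V(1,2,4) vu] by blast
      have "pair_closure V D c u u' = C"
        using pair_closure_crossed[of v v' u u'] V u' vu False v' by simp
      then show ?thesis using uX u' vu by (auto simp: Y_def P_def)
    next
      \<comment> \<open>Here u does not separate v from v'. Their neighbourhoods in the class of u
        have the same size, at most half of the class, and share u, so some z of that class is
        missed by both. Exchange on (u, z) yields one y such that (u, z) is crossed with (v, y) and
        with (v', y); hence its closure contains v and v', and maximality applies.\<close>
      case True
      let ?\<omega> = "c u"
      let ?N = "\<lambda>w. {x\<in>V. D w x \<and> c x = ?\<omega>}"
      have "card (?N v \<union> ?N v') < card {x\<in>V. c x = ?\<omega>}"
      proof -
        have "u \<in> ?N v \<inter> ?N v'" using V vu True by auto
        then have "card (?N v \<inter> ?N v') > 0" using fin by (auto simp: card_gt_0_iff)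
        moreover have "card (?N v) + card (?N v') = card (?N v \<union> ?N v') + card (?N v \<inter> ?N v')"
          using fin by (intro card_Un_Int) auto
        moreover have "card (?N v) = card (?N v')" using reg V by blast
        ultimately show ?thesis using half[OF V(1), of ?\<omega>] by linarith
      qed
      then obtain z where z: "z \<in> V" "c z = ?\<omega>" "\<not> D v z" "\<not> D v' z"
      proof -
        have "\<not> {x\<in>V. c x = ?\<omega>} \<subseteq> ?N v \<union> ?N v'"
        proof
          assume "{x\<in>V. c x = ?\<omega>} \<subseteq> ?N v \<union> ?N v'"
          then have "card {x\<in>V. c x = ?\<omega>} \<le> card (?N v \<union> ?N v')" using fin by (intro card_mono) auto
          then show False using \<open>card (?N v \<union> ?N v') < _\<close> by simp
        qed
        then show thesis using that by blast
      qed
      have "D u v" "\<not> D z v" "\<not> D z v'" "D u v'" using vu True z sym by blast+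
      then obtain y where y: "y \<in> V" "c y = c v" "D z y" "\<not> D u y"
        using regular_exchange[OF V(3) z(1) z(2)[symmetric] \<open>D u v\<close> \<open>\<not> D z v\<close>] by blast
      have ysym: "D y z" "\<not> D y u" using y sym by blast+
      have 1: "pair_closure V D c v y = pair_closure V D c u z"
        using pair_closure_crossed[of v y u z] V y z vu ysym by simp
      have 2: "pair_closure V D c v' y = pair_closure V D c u z"
        using pair_closure_crossed[of v' y u z] V y z True ysym by simp
      have "v \<in> pair_closure V D c u z" using pair_closure_props(2)[OF V(1) y(1)] 1 by simp
      moreover have "v' \<in> pair_closure V D c u z" using pair_closure_props(2)[OF V(2) y(1)] 2 by simp
      ultimately have "C \<subseteq> pair_closure V D c u z"
        using pair_closure_mono[OF V(3) z(1), of v v'] v' by simp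
      moreover have "(u, z) \<in> P" using uX z vu by (auto simp: P_def)
      ultimately show ?thesis using maximal uX by (auto simp: Y_def)
    qed
  qed
  have "X \<subseteq> C"
  proof
    fix v assume "v \<in> X"
    then obtain v' where "(v, v') \<in> P" "pair_closure V D c v v' = C"
      using \<open>Y = X\<close> unfolding Y_def by blast
    then show "v \<in> C" using pair_closure_props(2)[of v v'] X by (auto simp: P_def)
  qed
  then show ?thesis using aP by (auto simp: C_def P_def)
qed

end
end

subsection \<open>Random sets\<close>

definition bern :: "'e set \<Rightarrow> real \<Rightarrow> ('e \<Rightarrow> bool) pmf" where
  "bern E p = Pi_pmf E False (\<lambda>_. bernoulli_pmf p)"

abbreviation bern_exp :: "'e set \<Rightarrow> real \<Rightarrow> (('e \<Rightarrow> bool) \<Rightarrow> real) \<Rightarrow> real" where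
  "bern_exp E p \<equiv> measure_pmf.expectation (bern E p)"

definition depends_on :: "'e set \<Rightarrow> (('e \<Rightarrow> bool) \<Rightarrow> 'a) \<Rightarrow> bool" where
  "depends_on A f \<longleftrightarrow> (\<forall>b b'. (\<forall>e\<in>A. b e = b' e) \<longrightarrow> f b = f b')"

lemma depends_onD: "depends_on A f \<Longrightarrow> (\<And>e. e \<in> A \<Longrightarrow> b e = b' e) \<Longrightarrow> f b = f b'"
  by (auto simp: depends_on_def)

lemma set_bern_subset:
  assumes "finite E" shows "set_pmf (bern E p) \<subseteq> PiE_dflt E False (\<lambda>_. UNIV)"
  using set_Pi_pmf_subset[OF assms] by (fastforce simp: bern_def PiE_dflt_def)

lemma finite_set_bern: "finite E \<Longrightarrow> finite (set_pmf (bern E p))"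
  using set_bern_subset by (rule finite_subset) auto

lemma integrable_bern [simp]:
  fixes f :: "_ \<Rightarrow> real"
  shows "finite E \<Longrightarrow> integrable (measure_pmf (bern E p)) f"
  by (intro integrable_measure_pmf_finite finite_set_bern)

lemma bern_split:
  assumes "finite E" "A \<subseteq> E"
  shows "bern E p = bern (E - A) p \<bind> (\<lambda>g. map_pmf (\<lambda>f e. if e \<in> A then f e else g e) (bern A p))"
proof -
  have fin: "finite A" "finite (E - A)" using assms finite_subset by auto
  have "bern E p = Pi_pmf (A \<union> (E - A)) False (\<lambda>_. bernoulli_pmf p)"
    using assms by (simp add: bern_def Un_absorb1)
  also have "\<dots> = map_pmf (\<lambda>(f, g) x. if x \<in> A then f x else g x) (pair_pmf (bern A p) (bern (E - A) p))"
    using fin by (subst Pi_pmf_union) (auto simp: bern_def)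
  also have "\<dots> = bern A p \<bind> (\<lambda>f. bern (E - A) p \<bind> (\<lambda>g. return_pmf (\<lambda>e. if e \<in> A then f e else g e)))"
    by (simp add: pair_pmf_def map_bind_pmf)
  also have "\<dots> = bern (E - A) p \<bind> (\<lambda>g. bern A p \<bind> (\<lambda>f. return_pmf (\<lambda>e. if e \<in> A then f e else g e)))"
    by (rule bind_commute_pmf)
  finally show ?thesis by (simp add: map_pmf_def)
qed

lemma bern_exp_split:
  assumes "finite E" "A \<subseteq> E"
  shows "bern_exp E p h =
    bern_exp (E - A) p (\<lambda>g. bern_exp A p (\<lambda>f. h (\<lambda>e. if e \<in> A then f e else g e)))"
proof -
  have fin: "finite A" "finite (E - A)" using assms finite_subset by auto
  let ?q = "\<lambda>g. map_pmf (\<lambda>f e. if e \<in> A then f e else g e) (bern A p)"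
  have "bern_exp E p h = (\<Sum>g\<in>set_pmf (bern (E - A) p). pmf (bern (E - A) p) g *\<^sub>R measure_pmf.expectation (?q g) h)"
    unfolding bern_split[OF assms] using fin
    by (intro pmf_expectation_bind finite_set_bern) (auto simp: finite_set_bern)
  also have "\<dots> = bern_exp (E - A) p (\<lambda>g. measure_pmf.expectation (?q g) h)"
    using fin by (subst integral_measure_pmf[of "set_pmf (bern (E - A) p)"]) (auto simp: finite_set_bern)
  finally show ?thesis by simp
qed

lemma bern_exp_restrict:
  assumes "finite E" "A \<subseteq> E" "depends_on A f"
  shows "bern_exp E p f = bern_exp A p f"
proof -
  have "f (\<lambda>e. if e \<in> A then b e else g e) = f b" for b g
    using assms(3) by (rule depends_onD) auto
  then show ?thesis by (simp add: bern_exp_split[OF assms(1,2)])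
qed

text \<open>Conditioning on the coins outside \<open>A\<close>: a bound that holds for every outcome
  g of them survives averaging.\<close>

lemma bern_exp_le_cond:
  assumes "finite E" "A \<subseteq> E"
    and "\<And>g. bern_exp A p (\<lambda>f. h (\<lambda>e. if e \<in> A then f e else g e)) \<le> C"
  shows "bern_exp E p h \<le> C"
proof -
  have fin: "finite (E - A)" using assms by auto
  have "bern_exp E p h \<le> bern_exp (E - A) p (\<lambda>_. C)"
    unfolding bern_exp_split[OF assms(1,2)] using fin assms(3) by (intro integral_mono) auto
  then show ?thesis by simp
qed

lemma bern_exp_mult:
  assumes "finite E" "A \<subseteq> E" "B \<subseteq> E" "A \<inter> B = {}" "depends_on A f" "depends_on B g"
  shows "bern_exp E p (\<lambda>b. f b * g b) = bern_exp E p f * bern_exp E p g"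
proof -
  have f: "f (\<lambda>e. if e \<in> A then b e else b' e) = f b" for b b'
    using assms(5) by (rule depends_onD) auto
  have g: "g (\<lambda>e. if e \<in> A then b e else b' e) = g b'" for b b'
    using assms(6) by (rule depends_onD) (use assms(4) in auto)
  have "bern_exp E p (\<lambda>b. f b * g b) = bern_exp (E - A) p (\<lambda>b. bern_exp A p f * g b)"
    by (simp add: bern_exp_split[OF assms(1,2)] f g)
  also have "\<dots> = bern_exp A p f * bern_exp (E - A) p g" by simp
  also have "bern_exp (E - A) p g = bern_exp B p g"
    using assms by (intro bern_exp_restrict) auto
  also have "bern_exp A p f = bern_exp E p f" using assms by (intro bern_exp_restrict[symmetric])
  also have "bern_exp B p g = bern_exp E p g" using assms by (intro bern_exp_restrict[symmetric])
  finally show ?thesis .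
qed

lemma bern_exp_prod:
  assumes "finite E" "finite I" "\<And>i. i \<in> I \<Longrightarrow> A i \<subseteq> E" "disjoint_family_on A I"
    "\<And>i. i \<in> I \<Longrightarrow> depends_on (A i) (f i)"
  shows "bern_exp E p (\<lambda>b. \<Prod>i\<in>I. f i b) = (\<Prod>i\<in>I. bern_exp E p (f i))"
  using assms(2-)
proof (induction I rule: finite_induct)
  case (insert i I)
  have "depends_on (\<Union>j\<in>I. A j) (\<lambda>b. \<Prod>j\<in>I. f j b)"
    unfolding depends_on_def
  proof (intro allI impI)
    fix b b' :: "'a \<Rightarrow> bool" assume *: "\<forall>e\<in>\<Union> (A ` I). b e = b' e"
    show "(\<Prod>j\<in>I. f j b) = (\<Prod>j\<in>I. f j b')"
      by (rule prod.cong[OF refl], rule depends_onD[OF insert.prems(3)]) (use * in auto)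
  qed
  then have "bern_exp E p (\<lambda>b. f i b * (\<Prod>j\<in>I. f j b)) = bern_exp E p (f i) * bern_exp E p (\<lambda>b. \<Prod>j\<in>I. f j b)"
    using insert.prems insert.hyps
    by (intro bern_exp_mult[OF assms(1), of "A i" "\<Union>j\<in>I. A j"]) (auto simp: disjoint_family_on_def)
  moreover have "bern_exp E p (\<lambda>b. \<Prod>j\<in>I. f j b) = (\<Prod>j\<in>I. bern_exp E p (f j))"
    using insert.prems by (intro insert.IH) (auto simp: disjoint_family_on_def)
  ultimately show ?case using insert.hyps by simp
qed simp

lemma bern_exp_single:
  fixes f :: "bool \<Rightarrow> real"
  assumes "finite E" "e \<in> E" "0 \<le> p" "p \<le> 1"
  shows "bern_exp E p (\<lambda>b. f (b e)) = p * f True + (1 - p) * f False"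
proof -
  have "map_pmf (\<lambda>b. b e) (bern E p) = bernoulli_pmf p"
    using assms by (simp add: bern_def Pi_pmf_component)
  then have "bern_exp E p (\<lambda>b. f (b e)) = measure_pmf.expectation (bernoulli_pmf p) f"
    by (metis integral_map_pmf)
  then show ?thesis using assms by simp
qed

lemma bern_exp_prod_single:
  fixes f :: "_ \<Rightarrow> bool \<Rightarrow> real"
  assumes "finite E" "S \<subseteq> E" "0 \<le> p" "p \<le> 1"
  shows "bern_exp E p (\<lambda>b. \<Prod>e\<in>S. f e (b e)) = (\<Prod>e\<in>S. p * f e True + (1 - p) * f e False)"
proof -
  have "bern_exp E p (\<lambda>b. \<Prod>e\<in>S. f e (b e)) = (\<Prod>e\<in>S. bern_exp E p (\<lambda>b. f e (b e)))"
    using assms finite_subset[OF assms(2,1)]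
    by (intro bern_exp_prod[where A = "\<lambda>e. {e}"]) (auto simp: disjoint_family_on_def depends_on_def)
  also have "\<dots> = (\<Prod>e\<in>S. p * f e True + (1 - p) * f e False)"
    using assms by (intro prod.cong refl bern_exp_single) auto
  finally show ?thesis .
qed

section \<open>Events and union bounds\<close>

abbreviation bern_prob :: "'e set \<Rightarrow> real \<Rightarrow> (('e \<Rightarrow> bool) \<Rightarrow> bool) \<Rightarrow> real" where
  "bern_prob E p Q \<equiv> measure_pmf.prob (bern E p) {b. Q b}"

lemma bern_prob_exp: "bern_prob E p Q = bern_exp E p (\<lambda>b. of_bool (Q b))"
proof -
  have "(\<lambda>b. of_bool (Q b)) = (indicator {b. Q b} :: _ \<Rightarrow> real)" by (auto simp: indicator_def)
  then show ?thesis by simp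
qed

text \<open>Samples are almost surely False off \<open>E\<close>, so inclusions between events need
  to be checked only for such functions.\<close>

lemma bern_prob_mono_supp:
  assumes "finite E" "\<And>b. (\<And>e. e \<notin> E \<Longrightarrow> \<not> b e) \<Longrightarrow> Q b \<Longrightarrow> R b"
  shows "bern_prob E p Q \<le> bern_prob E p R"
proof -
  have "bern_prob E p Q = measure_pmf.prob (bern E p) ({b. Q b} \<inter> set_pmf (bern E p))"
    by (simp add: measure_Int_set_pmf)
  also have "\<dots> \<le> bern_prob E p R"
    using set_bern_subset[OF assms(1), of p] assms(2)
    by (intro measure_pmf.finite_measure_mono) (auto simp: PiE_dflt_def subset_iff)
  finally show ?thesis .
qed

lemma bern_prob_union:
  assumes "finite E" "\<And>b. (\<And>e. e \<notin> E \<Longrightarrow> \<not> b e) \<Longrightarrow> Q b \<Longrightarrow> \<exists>i\<in>I. R i b" "finite I"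
  shows "bern_prob E p Q \<le> (\<Sum>i\<in>I. bern_prob E p (R i))"
proof -
  have "bern_prob E p Q \<le> bern_prob E p (\<lambda>b. \<exists>i\<in>I. R i b)"
    using assms by (intro bern_prob_mono_supp) auto
  also have "{b. \<exists>i\<in>I. R i b} = (\<Union>i\<in>I. {b. R i b})" by auto
  also have "measure_pmf.prob (bern E p) \<dots> \<le> (\<Sum>i\<in>I. bern_prob E p (R i))"
    using assms(3) by (intro measure_pmf.finite_measure_subadditive_finite) auto
  finally show ?thesis by simp
qed

lemma bern_prob_union2:
  assumes "finite E" "\<And>b. (\<And>e. e \<notin> E \<Longrightarrow> \<not> b e) \<Longrightarrow> Q b \<Longrightarrow> R b \<or> R' b"
  shows "bern_prob E p Q \<le> bern_prob E p R + bern_prob E p R'"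
proof -
  have "bern_prob E p Q \<le> (\<Sum>i\<in>{True, False}. bern_prob E p (if i then R else R'))"
    using assms by (intro bern_prob_union) auto
  then show ?thesis by simp
qed

lemma bern_prob_single:
  assumes "finite E" "e \<in> E" "0 \<le> p" "p \<le> 1"
  shows "bern_prob E p (\<lambda>b. b e) = p"
  unfolding bern_prob_exp using bern_exp_single[OF assms, of of_bool] by simp

lemma bernoulli_xor:
  assumes "0 \<le> q" "q \<le> 1" "0 \<le> r" "r \<le> 1" "p = r * (1 - q) + (1 - r) * q"
  shows "bernoulli_pmf p = bernoulli_pmf r \<bind> (\<lambda>x. map_pmf (\<lambda>y. x \<noteq> y) (bernoulli_pmf q))"
proof (rule pmf_eqI)
  have "0 \<le> p" using assms by simp
  moreover have "p \<le> 1"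
  proof -
    have "1 - p = r * q + (1 - r) * (1 - q)" using assms(5) by (simp add: algebra_simps)
    moreover have "\<dots> \<ge> 0" using assms by (intro add_nonneg_nonneg mult_nonneg_nonneg) auto
    ultimately show ?thesis by simp
  qed
  moreover have "map_pmf (\<lambda>y. True \<noteq> y) (bernoulli_pmf q) = map_pmf Not (bernoulli_pmf q)"
    by (simp add: fun_eq_iff)
  moreover have "pmf (map_pmf Not (bernoulli_pmf q)) x = (if x then 1 - q else q)" for x
    using pmf_map_inj'[of Not "bernoulli_pmf q" "\<not> x"] assms by (simp add: inj_def)
  ultimately show "pmf (bernoulli_pmf p) x = pmf (bernoulli_pmf r \<bind> (\<lambda>x. map_pmf (\<lambda>y. x \<noteq> y) (bernoulli_pmf q))) x" for x
    using assms by (cases x) (simp_all add: pmf_bind map_pmf_ident algebra_simps)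
qed

text \<open>Expose the coins of density r first. A bound at density q that is uniform in the
  resulting shift g carries over to density p.\<close>

lemma bern_prob_xor:
  assumes "finite E" "0 \<le> q" "q \<le> 1" "0 \<le> r" "r \<le> 1" "p = r * (1 - q) + (1 - r) * q"
    and "\<And>g. bern_prob E q (\<lambda>b. Q (\<lambda>e. g e \<noteq> b e)) \<le> C"
  shows "bern_prob E p Q \<le> C"
proof -
  have "bern E p = bern E r \<bind> (\<lambda>g. Pi_pmf E False (\<lambda>e. map_pmf (\<lambda>y. g e \<noteq> y) (bernoulli_pmf q)))"
    unfolding bern_def bernoulli_xor[OF assms(2-6)] using assms(1) by (rule Pi_pmf_bind)
  also have "\<dots> = bern E r \<bind> (\<lambda>g. map_pmf (\<lambda>b e. g e \<noteq> b e) (bern E q))"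
  proof (rule bind_pmf_cong[OF refl])
    fix g assume "g \<in> set_pmf (bern E r)"
    then have g: "\<not> g e" if "e \<notin> E" for e
      using set_bern_subset[OF assms(1), of r] that by (auto simp: PiE_dflt_def)
    have "Pi_pmf E False (\<lambda>e. map_pmf (\<lambda>y. g e \<noteq> y) (bernoulli_pmf q))
        = Pi_pmf E False (\<lambda>e. bernoulli_pmf q \<bind> (\<lambda>y. return_pmf (g e \<noteq> y)))"
      by (simp add: map_pmf_def)
    also have "\<dots> = bern E q \<bind> (\<lambda>b. Pi_pmf E False (\<lambda>e. return_pmf (g e \<noteq> b e)))"
      unfolding bern_def using assms(1) by (rule Pi_pmf_bind)
    also have "\<dots> = bern E q \<bind> (\<lambda>b. return_pmf (\<lambda>e. g e \<noteq> b e))"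
    proof (rule bind_pmf_cong[OF refl])
      fix b assume "b \<in> set_pmf (bern E q)"
      then have "\<not> b e" if "e \<notin> E" for e
        using set_bern_subset[OF assms(1), of q] that by (auto simp: PiE_dflt_def)
      then show "Pi_pmf E False (\<lambda>e. return_pmf (g e \<noteq> b e)) = return_pmf (\<lambda>e. g e \<noteq> b e)"
        using assms(1) g by (simp add: fun_eq_iff)
    qed
    finally show "Pi_pmf E False (\<lambda>e. map_pmf (\<lambda>y. g e \<noteq> y) (bernoulli_pmf q)) = map_pmf (\<lambda>b e. g e \<noteq> b e) (bern E q)"
      by (simp add: map_pmf_def)
  qed
  finally have eq: "bern E p = bern E r \<bind> (\<lambda>g. map_pmf (\<lambda>b e. g e \<noteq> b e) (bern E q))" .
  have "bern_prob E p Q = bern_exp E p (\<lambda>b. of_bool (Q b))" by (rule bern_prob_exp)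
  also have "\<dots> = (\<Sum>g\<in>set_pmf (bern E r). pmf (bern E r) g *\<^sub>R bern_exp E q (\<lambda>b. of_bool (Q (\<lambda>e. g e \<noteq> b e))))"
    unfolding eq using assms(1) by (subst pmf_expectation_bind[of "set_pmf (bern E r)"]) (auto simp: finite_set_bern)
  also have "\<dots> \<le> (\<Sum>g\<in>set_pmf (bern E r). pmf (bern E r) g *\<^sub>R C)"
    using assms(7) unfolding bern_prob_exp by (intro sum_mono scaleR_left_mono) auto
  also have "\<dots> = C"
    using assms(1) by (simp add: sum_distrib_right[symmetric] sum_pmf_eq_1 finite_set_bern)
  finally show ?thesis .
qed

subsection \<open>Small generated sets\<close>

definition xor_adj :: "'v set set \<Rightarrow> ('v set \<Rightarrow> bool) \<Rightarrow> 'v \<Rightarrow> 'v \<Rightarrow> bool" where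
  "xor_adj G0 b u v \<longleftrightarrow> ({u, v} \<in> G0) \<noteq> b {u, v}"

text \<open>\<open>R\<close> plays the role of ``has the same colour''.\<close>

definition generated_set ::
  "'v set \<Rightarrow> ('v \<Rightarrow> 'v \<Rightarrow> bool) \<Rightarrow> 'v \<Rightarrow> 'v \<Rightarrow> 'v set \<Rightarrow> bool" where
  "generated_set V adj a a' T \<longleftrightarrow> T \<subseteq> V \<and> a \<in> T \<and> a' \<in> T \<and> (\<exists>R.
     (\<forall>v\<in>T. \<exists>v'\<in>T. v' \<noteq> v \<and> R v v') \<and>
     (\<forall>w\<in>V - T. \<forall>v\<in>T. \<forall>v'\<in>T. R v v' \<longrightarrow> adj w v = adj w v') \<and>
     (\<forall>I\<subseteq>T. a \<in> I \<longrightarrow> a' \<in> I \<longrightarrow>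
        (\<forall>v\<in>I. \<forall>v'\<in>I. R v v' \<longrightarrow> (\<forall>u\<in>T - I. adj u v = adj u v')) \<longrightarrow> I = T))"

definition trace_on :: "'v set set \<Rightarrow> 'v set \<Rightarrow> 'v \<Rightarrow> 'v set" where
  "trace_on G0 S v = {w\<in>S. {w, v} \<in> G0}"

text \<open>The state of an exploration of an unknown generated set \<open>T\<close>: \<open>I \<subseteq> T\<close>; \<open>Q\<close> and \<open>X\<close> avoid \<open>T\<close>,
  where no random edge joins \<open>Q\<close> to \<open>T\<close> and every vertex of \<open>X\<close> is joined to \<open>T\<close> by a random edge;
  the random edges from \<open>B\<close> to \<open>T\<close> end in \<open>I\<close>; \<open>F\<close> consists of known random edges.\<close>

definition explored ::
  "'v set \<Rightarrow> 'v set set \<Rightarrow> 'v \<Rightarrow> 'v \<Rightarrow> nat \<Rightarrow> 'v set \<Rightarrow> 'v set \<Rightarrow> 'v set \<Rightarrow> 'v set \<Rightarrow> 'v set set \<Rightarrow>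
   ('v set \<Rightarrow> bool) \<Rightarrow> bool" where
  "explored V G0 a a' s I B Q X F b \<longleftrightarrow> (\<exists>T. generated_set V (xor_adj G0 b) a a' T \<and> card T = s \<and>
     I \<subseteq> T \<and> Q \<inter> T = {} \<and> X \<inter> T = {} \<and>
     (\<forall>q\<in>Q. \<forall>v\<in>T. \<not> b {q, v}) \<and> (\<forall>x\<in>X. \<exists>v\<in>T. b {x, v}) \<and>
     (\<forall>v\<in>B. \<forall>u\<in>T - I. \<not> b {v, u}) \<and> (\<forall>e\<in>F. b e))"

lemma prod_of_bool:
  "finite A \<Longrightarrow> (\<Prod>x\<in>A. of_bool (P x) :: 'a :: comm_semiring_1) = of_bool (\<forall>x\<in>A. P x)"
  by (induction A rule: finite_induct) auto

text \<open>Deleting w maps the new traces onto the old ones and merges those of v and v', so the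
  number of distinct traces grows. It is the progress measure when the exploration adds a vertex to
  \<open>Q\<close>, and it never exceeds \<open>card I\<close>.\<close>

lemma card_trace_refine:
  assumes "finite I" "w \<notin> Q" "v \<in> I" "v' \<in> I" "trace_on G0 Q v = trace_on G0 Q v'"
    "({w, v} \<in> G0) \<noteq> ({w, v'} \<in> G0)"
  shows "card (trace_on G0 Q ` I) < card (trace_on G0 (insert w Q) ` I)"
proof -
  let ?f = "trace_on G0 Q" and ?g = "trace_on G0 (insert w Q)"
  have f: "?f x = ?g x - {w}" for x using assms(2) by (auto simp: trace_on_def)
  have im: "?f ` I = (\<lambda>S. S - {w}) ` (?g ` I)" unfolding image_image f ..
  have ne: "?g v \<noteq> ?g v'" using assms(6) by (auto simp: trace_on_def)
  have "?g v - {w} = ?g v' - {w}" using assms(5) unfolding f .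
  then have "\<not> inj_on (\<lambda>S. S - {w}) (?g ` I)"
    using inj_onD[of "\<lambda>S. S - {w}" "?g ` I" "?g v" "?g v'"] ne assms(3,4) by blast
  then show ?thesis unfolding im using assms(1)
    by (metis card_image_le eq_card_imp_inj_on finite_imageI le_neq_implies_less)
qed

definition star :: "'v set \<Rightarrow> 'v \<Rightarrow> 'v set set" where
  "star T w = (\<lambda>v. {w, v}) ` T"

lemma inj_on_star: "w \<notin> T \<Longrightarrow> inj_on (\<lambda>v. {w, v}) T"
  by (auto simp: inj_on_def doubleton_eq_iff)

lemma star_subset: "w \<in> V \<Longrightarrow> T \<subseteq> V \<Longrightarrow> w \<notin> T \<Longrightarrow> star T w \<subseteq> all_edges V"
  by (auto simp: star_def all_edges_def card_insert_if)

lemma finite_all_edges: "finite V \<Longrightarrow> finite (all_edges V)"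
  by (rule finite_subset[of _ "Pow V"]) (auto simp: all_edges_def)

context
  fixes V :: "'v set" and p :: real
  assumes fin: "finite V" and p: "0 \<le> p" "p \<le> 1"
begin

section \<open>Random edges from a vertex to a fixed set\<close>

lemma prob_touched:
  assumes "w \<in> V" "T \<subseteq> V" "w \<notin> T"
  shows "bern_prob (all_edges V) p (\<lambda>b. \<exists>v\<in>T. b {w, v}) \<le> real (card T) * p"
proof -
  have "bern_prob (all_edges V) p (\<lambda>b. \<exists>v\<in>T. b {w, v}) \<le> (\<Sum>v\<in>T. bern_prob (all_edges V) p (\<lambda>b. b {w, v}))"
    using finite_all_edges[OF fin] finite_subset[OF assms(2) fin] by (intro bern_prob_union) auto
  also have "\<dots> = (\<Sum>v\<in>T. p)"
    using star_subset[OF assms] finite_all_edges[OF fin] p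
    by (intro sum.cong refl bern_prob_single) (auto simp: star_def)
  finally show ?thesis by simp
qed

lemma prob_only:
  assumes "w \<in> V" "T \<subseteq> V" "w \<notin> T" "v \<in> T"
  shows "bern_prob (all_edges V) p (\<lambda>b. \<forall>u\<in>T. b {w, u} = (u = v)) = p * (1 - p) ^ (card T - 1)"
proof -
  have finT: "finite T" using assms fin finite_subset by blast
  have "bern_prob (all_edges V) p (\<lambda>b. \<forall>u\<in>T. b {w, u} = (u = v))
      = bern_exp (all_edges V) p (\<lambda>b. \<Prod>e\<in>star T w. of_bool (b e = (e = {w, v})))"
  proof -
    have "of_bool (\<forall>u\<in>T. b {w, u} = (u = v)) = (\<Prod>e\<in>star T w. of_bool (b e = (e = {w, v})) :: real)" for b
    proof -
      have "(\<Prod>e\<in>star T w. of_bool (b e = (e = {w, v})) :: real) = of_bool (\<forall>e\<in>star T w. b e = (e = {w, v}))"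
        using finT by (intro prod_of_bool) (simp add: star_def)
      also have "(\<forall>e\<in>star T w. b e = (e = {w, v})) = (\<forall>u\<in>T. b {w, u} = (u = v))"
        using assms by (auto simp: star_def doubleton_eq_iff)
      finally show ?thesis by simp
    qed
    then show ?thesis unfolding bern_prob_exp by presburger
  qed
  also have "\<dots> = (\<Prod>e\<in>star T w. p * of_bool (True = (e = {w, v})) + (1 - p) * of_bool (False = (e = {w, v})))"
    using star_subset[OF assms(1-3)] finite_all_edges[OF fin] p by (intro bern_exp_prod_single) auto
  also have "\<dots> = (\<Prod>u\<in>T. if u = v then p else 1 - p)"
    unfolding star_def using assms
    by (subst prod.reindex[OF inj_on_star[OF assms(3)]]) (auto intro!: prod.cong simp: doubleton_eq_iff)
  also have "\<dots> = p * (1 - p) ^ (card T - 1)"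
    using assms(4) finT by (subst prod.remove[of _ v]) (auto simp: card_Diff_singleton)
  finally show ?thesis .
qed

text \<open>The events that only v is hit are disjoint, so exactly one hit has probability \<tau> (1
  - p)^(card T - 1) with \<tau> = card T * p, and Bernoulli's inequality bounds the power below by
  2/3.\<close>

lemma prob_not_touched_once:
  assumes "w \<in> V" "T \<subseteq> V" "w \<notin> T" and small: "real (card T) * p \<le> 1 / 3"
  shows "bern_prob (all_edges V) p (\<lambda>b. \<not> (\<exists>v\<in>T. \<forall>u\<in>T. b {w, u} = (u = v)))
     \<le> exp (- (2 / 3) * (real (card T) * p))"
proof -
  let ?P = "\<lambda>Q. bern_prob (all_edges V) p Q" and ?\<tau> = "real (card T) * p"
  have finT: "finite T" using assms fin finite_subset by blast
  have "{b. \<exists>v\<in>T. \<forall>u\<in>T. b {w, u} = (u = v)} = (\<Union>v\<in>T. {b. \<forall>u\<in>T. b {w, u} = (u = v)})" by auto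
  then have "?P (\<lambda>b. \<exists>v\<in>T. \<forall>u\<in>T. b {w, u} = (u = v)) = (\<Sum>v\<in>T. ?P (\<lambda>b. \<forall>u\<in>T. b {w, u} = (u = v)))"
    using finT by (simp, intro measure_pmf.finite_measure_finite_Union) (auto simp: disjoint_family_on_def)
  also have "\<dots> = (\<Sum>v\<in>T. p * (1 - p) ^ (card T - 1))"
    using prob_only[OF assms(1-3)] by (intro sum.cong) auto
  also have "\<dots> = ?\<tau> * (1 - p) ^ (card T - 1)" by simp
  finally have 1: "?P (\<lambda>b. \<exists>v\<in>T. \<forall>u\<in>T. b {w, u} = (u = v)) = ?\<tau> * (1 - p) ^ (card T - 1)" .
  have "1 + real (card T - 1) * (- p) \<le> (1 + - p) ^ (card T - 1)"
    using p by (intro Bernoulli_inequality) auto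
  moreover have "real (card T - 1) * p \<le> ?\<tau>" using p by (intro mult_right_mono) auto
  ultimately have "2 / 3 \<le> (1 - p) ^ (card T - 1)" using small by simp
  then have 2: "?\<tau> * (2 / 3) \<le> ?\<tau> * (1 - p) ^ (card T - 1)" using p by (intro mult_left_mono) auto
  have "?P (\<lambda>b. \<not> (\<exists>v\<in>T. \<forall>u\<in>T. b {w, u} = (u = v))) = 1 - ?P (\<lambda>b. \<exists>v\<in>T. \<forall>u\<in>T. b {w, u} = (u = v))"
    using measure_pmf.prob_compl[of "{b. \<exists>v\<in>T. \<forall>u\<in>T. b {w, u} = (u = v)}" "bern (all_edges V) p"]
    by (simp only: Compl_eq_Diff_UNIV[symmetric] Collect_neg_eq space_measure_pmf sets_measure_pmf UNIV_I)
  also have "\<dots> \<le> 1 + - (2 / 3) * ?\<tau>" using 1 2 by simp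
  also have "\<dots> \<le> exp (- (2 / 3) * ?\<tau>)" by (rule exp_ge_add_one_self)
  finally show ?thesis .
qed

text \<open>The edges of \<open>F\<close> lie inside \<open>I\<close>, and the stars from different
  outside vertices to \<open>I\<close> are disjoint from them and from each other, so all the
  conditions are independent.\<close>

lemma prob_exploration_leaf:
  assumes I: "I \<subseteq> V" and X: "X \<subseteq> V - I" and F: "F \<subseteq> all_edges I"
    and small: "real (card I) * p \<le> 1 / 3"
  shows "bern_prob (all_edges V) p (\<lambda>b. (\<forall>e\<in>F. b e) \<and> (\<forall>x\<in>X. \<exists>v\<in>I. b {x, v}) \<and>
            (\<forall>w\<in>V - I - X. \<not> (\<exists>v\<in>I. \<forall>u\<in>I. b {w, u} = (u = v))))
     \<le> p ^ card F * (1 / 2) ^ card X * exp (- (2 / 3) * (real (card I) * p) * (real (card V) - real (card I)))"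
proof -
  let ?\<tau> = "real (card I) * p" and ?E = "all_edges V"
  have finI: "finite I" and finX: "finite X" and finE: "finite ?E"
    using assms fin finite_subset finite_all_edges[OF fin] by blast+
  have FE: "F \<subseteq> ?E" using F I by (auto simp: all_edges_def)
  have finF: "finite F" using FE finE finite_subset by blast
  define J where "J = insert None (Some ` (V - I))"
  define A where "A i = (case i of None \<Rightarrow> F | Some w \<Rightarrow> star I w)" for i
  define Z where "Z i b = (case i of None \<Rightarrow> (\<forall>e\<in>F. b e) | Some w \<Rightarrow>
     (if w \<in> X then \<exists>v\<in>I. b {w, v} else \<not> (\<exists>v\<in>I. \<forall>u\<in>I. b {w, u} = (u = v))))" for i and b :: "'v set \<Rightarrow> bool"
  have finJ: "finite J" using fin by (simp add: J_def)
  have "of_bool ((\<forall>e\<in>F. b e) \<and> (\<forall>x\<in>X. \<exists>v\<in>I. b {x, v}) \<and>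
            (\<forall>w\<in>V - I - X. \<not> (\<exists>v\<in>I. \<forall>u\<in>I. b {w, u} = (u = v)))) = (\<Prod>i\<in>J. of_bool (Z i b) :: real)" for b
  proof -
    have "(\<Prod>i\<in>J. of_bool (Z i b) :: real) = of_bool (\<forall>i\<in>J. Z i b)"
      using finJ by (rule prod_of_bool)
    also have "(\<forall>i\<in>J. Z i b) \<longleftrightarrow> (\<forall>e\<in>F. b e) \<and> (\<forall>w\<in>V - I. Z (Some w) b)"
      by (auto simp: J_def Z_def)
    also have "(\<forall>w\<in>V - I. Z (Some w) b) \<longleftrightarrow> (\<forall>x\<in>X. \<exists>v\<in>I. b {x, v}) \<and>
            (\<forall>w\<in>V - I - X. \<not> (\<exists>v\<in>I. \<forall>u\<in>I. b {w, u} = (u = v)))"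
      using X unfolding Z_def by (simp split: if_splits) blast
    finally show ?thesis by simp
  qed
  then have "bern_prob ?E p (\<lambda>b. (\<forall>e\<in>F. b e) \<and> (\<forall>x\<in>X. \<exists>v\<in>I. b {x, v}) \<and>
            (\<forall>w\<in>V - I - X. \<not> (\<exists>v\<in>I. \<forall>u\<in>I. b {w, u} = (u = v))))
     = bern_exp ?E p (\<lambda>b. \<Prod>i\<in>J. of_bool (Z i b))"
    unfolding bern_prob_exp by presburger
  also have "\<dots> = (\<Prod>i\<in>J. bern_exp ?E p (\<lambda>b. of_bool (Z i b)))"
  proof (rule bern_exp_prod[OF finE finJ])
    show "A i \<subseteq> ?E" if "i \<in> J" for i
      using that FE star_subset[OF _ I] by (fastforce simp: J_def A_def)
    show "disjoint_family_on A J"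
      unfolding disjoint_family_on_def
    proof (intro ballI impI)
      fix i j assume ij: "i \<in> J" "j \<in> J" "i \<noteq> j"
      show "A i \<inter> A j = {}"
        using ij F unfolding J_def A_def star_def all_edges_def
        by (auto split: option.splits simp: doubleton_eq_iff)
    qed
    show "depends_on (A i) (\<lambda>b. of_bool (Z i b) :: real)" if "i \<in> J" for i
    proof (cases i)
      case None
      then show ?thesis by (auto simp: depends_on_def A_def Z_def)
    next
      case (Some w)
      show ?thesis unfolding depends_on_def
      proof (intro allI impI)
        fix b b' :: "'v set \<Rightarrow> bool" assume "\<forall>e\<in>A i. b e = b' e"
        then have *: "b {w, v} = b' {w, v}" if "v \<in> I" for v
          using that by (auto simp: A_def Some star_def)
        have "Z i b = Z i b'" unfolding Z_def Some using * by simp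
        then show "of_bool (Z i b) = (of_bool (Z i b') :: real)" by simp
      qed
    qed
  qed
  also have "\<dots> = bern_exp ?E p (\<lambda>b. of_bool (Z None b)) * (\<Prod>w\<in>V - I. bern_exp ?E p (\<lambda>b. of_bool (Z (Some w) b)))"
    unfolding J_def using fin by (simp add: prod.reindex)
  also have "bern_exp ?E p (\<lambda>b. of_bool (Z None b)) = p ^ card F"
  proof -
    have "(\<lambda>b. of_bool (Z None b) :: real) = (\<lambda>b. \<Prod>e\<in>F. of_bool (b e))"
      using finF by (simp add: Z_def prod_of_bool)
    then have "bern_exp ?E p (\<lambda>b. of_bool (Z None b)) = (\<Prod>e\<in>F. p * of_bool True + (1 - p) * of_bool False)"
      using bern_exp_prod_single[OF finE FE p, of "\<lambda>_. of_bool"] by simp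
    then show ?thesis by simp
  qed
  also have "p ^ card F * (\<Prod>w\<in>V - I. bern_exp ?E p (\<lambda>b. of_bool (Z (Some w) b)))
     \<le> p ^ card F * (\<Prod>w\<in>V - I. if w \<in> X then ?\<tau> else exp (- (2 / 3) * ?\<tau>))"
  proof (intro mult_left_mono prod_mono conjI)
    fix w assume w: "w \<in> V - I"
    show "0 \<le> bern_exp ?E p (\<lambda>b. of_bool (Z (Some w) b))" by simp
    show "bern_exp ?E p (\<lambda>b. of_bool (Z (Some w) b)) \<le> (if w \<in> X then ?\<tau> else exp (- (2 / 3) * ?\<tau>))"
    proof (cases "w \<in> X")
      case True
      then show ?thesis
        using prob_touched[of w I] w I unfolding bern_prob_exp Z_def by simp
    next
      case False
      then show ?thesis
        using prob_not_touched_once[of w I] w I small unfolding bern_prob_exp Z_def by simp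
    qed
  qed (use p in auto)
  also have "(\<Prod>w\<in>V - I. if w \<in> X then ?\<tau> else exp (- (2 / 3) * ?\<tau>))
      = ?\<tau> ^ card X * exp (- (2 / 3) * ?\<tau>) ^ card (V - I - X)"
  proof -
    have "(V - I) \<inter> X = X" "(V - I) \<inter> - X = V - I - X" using X by auto
    then show ?thesis using fin by (simp add: prod.If_cases)
  qed
  also have "\<dots> \<le> (1 / 2 * exp (- (2 / 3) * ?\<tau>)) ^ card X * exp (- (2 / 3) * ?\<tau>) ^ card (V - I - X)"
  proof (intro mult_right_mono power_mono)
    \<comment> \<open>A vertex of \<open>X\<close> costs \<tau>. This is traded for the exponential
      factor paid by every other outside vertex; the remaining 1/2 is the weight of the branch into
      \<open>X\<close>.\<close>
    have "t \<le> 1 / 2 * exp (- (2 / 3) * t)" if t: "0 \<le> t" "t \<le> 1 / 3" for t :: real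
    proof -
      have "exp (2 / 3 * t) \<le> 1 + 2 / 3 * t + (2 / 3 * t)\<^sup>2"
        using t by (intro exp_bound) auto
      also have "(2 / 3 * t)\<^sup>2 \<le> (2 / 9)\<^sup>2" using t by (intro power_mono) auto
      finally have "exp (2 / 3 * t) \<le> 3 / 2" using t by (simp add: power2_eq_square)
      then have "t * exp (2 / 3 * t) \<le> 1 / 3 * (3 / 2)" using t by (intro mult_mono) auto
      then have "t * exp (2 / 3 * t) * exp (- (2 / 3) * t) \<le> 1 / 2 * exp (- (2 / 3) * t)"
        by (intro mult_right_mono) auto
      then show ?thesis by (simp add: mult.assoc exp_add[symmetric])
    qed
    from this[of ?\<tau>] show "?\<tau> \<le> 1 / 2 * exp (- (2 / 3) * ?\<tau>)" using p small by auto
  qed (use p in auto)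
  also have "\<dots> = (1 / 2) ^ card X * exp (- (2 / 3) * ?\<tau>) ^ (card X + card (V - I - X))"
    by (simp only: power_add power_mult_distrib mult.assoc)
  also have "card X + card (V - I - X) = card (V - I)"
    using X fin finX by (metis card_Diff_subset card_mono finite_Diff le_add_diff_inverse)
  also have "exp (- (2 / 3) * ?\<tau>) ^ card (V - I) = exp (- (2 / 3) * ?\<tau> * (real (card V) - real (card I)))"
  proof -
    have "card (V - I) = card V - card I" "card I \<le> card V"
      using I fin finI by (auto simp: card_Diff_subset card_mono)
    then show ?thesis by (simp add: exp_of_nat_mult[symmetric] mult.commute)
  qed
  finally show ?thesis using p by (simp add: mult.assoc mult_left_mono)
qed

text \<open>Vertices of \<open>Q\<close> have no random edge to T, so mates in T have equal
  \<open>G0\<close> traces on \<open>Q\<close>. If no undecided vertex distinguishes equal traces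
  and no random edge leads from \<open>I\<close> to the rest of T, then \<open>I\<close> is closed
  and hence equals T. A vertex with a single random edge to T would distinguish the end of that edge
  from a mate of it; this is possible only for vertices of \<open>X\<close>, where nothing is
  claimed.\<close>

lemma explored_terminal:
  assumes ex: "explored V G0 a a' s I I Q X F b"
    and aI: "a \<in> I" "a' \<in> I" and QV: "Q \<subseteq> V"
    and stuck: "\<And>w v v'. w \<in> V - I - Q - X \<Longrightarrow> v \<in> I \<Longrightarrow> v' \<in> I \<Longrightarrow>
       trace_on G0 Q v = trace_on G0 Q v' \<Longrightarrow> ({w, v} \<in> G0) = ({w, v'} \<in> G0)"
  shows "card I = s \<and> (\<forall>e\<in>F. b e) \<and> (\<forall>x\<in>X. \<exists>v\<in>I. b {x, v}) \<and>
            (\<forall>w\<in>V - I - X. \<not> (\<exists>v\<in>I. \<forall>u\<in>I. b {w, u} = (u = v)))"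
proof -
  obtain T where T: "generated_set V (xor_adj G0 b) a a' T" "card T = s" "I \<subseteq> T" "Q \<inter> T = {}" "X \<inter> T = {}"
     "\<forall>q\<in>Q. \<forall>v\<in>T. \<not> b {q, v}" "\<forall>x\<in>X. \<exists>v\<in>T. b {x, v}"
     "\<forall>v\<in>I. \<forall>u\<in>T - I. \<not> b {v, u}" "\<forall>e\<in>F. b e"
    using ex unfolding explored_def by blast
  from T(1) obtain R where TV: "T \<subseteq> V" and mate: "\<forall>v\<in>T. \<exists>v'\<in>T. v' \<noteq> v \<and> R v v'"
    and out: "\<forall>w\<in>V - T. \<forall>v\<in>T. \<forall>v'\<in>T. R v v' \<longrightarrow> xor_adj G0 b w v = xor_adj G0 b w v'"
    and gen: "\<forall>I\<subseteq>T. a \<in> I \<longrightarrow> a' \<in> I \<longrightarrow>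
        (\<forall>v\<in>I. \<forall>v'\<in>I. R v v' \<longrightarrow> (\<forall>u\<in>T - I. xor_adj G0 b u v = xor_adj G0 b u v')) \<longrightarrow> I = T"
    unfolding generated_set_def by blast
  have trace: "trace_on G0 Q v = trace_on G0 Q v'" if v: "v \<in> T" "v' \<in> T" "R v v'" for v v'
  proof -
    have "({q, v} \<in> G0) = ({q, v'} \<in> G0)" if "q \<in> Q" for q
    proof -
      have "q \<in> V - T" using that QV T(4) by blast
      then have "xor_adj G0 b q v = xor_adj G0 b q v'" using out v by blast
      moreover have "\<not> b {q, v}" "\<not> b {q, v'}" using T(6) v that by blast+
      ultimately show ?thesis by (simp add: xor_adj_def)
    qed
    then show ?thesis by (auto simp: trace_on_def)
  qed
  have "I = T"
  proof (rule gen[rule_format])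
    fix v v' u assume h: "v \<in> I" "v' \<in> I" "R v v'" "u \<in> T - I"
    have "u \<in> V - I - Q - X" using h TV T(4,5) by blast
    then have "({u, v} \<in> G0) = ({u, v'} \<in> G0)" using h T(3) trace[of v v'] by (intro stuck) blast+
    moreover have "\<not> b {u, v}" "\<not> b {u, v'}" using T(8) h by (metis insert_commute)+
    ultimately show "xor_adj G0 b u v = xor_adj G0 b u v'" by (simp add: xor_adj_def)
  qed (use T(3) aI in auto)
  moreover have "\<not> (\<exists>v\<in>T. \<forall>u\<in>T. b {w, u} = (u = v))" if w: "w \<in> V - T - X" for w
  proof
    assume "\<exists>v\<in>T. \<forall>u\<in>T. b {w, u} = (u = v)"
    then obtain v where v: "v \<in> T" "\<forall>u\<in>T. b {w, u} = (u = v)" by blast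
    obtain v' where v': "v' \<in> T" "v' \<noteq> v" "R v v'" using mate v by blast
    have "w \<notin> Q" using v T(6) by blast
    then have "({w, v} \<in> G0) = ({w, v'} \<in> G0)"
      using stuck[of w v v'] w v v' trace \<open>I = T\<close> by blast
    moreover have "xor_adj G0 b w v = xor_adj G0 b w v'" using out w v v' by blast
    ultimately show False using v v' by (simp add: xor_adj_def)
  qed
  ultimately show ?thesis using T by auto
qed

section \<open>Branching of the exploration\<close>

lemma explored_branch_split:
  assumes ex: "explored V G0 a a' s I B Q X F b"
  shows "explored V G0 a a' s (insert w I) B Q X F b \<or> explored V G0 a a' s I B (insert w Q) X F b
    \<or> explored V G0 a a' s I B Q (insert w X) F b"
proof -
  obtain T where T: "generated_set V (xor_adj G0 b) a a' T" "card T = s" "I \<subseteq> T" "Q \<inter> T = {}" "X \<inter> T = {}"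
     "\<forall>q\<in>Q. \<forall>v\<in>T. \<not> b {q, v}" "\<forall>x\<in>X. \<exists>v\<in>T. b {x, v}"
     "\<forall>v\<in>B. \<forall>u\<in>T - I. \<not> b {v, u}" "\<forall>e\<in>F. b e"
    using ex unfolding explored_def by blast
  consider "w \<in> T" | "w \<notin> T" "\<forall>v\<in>T. \<not> b {w, v}" | "w \<notin> T" "\<exists>v\<in>T. b {w, v}" by blast
  then show ?thesis
  proof cases
    case 1
    then have "explored V G0 a a' s (insert w I) B Q X F b"
      unfolding explored_def using T by (intro exI[of _ T]) auto
    then show ?thesis by blast
  next
    case 2
    then have "explored V G0 a a' s I B (insert w Q) X F b"
      unfolding explored_def using T by (intro exI[of _ T]) auto
    then show ?thesis by blast
  next
    case 3
    then have "explored V G0 a a' s I B Q (insert w X) F b"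
      unfolding explored_def using T by (intro exI[of _ T]) auto
    then show ?thesis by blast
  qed
qed

lemma explored_branch_edge:
  assumes ex: "explored V G0 a a' s I B Q X F b" and v: "v \<in> I"
  shows "explored V G0 a a' s I (insert v B) Q X F b \<or>
    (\<exists>u\<in>V - I - Q - X. explored V G0 a a' s (insert u I) B Q X (insert {v, u} F) b)"
proof -
  obtain T where T: "generated_set V (xor_adj G0 b) a a' T" "card T = s" "I \<subseteq> T" "Q \<inter> T = {}" "X \<inter> T = {}"
     "\<forall>q\<in>Q. \<forall>v\<in>T. \<not> b {q, v}" "\<forall>x\<in>X. \<exists>v\<in>T. b {x, v}"
     "\<forall>v\<in>B. \<forall>u\<in>T - I. \<not> b {v, u}" "\<forall>e\<in>F. b e"
    using ex unfolding explored_def by blast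
  have TV: "T \<subseteq> V" using T(1) by (simp add: generated_set_def)
  show ?thesis
  proof (cases "\<forall>u\<in>T - I. \<not> b {v, u}")
    case True
    then have "explored V G0 a a' s I (insert v B) Q X F b"
      unfolding explored_def using T by (intro exI[of _ T]) auto
    then show ?thesis by blast
  next
    case False
    then obtain u where u: "u \<in> T - I" "b {v, u}" by blast
    then have "explored V G0 a a' s (insert u I) B Q X (insert {v, u} F) b"
      unfolding explored_def using T by (intro exI[of _ T]) auto
    moreover have "u \<in> V - I - Q - X" using u TV T by auto
    ultimately show ?thesis by blast
  qed
qed

text \<open>The right-hand side is a potential that the branches of a step share out. Deciding a
  vertex gives at most 1/101 + 1/101 + 1/2. Treating v gives 1/101 if no random edge leads to a new
  vertex of T, and otherwise n p / 101 = 100/101 over all possible ends. At a leaf \<open>I\<close>,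
  \<open>B\<close> and the set of traces have at most s elements each, whence the exponent 3
  s.\<close>

lemma prob_explored:
  assumes np: "real (card V) * p = 100" and small: "real s * p \<le> 1 / 3"
    and "I \<subseteq> V" "a \<in> I" "a' \<in> I" "B \<subseteq> I" "Q \<subseteq> V - I" "X \<subseteq> V - I - Q" "F \<subseteq> all_edges I"
  shows "bern_prob (all_edges V) p (explored V G0 a a' s I B Q X F) \<le>
    101 ^ (3 * s) * (1 / 101) ^ (card I + card B + card (trace_on G0 Q ` I)) * p ^ card F * (1 / 2) ^ card X *
    exp (- (2 / 3) * (real s * p) * (real (card V) - real s))"
  using assms(3-)
\<comment> \<open>Every step enlarges one of \<open>I\<close>, \<open>B\<close>, \<open>Q\<close>,
  \<open>X\<close>, each of which has at most \<open>card V\<close> elements.\<close>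
proof (induction "4 * card V - (card I + card B + card Q + card X)" arbitrary: I B Q X F rule: less_induct)
  case less
  define n where "n = card V"
  define L where "L = exp (- (2 / 3) * (real s * p) * (real n - real s))"
  define \<Phi> where "\<Phi> I B Q X F = 101 ^ (3 * s) * (1 / 101) ^ (card I + card B + card (trace_on G0 Q ` I)) * p ^ card F *
     (1 / 2) ^ card X * L" for I B Q X :: "'v set" and F :: "'v set set"
  let ?P = "\<lambda>I B Q X F. bern_prob (all_edges V) p (explored V G0 a a' s I B Q X F)"
  note prems = less.prems
  have finE: "finite (all_edges V)" using finite_all_edges[OF fin] .
  have fins: "finite I" "finite B" "finite Q" "finite X"
    using prems fin by (meson finite_Diff finite_subset)+
  have FE: "F \<subseteq> all_edges V" using prems(1,7) unfolding all_edges_def by blast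
  have finF: "finite F" using FE finE finite_subset by blast
  have L0: "L \<ge> 0" by (simp add: L_def)
  have \<Phi>0: "\<Phi> I B Q X F \<ge> 0" for I B Q X F using p L0 by (simp add: \<Phi>_def)
  have cards: "card I \<le> n" "card B \<le> n" "card Q \<le> n" "card X \<le> n"
    using prems fin unfolding n_def by (auto intro!: card_mono)
  have IH: "?P I' B' Q' X' F' \<le> \<Phi> I' B' Q' X' F'"
    if "card I + card B + card Q + card X < card I' + card B' + card Q' + card X'"
      "I' \<subseteq> V" "a \<in> I'" "a' \<in> I'" "B' \<subseteq> I'" "Q' \<subseteq> V - I'" "X' \<subseteq> V - I' - Q'" "F' \<subseteq> all_edges I'"
    for I' B' Q' X' F'
  proof -
    have "B' \<subseteq> V" "Q' \<subseteq> V" "X' \<subseteq> V" using that by auto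
    then have "card I' \<le> n" "card B' \<le> n" "card Q' \<le> n" "card X' \<le> n"
      using that(2) fin unfolding n_def by (auto intro: card_mono)
    then have "4 * n - (card I' + card B' + card Q' + card X') < 4 * n - (card I + card B + card Q + card X)"
      using that(1) by linarith
    then show ?thesis unfolding \<Phi>_def L_def n_def by (intro less.hyps) (use that in \<open>auto simp: n_def\<close>)
  qed
  have "?P I B Q X F \<le> \<Phi> I B Q X F"
  proof -
    consider (big) "card I > s"
      | (split) w v v' where "w \<in> V - I - Q - X" "v \<in> I" "v' \<in> I" "trace_on G0 Q v = trace_on G0 Q v'"
         "({w, v} \<in> G0) \<noteq> ({w, v'} \<in> G0)"
      | (edge) v where "v \<in> I" "v \<notin> B"
      | (stuck) "card I \<le> s" "B = I" "\<And>w v v'. w \<in> V - I - Q - X \<Longrightarrow> v \<in> I \<Longrightarrow> v' \<in> I \<Longrightarrow>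
         trace_on G0 Q v = trace_on G0 Q v' \<Longrightarrow> ({w, v} \<in> G0) = ({w, v'} \<in> G0)"
      using prems(4) by (metis not_le subset_antisym subsetI)
    then show ?thesis
    proof cases
      case big
      have "?P I B Q X F \<le> bern_prob (all_edges V) p (\<lambda>_. False)"
      proof (rule bern_prob_mono_supp[OF finE])
        fix b assume "explored V G0 a a' s I B Q X F b"
        then obtain T where "T \<subseteq> V" "card T = s" "I \<subseteq> T"
          unfolding explored_def generated_set_def by blast
        then have "card I \<le> s" using card_mono[of T I] finite_subset[OF _ fin] by blast
        then show False using big by simp
      qed
      then show ?thesis using \<Phi>0[of I B Q X F] by simp
    next
      case split
      have "?P I B Q X F \<le> ?P (insert w I) B Q X F +
          bern_prob (all_edges V) p (\<lambda>b. explored V G0 a a' s I B (insert w Q) X F b \<or> explored V G0 a a' s I B Q (insert w X) F b)"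
        by (rule bern_prob_union2[OF finE]) (use explored_branch_split in blast)
      moreover have "bern_prob (all_edges V) p (\<lambda>b. explored V G0 a a' s I B (insert w Q) X F b \<or> explored V G0 a a' s I B Q (insert w X) F b)
        \<le> ?P I B (insert w Q) X F + ?P I B Q (insert w X) F"
        by (rule bern_prob_union2[OF finE]) blast
      moreover have "?P (insert w I) B Q X F \<le> \<Phi> (insert w I) B Q X F"
        using prems split(1) fins by (intro IH) (auto simp: all_edges_def)
      moreover have "\<Phi> (insert w I) B Q X F \<le> 1 / 101 * \<Phi> I B Q X F"
      proof -
        have "card (trace_on G0 Q ` I) \<le> card (trace_on G0 Q ` insert w I)"
          using fins by (intro card_mono) auto
        then have "Suc (card I + card B + card (trace_on G0 Q ` I)) \<le>
            card (insert w I) + card B + card (trace_on G0 Q ` insert w I)"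
          using split(1) fins by simp
        then have "(1 / 101) ^ (card (insert w I) + card B + card (trace_on G0 Q ` insert w I))
           \<le> (1 / 101 :: real) ^ Suc (card I + card B + card (trace_on G0 Q ` I))"
          by (intro power_decreasing) auto
        then have "101 ^ (3 * s) * (1 / 101) ^ (card (insert w I) + card B + card (trace_on G0 Q ` insert w I)) * p ^ card F * (1 / 2) ^ card X * L
          \<le> 101 ^ (3 * s) * (1 / 101 :: real) ^ Suc (card I + card B + card (trace_on G0 Q ` I)) * p ^ card F * (1 / 2) ^ card X * L"
          using p L0 by (intro mult_right_mono mult_left_mono) auto
        then show ?thesis by (simp add: \<Phi>_def)
      qed
      moreover have "?P I B (insert w Q) X F \<le> \<Phi> I B (insert w Q) X F"
        using prems split(1) fins by (intro IH) (auto simp: all_edges_def)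
      moreover have "\<Phi> I B (insert w Q) X F \<le> 1 / 101 * \<Phi> I B Q X F"
      proof -
        have "card (trace_on G0 Q ` I) < card (trace_on G0 (insert w Q) ` I)"
          using split fins by (intro card_trace_refine[of I w Q v v']) auto
        then have "(1 / 101) ^ (card I + card B + card (trace_on G0 (insert w Q) ` I))
           \<le> (1 / 101 :: real) ^ Suc (card I + card B + card (trace_on G0 Q ` I))"
          by (intro power_decreasing) auto
        then have "101 ^ (3 * s) * (1 / 101) ^ (card I + card B + card (trace_on G0 (insert w Q) ` I)) * p ^ card F * (1 / 2) ^ card X * L
          \<le> 101 ^ (3 * s) * (1 / 101 :: real) ^ Suc (card I + card B + card (trace_on G0 Q ` I)) * p ^ card F * (1 / 2) ^ card X * L"
          using p L0 by (intro mult_right_mono mult_left_mono) auto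
        then show ?thesis by (simp add: \<Phi>_def)
      qed
      moreover have "?P I B Q (insert w X) F \<le> \<Phi> I B Q (insert w X) F"
        using prems split(1) fins by (intro IH) (auto simp: all_edges_def)
      moreover have "\<Phi> I B Q (insert w X) F = 1 / 2 * \<Phi> I B Q X F"
        using split(1) fins by (simp add: \<Phi>_def)
      ultimately show ?thesis using \<Phi>0[of I B Q X F] by linarith
    next
      case edge
      let ?U = "V - I - Q - X"
      have "?P I B Q X F \<le> ?P I (insert v B) Q X F +
          bern_prob (all_edges V) p (\<lambda>b. \<exists>u\<in>?U. explored V G0 a a' s (insert u I) B Q X (insert {v, u} F) b)"
        by (rule bern_prob_union2[OF finE]) (use explored_branch_edge edge in blast)
      moreover have "bern_prob (all_edges V) p (\<lambda>b. \<exists>u\<in>?U. explored V G0 a a' s (insert u I) B Q X (insert {v, u} F) b)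
         \<le> (\<Sum>u\<in>?U. ?P (insert u I) B Q X (insert {v, u} F))"
        using fin by (intro bern_prob_union[OF finE]) auto
      moreover have "?P I (insert v B) Q X F \<le> \<Phi> I (insert v B) Q X F"
        using prems edge fins by (intro IH) auto
      moreover have "\<Phi> I (insert v B) Q X F = 1 / 101 * \<Phi> I B Q X F"
        using edge fins by (simp add: \<Phi>_def)
      moreover have "(\<Sum>u\<in>?U. ?P (insert u I) B Q X (insert {v, u} F)) \<le> (\<Sum>u\<in>?U. p * (1 / 101 * \<Phi> I B Q X F))"
      proof (rule sum_mono)
        fix u assume u: "u \<in> ?U"
        have F': "insert {v, u} F \<subseteq> all_edges (insert u I)"
          using prems u edge by (auto simp: all_edges_def card_insert_if)
        have nF: "{v, u} \<notin> F" using prems u by (auto simp: all_edges_def)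
        have "?P (insert u I) B Q X (insert {v, u} F) \<le> \<Phi> (insert u I) B Q X (insert {v, u} F)"
          using prems u fins F' by (intro IH) auto
        also have "\<dots> \<le> p * (1 / 101 * \<Phi> I B Q X F)"
        proof -
          have "card (trace_on G0 Q ` I) \<le> card (trace_on G0 Q ` insert u I)"
            using fins by (intro card_mono) auto
          then have "Suc (card I + card B + card (trace_on G0 Q ` I)) \<le>
              card (insert u I) + card B + card (trace_on G0 Q ` insert u I)"
            using u fins by simp
          then have "(1 / 101) ^ (card (insert u I) + card B + card (trace_on G0 Q ` insert u I))
             \<le> (1 / 101 :: real) ^ Suc (card I + card B + card (trace_on G0 Q ` I))"
            by (intro power_decreasing) auto
          then have "101 ^ (3 * s) * (1 / 101) ^ (card (insert u I) + card B + card (trace_on G0 Q ` insert u I)) * p ^ Suc (card F) * (1 / 2) ^ card X * L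
            \<le> 101 ^ (3 * s) * (1 / 101 :: real) ^ Suc (card I + card B + card (trace_on G0 Q ` I)) * p ^ Suc (card F) * (1 / 2) ^ card X * L"
            using p L0 by (intro mult_right_mono mult_left_mono) auto
          then show ?thesis using nF finF by (simp add: \<Phi>_def mult_ac)
        qed
        finally show "?P (insert u I) B Q X (insert {v, u} F) \<le> p * (1 / 101 * \<Phi> I B Q X F)" .
      qed
      moreover have "(\<Sum>u\<in>?U. p * (1 / 101 * \<Phi> I B Q X F)) \<le> 100 / 101 * \<Phi> I B Q X F"
      proof -
        have "card ?U \<le> n" unfolding n_def using fin by (intro card_mono) auto
        then have "real (card ?U) * p \<le> 100" using np p mult_right_mono[of "real (card ?U)" "real n" p] by (simp add: n_def)
        then have "real (card ?U) * p * (1 / 101 * \<Phi> I B Q X F) \<le> 100 * (1 / 101 * \<Phi> I B Q X F)"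
          using \<Phi>0 by (intro mult_right_mono) auto
        then show ?thesis by simp
      qed
      ultimately show ?thesis by linarith
    next
      case stuck
      show ?thesis
      proof (cases "card I = s")
        case False
        have "?P I B Q X F \<le> bern_prob (all_edges V) p (\<lambda>_. False)"
        proof (rule bern_prob_mono_supp[OF finE])
          fix b assume "explored V G0 a a' s I B Q X F b"
          then have "card I = s"
            using explored_terminal[of G0 a a' s I Q X F b] prems stuck by blast
          then show False using False by simp
        qed
        then show ?thesis using \<Phi>0[of I B Q X F] by simp
      next
        case True
        have "?P I B Q X F \<le> bern_prob (all_edges V) p (\<lambda>b. (\<forall>e\<in>F. b e) \<and> (\<forall>x\<in>X. \<exists>v\<in>I. b {x, v}) \<and>
            (\<forall>w\<in>V - I - X. \<not> (\<exists>v\<in>I. \<forall>u\<in>I. b {w, u} = (u = v))))"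
        proof (rule bern_prob_mono_supp[OF finE])
          fix b assume "explored V G0 a a' s I B Q X F b"
          then show "(\<forall>e\<in>F. b e) \<and> (\<forall>x\<in>X. \<exists>v\<in>I. b {x, v}) \<and>
            (\<forall>w\<in>V - I - X. \<not> (\<exists>v\<in>I. \<forall>u\<in>I. b {w, u} = (u = v)))"
            using explored_terminal[of G0 a a' s I Q X F b] prems stuck by blast
        qed
        also have "\<dots> \<le> p ^ card F * (1 / 2) ^ card X * L"
          using prob_exploration_leaf[of I X F] prems small True unfolding L_def n_def by auto
        also have "\<dots> \<le> \<Phi> I B Q X F"
        proof -
          have "card (trace_on G0 Q ` I) \<le> s" using card_image_le[of I "trace_on G0 Q"] fins True by simp
          then have "(1 / 101 :: real) ^ (3 * s) \<le> (1 / 101) ^ (card I + card B + card (trace_on G0 Q ` I))"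
            using True stuck(2) by (intro power_decreasing) auto
          then have "101 ^ (3 * s) * (1 / 101 :: real) ^ (3 * s) \<le> 101 ^ (3 * s) * (1 / 101) ^ (card I + card B + card (trace_on G0 Q ` I))"
            by (intro mult_left_mono) auto
          then have "1 \<le> 101 ^ (3 * s) * (1 / 101 :: real) ^ (card I + card B + card (trace_on G0 Q ` I))"
            by (simp add: power_mult_distrib[symmetric])
          then have "1 * (p ^ card F * (1 / 2) ^ card X * L) \<le>
             101 ^ (3 * s) * (1 / 101 :: real) ^ (card I + card B + card (trace_on G0 Q ` I)) * (p ^ card F * (1 / 2) ^ card X * L)"
            using p L0 by (intro mult_right_mono) auto
          then show ?thesis by (simp add: \<Phi>_def mult.assoc)
        qed
        finally show ?thesis .
      qed
    qed
  qed
  then show ?case unfolding \<Phi>_def L_def n_def .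
qed

text \<open>For p = 100 / n and s <= n / 300 the exponent at the leaves is 200/3 (1 - s/n) s >= 66
  s, and the branching costs 101 ^ (3 s) <= exp (16 s).\<close>

lemma prob_generated_set:
  assumes np: "real (card V) * p = 100" and s: "300 * s \<le> card V" and a: "a \<in> V" "a' \<in> V"
  shows "bern_prob (all_edges V) p (\<lambda>b. \<exists>T. generated_set V (xor_adj G0 b) a a' T \<and> card T = s) \<le> exp (- 50 * real s)"
proof -
  define n where "n = card V"
  have finE: "finite (all_edges V)" using finite_all_edges[OF fin] .
  have n0: "real n > 0" using np unfolding n_def by (cases "card V = 0") auto
  have pn: "p = 100 / real n" using np n0 by (simp add: n_def field_simps)
  have sn: "real s \<le> real n / 300" using s by (simp add: n_def)
  have small: "real s * p \<le> 1 / 3" using sn n0 by (simp add: pn field_simps)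
  have "bern_prob (all_edges V) p (\<lambda>b. \<exists>T. generated_set V (xor_adj G0 b) a a' T \<and> card T = s)
      \<le> bern_prob (all_edges V) p (explored V G0 a a' s {a, a'} {} {} {} {})"
    by (rule bern_prob_mono_supp[OF finE]) (auto simp: explored_def generated_set_def)
  also have "\<dots> \<le> 101 ^ (3 * s) * (1 / 101) ^ (card {a, a'} + card ({} :: 'v set) + card (trace_on G0 {} ` {a, a'})) *
      p ^ card ({} :: 'v set set) * (1 / 2) ^ card ({} :: 'v set) * exp (- (2 / 3) * (real s * p) * (real (card V) - real s))"
    using a by (intro prob_explored[OF np small]) auto
  also have "\<dots> \<le> 101 ^ (3 * s) * 1 * exp (- 66 * real s)"
  proof -
    have "(1 / 101 :: real) ^ (card {a, a'} + card ({} :: 'v set) + card (trace_on G0 {} ` {a, a'})) \<le> 1"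
      by (rule power_le_one) auto
    moreover have "exp (- (2 / 3) * (real s * p) * (real (card V) - real s)) \<le> exp (- 66 * real s)"
    proof -
      have "real s * (200 / 3 * (1 - real s / real n)) \<ge> real s * 66"
        using sn n0 by (intro mult_left_mono) (auto simp: field_simps)
      moreover have "2 / 3 * (real s * p) * (real (card V) - real s) = real s * (200 / 3 * (1 - real s / real n))"
        using n0 by (simp add: pn n_def[symmetric] field_simps)
      ultimately have "- (2 / 3) * (real s * p) * (real (card V) - real s) \<le> - 66 * real s" by linarith
      then show ?thesis by simp
    qed
    ultimately show ?thesis by (intro mult_mono) auto
  qed
  also have "(101 :: real) ^ (3 * s) \<le> exp (16 * real s)"
  proof -
    \<comment> \<open>101 ^ 3 = 1030301 is just below 2 ^ 20 = 1048576, and 2 <= exp (4/5).\<close>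
    have "(101 :: real) ^ 3 \<le> 2 ^ 20" by simp
    also have "(2 :: real) ^ 20 \<le> exp (4 / 5) ^ 20"
    proof (rule power_mono)
      have "(2 :: real) \<le> 1 + 4 / 5 + (4 / 5)\<^sup>2 / 2" by (simp add: power2_eq_square)
      also have "\<dots> \<le> exp (4 / 5)" by (rule exp_lower_Taylor_quadratic) simp
      finally show "2 \<le> exp (4 / 5 :: real)" .
    qed simp
    also have "\<dots> = exp 16" by (simp add: exp_of_nat_mult[symmetric])
    finally have "((101 :: real) ^ 3) ^ s \<le> exp 16 ^ s" by (intro power_mono) auto
    moreover have "exp 16 ^ s = exp (16 * real s)" by (simp add: exp_of_nat_mult[symmetric] mult.commute)
    ultimately show ?thesis by (simp only: power_mult)
  qed
  finally show ?thesis by (simp add: exp_add[symmetric] mult_right_mono)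
qed

end

subsection \<open>Parities of degrees\<close>

context
  fixes V :: "'v set" and p :: real
  assumes fin: "finite V" and p: "0 \<le> p" "p \<le> 1"
begin

text \<open>The parity is picked out by a sign: z^k restricted to one parity is half the sum or
  difference of z^k and (-z)^k, and the expectation of either power factorises over the
  star.\<close>

lemma prob_parity_star:
  assumes v: "v \<in> V" and W: "W \<subseteq> V" "v \<notin> W" and r: "0 \<le> 1 - p - p * z"
    and E: "finite E" "star W v \<subseteq> E"
  shows "bern_exp E p (\<lambda>b. z ^ card {w\<in>W. b {v, w}} * of_bool (odd (card {w\<in>W. b {v, w}}) = t))
     \<le> ((1 - p + p * z) ^ card W + (1 - p - p * z) ^ card W) / 2"
proof -
  have finW: "finite W" using W fin finite_subset by blast
  have card_star: "card (star W v) = card W"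
    unfolding star_def by (rule card_image[OF inj_on_star[OF W(2)]])
  have prod_pow: "x ^ card {w\<in>W. b {v, w}} = (\<Prod>e\<in>star W v. if b e then x else 1)" for x :: real and b
  proof -
    have "(\<Prod>e\<in>star W v. if b e then x else 1) = (\<Prod>w\<in>W. if b {v, w} then x else 1)"
      unfolding star_def by (subst prod.reindex[OF inj_on_star[OF W(2)]]) simp
    also have "\<dots> = x ^ card (W \<inter> {w. b {v, w}})" using finW by (simp add: prod.If_cases)
    also have "W \<inter> {w. b {v, w}} = {w\<in>W. b {v, w}}" by auto
    finally show ?thesis by simp
  qed
  have pow: "bern_exp E p (\<lambda>b. x ^ card {w\<in>W. b {v, w}}) = (1 - p + p * x) ^ card W" for x :: real
  proof -
    have "bern_exp E p (\<lambda>b. x ^ card {w\<in>W. b {v, w}}) = (\<Prod>e\<in>star W v. p * (if True then x else 1) + (1 - p) * (if False then x else 1))"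
      unfolding prod_pow using E p by (intro bern_exp_prod_single) auto
    then show ?thesis by (simp add: card_star algebra_simps)
  qed
  define \<sigma> :: real where "\<sigma> = (if t then - 1 else 1)"
  have "z ^ k * of_bool (odd k = t) = (z ^ k + \<sigma> * (- z) ^ k) / 2" for k
    by (cases "odd k") (auto simp: \<sigma>_def)
  then have "bern_exp E p (\<lambda>b. z ^ card {w\<in>W. b {v, w}} * of_bool (odd (card {w\<in>W. b {v, w}}) = t))
      = bern_exp E p (\<lambda>b. (z ^ card {w\<in>W. b {v, w}} + \<sigma> * (- z) ^ card {w\<in>W. b {v, w}}) / 2)" by (simp only:)
  also have "\<dots> = (bern_exp E p (\<lambda>b. z ^ card {w\<in>W. b {v, w}}) + \<sigma> * bern_exp E p (\<lambda>b. (- z) ^ card {w\<in>W. b {v, w}})) / 2"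
    using E by simp
  also have "\<dots> = ((1 - p + p * z) ^ card W + \<sigma> * (1 - p - p * z) ^ card W) / 2"
    unfolding pow by simp
  also have "\<dots> \<le> ((1 - p + p * z) ^ card W + (1 - p - p * z) ^ card W) / 2"
    using r by (auto simp: \<sigma>_def)
  finally show ?thesis .
qed

text \<open>If every vertex \<open>v \<in> A\<close> must have the same degree parities into the parts of the labelling \<open>L\<close> as
  its representative \<open>\<rho> v \<notin> A \<union> Y\<close>, then, given all edges outside \<open>A \<times> Y\<close>, the parities of the numbers
  of random edges from \<open>v\<close> to the traces of the parts on \<open>Y\<close> are prescribed. The factor \<open>z\<close> rewards outcomes with
  many random edges between \<open>A\<close> and \<open>Y\<close>.\<close>

lemma prob_parities_agree:
  fixes L :: "'v \<Rightarrow> 'l" and z :: real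
  assumes A: "A \<subseteq> V" and Y: "Y \<subseteq> V" and AY: "A \<inter> Y = {}" and \<rho>: "\<And>v. v \<in> A \<Longrightarrow> \<rho> v \<notin> A \<union> Y"
    and z: "1 \<le> z" and r: "0 \<le> 1 - p - p * z"
  defines "N \<equiv> \<lambda>b. \<Sum>v\<in>A. card {w\<in>Y. b {v, w}}"
  shows "bern_prob (all_edges V) p (\<lambda>b. (\<forall>v\<in>A. \<forall>l\<in>L ` Y.
       odd (card {w\<in>V. L w = l \<and> xor_adj G0 b v w}) = odd (card {w\<in>V. L w = l \<and> xor_adj G0 b (\<rho> v) w})) \<and> N0 \<le> N b) * z ^ N0
     \<le> (\<Prod>l\<in>L ` Y. ((1 - p + p * z) ^ card {w\<in>Y. L w = l} + (1 - p - p * z) ^ card {w\<in>Y. L w = l}) / 2) ^ card A"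
proof -
  let ?E = "all_edges V"
  define K where "K = (\<Union>v\<in>A. star Y v)"
  define Yl where "Yl l = {w\<in>Y. L w = l}" for l
  define \<tau> where "\<tau> b v l \<longleftrightarrow> (odd (card {w\<in>Yl l. {v, w} \<in> G0}) \<noteq> odd (card {w\<in>V - Y. L w = l \<and> xor_adj G0 b v w}))
      \<noteq> odd (card {w\<in>V. L w = l \<and> xor_adj G0 b (\<rho> v) w})" for b v l
  have finE: "finite ?E" using finite_all_edges[OF fin] .
  have finA: "finite A" and finY: "finite Y" using A Y fin finite_subset by auto
  have finYl: "finite (Yl l)" for l using finY by (simp add: Yl_def)
  have KE: "K \<subseteq> ?E" using star_subset[OF _ Y] A AY unfolding K_def by blast
  have finK: "finite K" using KE finE finite_subset by blast
  have inK: "{v, w} \<in> K \<longleftrightarrow> (v \<in> A \<and> w \<in> Y) \<or> (w \<in> A \<and> v \<in> Y)" for v w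
    by (auto simp: K_def star_def doubleton_eq_iff)
  \<comment> \<open>Symmetric difference adds cardinalities mod 2; this is how an arbitrary
    \<open>G0\<close> is reduced to a shift of the prescribed parities.\<close>
  have odd_xor: "odd (card {w\<in>W. P w \<noteq> R w}) \<longleftrightarrow> odd (card {w\<in>W. P w}) \<noteq> odd (card {w\<in>W. R w})"
    if "finite W" for W :: "'v set" and P R
    using that
  proof (induction W rule: finite_induct)
    case (insert x W)
    have "card {w\<in>insert x W. P w} = (if P x then 1 else 0) + card {w\<in>W. P w}" for P
    proof -
      have "{w\<in>insert x W. P w} = (if P x then insert x {w\<in>W. P w} else {w\<in>W. P w})" by auto
      then show ?thesis using insert.hyps by simp
    qed
    then show ?case using insert.IH by auto
  qed simp
  have parity: "odd (card {w\<in>Yl l. b {v, w}}) = \<tau> b v l"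
    if "odd (card {w\<in>V. L w = l \<and> xor_adj G0 b v w}) = odd (card {w\<in>V. L w = l \<and> xor_adj G0 b (\<rho> v) w})" for b v l
  proof -
    have "{w\<in>V. L w = l \<and> xor_adj G0 b v w} = {w\<in>Yl l. xor_adj G0 b v w} \<union> {w\<in>V - Y. L w = l \<and> xor_adj G0 b v w}"
      using Y by (auto simp: Yl_def)
    also have "card \<dots> = card {w\<in>Yl l. xor_adj G0 b v w} + card {w\<in>V - Y. L w = l \<and> xor_adj G0 b v w}"
      using fin finY by (intro card_Un_disjoint) (auto simp: Yl_def)
    finally have "odd (card {w\<in>V. L w = l \<and> xor_adj G0 b v w}) \<longleftrightarrow>
        odd (card {w\<in>Yl l. xor_adj G0 b v w}) \<noteq> odd (card {w\<in>V - Y. L w = l \<and> xor_adj G0 b v w})" by simp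
    moreover have "odd (card {w\<in>Yl l. xor_adj G0 b v w}) \<longleftrightarrow>
        odd (card {w\<in>Yl l. {v, w} \<in> G0}) \<noteq> odd (card {w\<in>Yl l. b {v, w}})"
      unfolding xor_adj_def by (rule odd_xor[OF finYl])
    ultimately show ?thesis using that unfolding \<tau>_def by blast
  qed
  define H where "H b = (\<Prod>vl\<in>A \<times> L ` Y. z ^ card {w\<in>Yl (snd vl). b {fst vl, w}} *
      of_bool (odd (card {w\<in>Yl (snd vl). b {fst vl, w}}) = \<tau> b (fst vl) (snd vl)))" for b
  have N: "N b = (\<Sum>vl\<in>A \<times> L ` Y. card {w\<in>Yl (snd vl). b {fst vl, w}})" for b
  proof -
    have "card {w\<in>Y. b {v, w}} = (\<Sum>l\<in>L ` Y. card {w\<in>Yl l. b {v, w}})" for v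
    proof -
      have "{w\<in>Y. b {v, w}} = (\<Union>l\<in>L ` Y. {w\<in>Yl l. b {v, w}})" by (auto simp: Yl_def)
      also have "card \<dots> = (\<Sum>l\<in>L ` Y. card {w\<in>Yl l. b {v, w}})"
        using finY finYl by (intro card_UN_disjoint) (auto simp: Yl_def)
      finally show ?thesis .
    qed
    then have "N b = (\<Sum>v\<in>A. \<Sum>l\<in>L ` Y. card {w\<in>Yl l. b {v, w}})" by (simp add: N_def)
    also have "\<dots> = (\<Sum>(v, l)\<in>A \<times> L ` Y. card {w\<in>Yl l. b {v, w}})" by (rule sum.cartesian_product)
    finally show ?thesis by (simp add: case_prod_unfold)
  qed
  define M where "M b \<longleftrightarrow> (\<forall>v\<in>A. \<forall>l\<in>L ` Y.
       odd (card {w\<in>V. L w = l \<and> xor_adj G0 b v w}) = odd (card {w\<in>V. L w = l \<and> xor_adj G0 b (\<rho> v) w})) \<and> N0 \<le> N b" for b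
  have H0: "H b \<ge> 0" for b unfolding H_def using z by (intro prod_nonneg) auto
  \<comment> \<open>Markov's inequality in weighted form: on the event all parity indicators in
    \<open>H\<close> are 1, and what remains is z ^ N b >= z ^ N0.\<close>
  have le: "of_bool (M b) * z ^ N0 \<le> H b" for b
  proof (cases "M b")
    case True
    then have "H b = (\<Prod>vl\<in>A \<times> L ` Y. z ^ card {w\<in>Yl (snd vl). b {fst vl, w}})"
      unfolding H_def
    proof (intro prod.cong refl)
      fix vl assume "vl \<in> A \<times> L ` Y"
      then have "odd (card {w\<in>Yl (snd vl). b {fst vl, w}}) = \<tau> b (fst vl) (snd vl)"
        using True unfolding M_def by (intro parity) auto
      then show "z ^ card {w\<in>Yl (snd vl). b {fst vl, w}} * of_bool (odd (card {w\<in>Yl (snd vl). b {fst vl, w}}) = \<tau> b (fst vl) (snd vl))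
          = z ^ card {w\<in>Yl (snd vl). b {fst vl, w}}" by simp
    qed
    also have "\<dots> = z ^ N b" unfolding N by (rule power_sum[symmetric])
    also have "\<dots> \<ge> z ^ N0" using True z by (intro power_increasing) (auto simp: M_def)
    finally show ?thesis using True by simp
  qed (use H0 in simp)
  have "bern_prob ?E p M * z ^ N0 = bern_exp ?E p (\<lambda>b. of_bool (M b) * z ^ N0)"
    using finE unfolding bern_prob_exp by simp
  also have "\<dots> \<le> bern_exp ?E p H" using finE le by (intro integral_mono) auto
  also have "\<dots> \<le> (\<Prod>l\<in>L ` Y. ((1 - p + p * z) ^ card (Yl l) + (1 - p - p * z) ^ card (Yl l)) / 2) ^ card A"
  \<comment> \<open>Fix all coins outside \<open>K\<close>. For v in \<open>A\<close> the prescribed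
    parities \<open>\<tau>\<close> become constants: they read only edges from v to
    \<open>V - Y\<close> and edges at \<open>\<rho> v\<close>, none of which is in \<open>K\<close>.
    The stars of distinct (v, l) are disjoint, so the factors of \<open>H\<close> become
    independent.\<close>
  proof (rule bern_exp_le_cond[OF finE KE])
    fix g :: "'v set \<Rightarrow> bool"
    let ?c = "\<lambda>f e. if e \<in> K then f e else g e"
    define \<theta> where "\<theta> v l = \<tau> g v l" for v l
    have \<tau>: "\<tau> (?c f) v l = \<theta> v l" if "v \<in> A" for f v l
    proof -
      have "xor_adj G0 (?c f) v w = xor_adj G0 g v w" if "w \<in> V - Y" for w
        using that \<open>v \<in> A\<close> AY inK[of v w] by (auto simp: xor_adj_def)
      then have 1: "{w\<in>V - Y. L w = l \<and> xor_adj G0 (?c f) v w} = {w\<in>V - Y. L w = l \<and> xor_adj G0 g v w}" by blast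
      have "xor_adj G0 (?c f) (\<rho> v) w = xor_adj G0 g (\<rho> v) w" for w
        using \<rho>[OF \<open>v \<in> A\<close>] inK[of "\<rho> v" w] by (auto simp: xor_adj_def)
      then have 2: "{w\<in>V. L w = l \<and> xor_adj G0 (?c f) (\<rho> v) w} = {w\<in>V. L w = l \<and> xor_adj G0 g (\<rho> v) w}" by blast
      show ?thesis unfolding \<theta>_def \<tau>_def 1 2 ..
    qed
    have H: "H (?c f) = (\<Prod>vl\<in>A \<times> L ` Y. z ^ card {w\<in>Yl (snd vl). f {fst vl, w}} *
      of_bool (odd (card {w\<in>Yl (snd vl). f {fst vl, w}}) = \<theta> (fst vl) (snd vl)))" for f
      unfolding H_def
    proof (rule prod.cong[OF refl])
      fix vl assume vl: "vl \<in> A \<times> L ` Y"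
      have 1: "{w\<in>Yl (snd vl). ?c f {fst vl, w}} = {w\<in>Yl (snd vl). f {fst vl, w}}"
        using vl inK by (auto simp: Yl_def)
      have 2: "\<tau> (?c f) (fst vl) (snd vl) = \<theta> (fst vl) (snd vl)" using vl by (intro \<tau>) auto
      show "z ^ card {w\<in>Yl (snd vl). ?c f {fst vl, w}} *
           of_bool (odd (card {w\<in>Yl (snd vl). ?c f {fst vl, w}}) = \<tau> (?c f) (fst vl) (snd vl)) =
        z ^ card {w\<in>Yl (snd vl). f {fst vl, w}} * of_bool (odd (card {w\<in>Yl (snd vl). f {fst vl, w}}) = \<theta> (fst vl) (snd vl))"
        unfolding 1 2 ..
    qed
    let ?h = "\<lambda>vl f. z ^ card {w\<in>Yl (snd vl). f {fst vl, w}} * of_bool (odd (card {w\<in>Yl (snd vl). f {fst vl, w}}) = \<theta> (fst vl) (snd vl)) :: real"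
    have sub: "star (Yl l) v \<subseteq> K" if "v \<in> A" for v l
      using that by (auto simp: K_def star_def Yl_def)
    have "bern_exp K p (\<lambda>f. H (?c f)) = bern_exp K p (\<lambda>f. \<Prod>vl\<in>A \<times> L ` Y. ?h vl f)" unfolding H ..
    also have "\<dots> = (\<Prod>vl\<in>A \<times> L ` Y. bern_exp K p (?h vl))"
    proof (rule bern_exp_prod[where A = "\<lambda>vl. star (Yl (snd vl)) (fst vl)"])
      show "finite K" "finite (A \<times> L ` Y)" using finK finA finY by auto
      show "star (Yl (snd vl)) (fst vl) \<subseteq> K" if "vl \<in> A \<times> L ` Y" for vl
        using that by (intro sub) auto
      show "disjoint_family_on (\<lambda>vl. star (Yl (snd vl)) (fst vl)) (A \<times> L ` Y)"
        unfolding disjoint_family_on_def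
      proof (intro ballI impI)
        fix x y assume xy: "x \<in> A \<times> L ` Y" "y \<in> A \<times> L ` Y" "x \<noteq> y"
        have "False" if e: "e \<in> star (Yl (snd x)) (fst x)" "e \<in> star (Yl (snd y)) (fst y)" for e
        proof -
          obtain w w' where w: "e = {fst x, w}" "w \<in> Y" "L w = snd x" "e = {fst y, w'}" "w' \<in> Y" "L w' = snd y"
          proof -
            obtain w where "e = {fst x, w}" "w \<in> Yl (snd x)" using e(1) by (auto simp: star_def)
            moreover obtain w' where "e = {fst y, w'}" "w' \<in> Yl (snd y)" using e(2) by (auto simp: star_def)
            ultimately show thesis using that[of w w'] unfolding Yl_def by blast
          qed
          have "fst x \<in> A" "fst y \<in> A" using xy by auto
          then have "fst x = fst y" "w = w'" using w AY by (auto simp: doubleton_eq_iff)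
          then show False using w xy(3) by (auto simp: prod_eq_iff)
        qed
        then show "star (Yl (snd x)) (fst x) \<inter> star (Yl (snd y)) (fst y) = {}" by blast
      qed
      show "depends_on (star (Yl (snd vl)) (fst vl)) (?h vl)" for vl
        unfolding depends_on_def
      proof (intro allI impI)
        fix b b' :: "'v set \<Rightarrow> bool" assume "\<forall>e\<in>star (Yl (snd vl)) (fst vl). b e = b' e"
        then have "{w\<in>Yl (snd vl). b {fst vl, w}} = {w\<in>Yl (snd vl). b' {fst vl, w}}" by (auto simp: star_def)
        then show "?h vl b = ?h vl b'" by simp
      qed
    qed
    also have "\<dots> \<le> (\<Prod>vl\<in>A \<times> L ` Y. ((1 - p + p * z) ^ card (Yl (snd vl)) + (1 - p - p * z) ^ card (Yl (snd vl))) / 2)"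
    proof (intro prod_mono conjI)
      fix vl assume vl: "vl \<in> A \<times> L ` Y"
      show "0 \<le> bern_exp K p (?h vl)" using z by (intro integral_nonneg_AE) auto
      show "bern_exp K p (?h vl) \<le> ((1 - p + p * z) ^ card (Yl (snd vl)) + (1 - p - p * z) ^ card (Yl (snd vl))) / 2"
      proof (rule prob_parity_star[OF _ _ _ r finK])
        show "fst vl \<in> V" "Yl (snd vl) \<subseteq> V" "fst vl \<notin> Yl (snd vl)" using vl A Y AY by (auto simp: Yl_def)
        show "star (Yl (snd vl)) (fst vl) \<subseteq> K" using vl by (intro sub) auto
      qed
    qed
    also have "\<dots> = (\<Prod>(v, l)\<in>A \<times> L ` Y. ((1 - p + p * z) ^ card (Yl l) + (1 - p - p * z) ^ card (Yl l)) / 2)"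
      by (simp only: case_prod_unfold)
    also have "\<dots> = (\<Prod>v\<in>A. \<Prod>l\<in>L ` Y. ((1 - p + p * z) ^ card (Yl l) + (1 - p - p * z) ^ card (Yl l)) / 2)"
      by (rule prod.cartesian_product[symmetric])
    also have "\<dots> = (\<Prod>l\<in>L ` Y. ((1 - p + p * z) ^ card (Yl l) + (1 - p - p * z) ^ card (Yl l)) / 2) ^ card A" by simp
    finally show "bern_exp K p (\<lambda>f. H (?c f)) \<le> (\<Prod>l\<in>L ` Y. ((1 - p + p * z) ^ card (Yl l) + (1 - p - p * z) ^ card (Yl l)) / 2) ^ card A" .
  qed
  finally show ?thesis unfolding M_def Yl_def .
qed

text \<open>Chernoff's method with base 1/4: the expectation of (1/4)^N is (1 - 3/4 p)^(card A *
  card Y).\<close>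

lemma prob_few_cross_edges:
  assumes A: "A \<subseteq> V" and Y: "Y \<subseteq> V" and AY: "A \<inter> Y = {}"
  shows "bern_prob (all_edges V) p (\<lambda>b. (\<Sum>v\<in>A. card {w\<in>Y. b {v, w}}) \<le> K)
     \<le> 4 ^ K * exp (- (3 / 4) * p * (real (card A) * real (card Y)))"
proof -
  let ?E = "all_edges V"
  let ?N = "\<lambda>b. \<Sum>v\<in>A. card {w\<in>Y. b {v, w}}"
  define B where "B = (\<lambda>(v, w). {v, w}) ` (A \<times> Y)"
  have finE: "finite ?E" using finite_all_edges[OF fin] .
  have finA: "finite A" and finY: "finite Y" using A Y fin finite_subset by auto
  have inj: "inj_on (\<lambda>(v, w). {v, w}) (A \<times> Y)"
    using AY by (auto simp: inj_on_def doubleton_eq_iff)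
  have BE: "B \<subseteq> ?E" using A Y AY by (auto simp: B_def all_edges_def card_insert_if)
  have "(1 / 4 :: real) ^ ?N b = (\<Prod>e\<in>B. if b e then 1 / 4 else 1)" for b
  proof -
    have "(\<Prod>e\<in>B. if b e then 1 / 4 else 1 :: real) = (\<Prod>(v, w)\<in>A \<times> Y. if b {v, w} then 1 / 4 else 1)"
      unfolding B_def by (subst prod.reindex[OF inj]) (simp add: case_prod_unfold)
    also have "\<dots> = (\<Prod>v\<in>A. \<Prod>w\<in>Y. if b {v, w} then 1 / 4 else 1)" by (rule prod.cartesian_product[symmetric])
    also have "\<dots> = (\<Prod>v\<in>A. (1 / 4) ^ card {w\<in>Y. b {v, w}})"
    proof (rule prod.cong[OF refl])
      fix v
      have "(\<Prod>w\<in>Y. if b {v, w} then 1 / 4 else 1 :: real) = (1 / 4) ^ card (Y \<inter> {w. b {v, w}})"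
        using finY by (simp add: prod.If_cases)
      also have "Y \<inter> {w. b {v, w}} = {w\<in>Y. b {v, w}}" by auto
      finally show "(\<Prod>w\<in>Y. if b {v, w} then 1 / 4 else 1 :: real) = (1 / 4) ^ card {w\<in>Y. b {v, w}}" .
    qed
    finally show ?thesis by (simp add: power_sum)
  qed
  then have "bern_exp ?E p (\<lambda>b. (1 / 4 :: real) ^ ?N b) = (\<Prod>e\<in>B. p * (if True then 1 / 4 else 1) + (1 - p) * (if False then 1 / 4 else 1))"
    using BE finE p bern_exp_prod_single[of ?E B p "\<lambda>_ x. if x then 1 / 4 else 1"] by simp
  also have "\<dots> = (1 - 3 / 4 * p) ^ card B" by (simp add: algebra_simps)
  also have "\<dots> \<le> exp (- (3 / 4 * p)) ^ card B"
    using p exp_ge_add_one_self[of "- (3 / 4 * p)"] by (intro power_mono) auto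
  also have "card B = card A * card Y" unfolding B_def by (simp add: card_image[OF inj] card_cartesian_product)
  finally have 1: "bern_exp ?E p (\<lambda>b. (1 / 4 :: real) ^ ?N b) \<le> exp (- (3 / 4) * p * (real (card A) * real (card Y)))"
    by (simp add: exp_of_nat_mult[symmetric] mult_ac)
  have "of_bool (?N b \<le> K) \<le> 4 ^ K * (1 / 4 :: real) ^ ?N b" for b
  proof (cases "?N b \<le> K")
    case True
    then have "(1 / 4 :: real) ^ K \<le> (1 / 4) ^ ?N b" by (intro power_decreasing) auto
    then have "4 ^ K * (1 / 4 :: real) ^ K \<le> 4 ^ K * (1 / 4) ^ ?N b" by (intro mult_left_mono) auto
    then show ?thesis using True by (simp add: power_mult_distrib[symmetric])
  qed simp
  then have "bern_prob ?E p (\<lambda>b. ?N b \<le> K) \<le> bern_exp ?E p (\<lambda>b. 4 ^ K * (1 / 4 :: real) ^ ?N b)"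
    unfolding bern_prob_exp using finE by (intro integral_mono) auto
  also have "\<dots> = 4 ^ K * bern_exp ?E p (\<lambda>b. (1 / 4 :: real) ^ ?N b)" using finE by simp
  also have "\<dots> \<le> 4 ^ K * exp (- (3 / 4) * p * (real (card A) * real (card Y)))"
    using 1 by (intro mult_left_mono) auto
  finally show ?thesis .
qed

end

subsection \<open>Coarse labellings\<close>

text \<open>Greedy packing: the next set goes into the last bin if its load is at most \<beta>, and
  otherwise opens a new one. Loads stay at most 2 \<beta>, and every bin but the last holds at least
  \<beta>, which bounds the number of bins.\<close>

lemma ex_bins:
  fixes \<beta> :: nat
  assumes "finite \<Q>" "\<forall>Q\<in>\<Q>. finite Q \<and> card Q \<le> \<beta>" "disjoint \<Q>"
  shows "\<exists>bin k. 1 \<le> k \<and> (\<forall>Q\<in>\<Q>. \<forall>x\<in>Q. \<forall>y\<in>Q. bin x = bin y) \<and> (\<forall>x\<in>\<Union>\<Q>. bin x < k) \<and>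
     (\<forall>j. card {x\<in>\<Union>\<Q>. bin x = j} \<le> 2 * \<beta>) \<and> (k - 1) * \<beta> \<le> card (\<Union>\<Q>)"
proof -
  have "\<exists>bin k. 1 \<le> k \<and> (\<forall>Q\<in>\<Q>. \<forall>x\<in>Q. \<forall>y\<in>Q. bin x = bin y) \<and> (\<forall>x\<in>\<Union>\<Q>. bin x < k) \<and>
     (\<forall>j. card {x\<in>\<Union>\<Q>. bin x = j} \<le> 2 * \<beta>) \<and> (\<forall>j. Suc j < k \<longrightarrow> \<beta> \<le> card {x\<in>\<Union>\<Q>. bin x = j})"
    using assms
  proof (induction \<Q> rule: finite_induct)
    case empty
    show ?case by (intro exI[of _ "\<lambda>_. 0"] exI[of _ "1 :: nat"]) auto
  next
    case (insert Q \<Q>)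
    have "disjoint \<Q>" using insert.prems(2) by (auto simp: disjoint_def)
    have bounds: "\<forall>Q\<in>\<Q>. finite Q \<and> card Q \<le> \<beta>" using insert.prems(1) by blast
    from insert.IH[OF bounds \<open>disjoint \<Q>\<close>] obtain bin k where IH: "1 \<le> k" "\<forall>Q\<in>\<Q>. \<forall>x\<in>Q. \<forall>y\<in>Q. bin x = bin y" "\<forall>x\<in>\<Union>\<Q>. bin x < k"
      "\<forall>j. card {x\<in>\<Union>\<Q>. bin x = j} \<le> 2 * \<beta>" "\<forall>j. Suc j < k \<longrightarrow> \<beta> \<le> card {x\<in>\<Union>\<Q>. bin x = j}"
      by (elim exE conjE) (rule that; assumption)
    have disj: "Q \<inter> \<Union>\<Q> = {}" using insert.prems(2) insert.hyps(2) unfolding pairwise_insert disjnt_def by blast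
    have fin: "finite (\<Union>\<Q>)" "finite Q" using insert by auto
    define j0 where "j0 = (if card {x\<in>\<Union>\<Q>. bin x = k - 1} \<le> \<beta> then k - 1 else k)"
    define bin' where "bin' x = (if x \<in> Q then j0 else bin x)" for x
    have j0: "k - 1 \<le> j0" "j0 \<le> k" by (auto simp: j0_def)
    have eq: "{x\<in>\<Union>(insert Q \<Q>). bin' x = j} = {x\<in>\<Union>\<Q>. bin x = j} \<union> (if j = j0 then Q else {})" for j
      using disj by (auto simp: bin'_def)
    have card: "card {x\<in>\<Union>(insert Q \<Q>). bin' x = j} = card {x\<in>\<Union>\<Q>. bin x = j} + (if j = j0 then card Q else 0)" for j
      unfolding eq using disj fin finite_subset[OF _ fin(1), of "{x\<in>\<Union>\<Q>. bin x = j}"]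
      by (subst card_Un_disjoint) auto
    have none: "{x\<in>\<Union>\<Q>. bin x = k} = {}" using IH(3) by auto
    have j0card: "card {x\<in>\<Union>\<Q>. bin x = j0} \<le> \<beta>"
    proof (cases "j0 = k")
      case True
      show ?thesis unfolding True none by simp
    next
      case False
      then show ?thesis by (metis j0_def)
    qed
    show ?case
    proof (intro exI[of _ bin'] exI[of _ "Suc j0"] conjI allI impI)
      show "1 \<le> Suc j0" by simp
      show "\<forall>R\<in>insert Q \<Q>. \<forall>x\<in>R. \<forall>y\<in>R. bin' x = bin' y"
      proof (intro ballI)
        fix R x y assume R: "R \<in> insert Q \<Q>" "x \<in> R" "y \<in> R"
        show "bin' x = bin' y"
        proof (cases "R = Q")
          case False
          then have "R \<in> \<Q>" using R by blast
          then have "x \<notin> Q" "y \<notin> Q" "bin x = bin y" using R disj IH(2) by blast+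
          then show ?thesis by (simp add: bin'_def)
        qed (use R in \<open>simp add: bin'_def\<close>)
      qed
      show "\<forall>x\<in>\<Union>(insert Q \<Q>). bin' x < Suc j0"
        using IH(1,3) j0 unfolding bin'_def by fastforce
      show "card {x\<in>\<Union>(insert Q \<Q>). bin' x = j} \<le> 2 * \<beta>" for j
        unfolding card using IH(4) j0card insert.prems(1) by auto
      show "\<beta> \<le> card {x\<in>\<Union>(insert Q \<Q>). bin' x = j}" if "Suc j < Suc j0" for j
      proof (cases "Suc j < k")
        case True
        then show ?thesis unfolding card using IH(5) by (simp add: trans_le_add1)
      next
        case False
        then have "j = k - 1" "j0 = k" using that j0 IH(1) by auto
        then have "\<beta> < card {x\<in>\<Union>\<Q>. bin x = j}"
          using IH(1) unfolding j0_def by (metis One_nat_def diff_Suc_less less_irrefl less_le_trans not_le zero_less_one)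
        then show ?thesis unfolding card by linarith
      qed
    qed
  qed
  then obtain bin k where b: "1 \<le> k" "\<forall>Q\<in>\<Q>. \<forall>x\<in>Q. \<forall>y\<in>Q. bin x = bin y" "\<forall>x\<in>\<Union>\<Q>. bin x < k"
      "\<forall>j. card {x\<in>\<Union>\<Q>. bin x = j} \<le> 2 * \<beta>" "\<forall>j. Suc j < k \<longrightarrow> \<beta> \<le> card {x\<in>\<Union>\<Q>. bin x = j}"
    by (elim exE conjE) (rule that; assumption)
  have fin: "finite (\<Union>\<Q>)" using assms by auto
  have "(k - 1) * \<beta> = (\<Sum>j<k - 1. \<beta>)" by simp
  also have "\<dots> \<le> (\<Sum>j<k - 1. card {x\<in>\<Union>\<Q>. bin x = j})" using b(5) by (intro sum_mono) auto
  also have "\<dots> = card (\<Union>j<k - 1. {x\<in>\<Union>\<Q>. bin x = j})"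
  proof (rule card_UN_disjoint[symmetric])
    have "finite {x\<in>\<Union>\<Q>. bin x = j}" for j by (rule finite_subset[OF _ fin]) blast
    then show "\<forall>j\<in>{..<k - 1}. finite {x\<in>\<Union>\<Q>. bin x = j}" by blast
  qed auto
  also have "\<dots> \<le> card (\<Union>\<Q>)" using fin by (intro card_mono) auto
  finally show ?thesis using b by blast
qed

definition colour_class :: "'v set \<Rightarrow> ('v \<Rightarrow> 'c) \<Rightarrow> 'v \<Rightarrow> 'v set" where
  "colour_class V c v = {w\<in>V. c w = c v}"

definition nonsingletons :: "'v set \<Rightarrow> ('v \<Rightarrow> 'c) \<Rightarrow> 'v set" where
  "nonsingletons V c = {v\<in>V. 2 \<le> card (colour_class V c v)}"

lemma colour_class_eq: "c v = c w \<Longrightarrow> colour_class V c v = colour_class V c w"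
  by (simp add: colour_class_def)

text \<open>Label 0 will mean that the vertex is alone in its colour. Splitting this fibre into
  points makes every fibre a union of colour classes, while in the counting of labellings all such
  vertices share one value.\<close>

definition separate_zero :: "('v \<Rightarrow> nat) \<Rightarrow> 'v \<Rightarrow> 'v + nat" where
  "separate_zero lab v = (if lab v = 0 then Inl v else Inr (lab v))"

context
  fixes V :: "'v set" and c :: "'v \<Rightarrow> 'c"
  assumes fin: "finite V"
begin

lemma card_colour_class_pos: "v \<in> V \<Longrightarrow> card (colour_class V c v) > 0"
  using fin by (auto simp: colour_class_def card_gt_0_iff)

text \<open>Among the unions of classes that contain with a class all larger ones and cover half of
  the \<open>nonsingletons\<close>, take one of least size, and let \<beta> be its smallest class
  size. Removing one class of that size loses the half, which bounds \<open>card X\<close> from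
  above; \<beta> >= \<open>B\<close> would put \<open>X\<close> inside the classes of size at least
  \<open>B\<close>, which cover too little.\<close>

lemma ex_upper_set:
  assumes s: "s = card (nonsingletons V c)" "0 < s"
    and few: "2 * card {v\<in>nonsingletons V c. B \<le> card (colour_class V c v)} < s"
  obtains X \<beta> where "X \<subseteq> nonsingletons V c" "\<And>v w. v \<in> X \<Longrightarrow> w \<in> V \<Longrightarrow> c v = c w \<Longrightarrow> w \<in> X" "2 \<le> \<beta>" "\<beta> < B"
    "\<And>v. v \<in> X \<Longrightarrow> \<beta> \<le> card (colour_class V c v)"
    "\<And>v. v \<in> nonsingletons V c - X \<Longrightarrow> card (colour_class V c v) \<le> \<beta>"
    "s \<le> 2 * card X" "2 * card X < s + 2 * \<beta>"
proof -
  let ?T = "nonsingletons V c" and ?b = "\<lambda>v. card (colour_class V c v)"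
  have T: "?T \<subseteq> V" by (auto simp: nonsingletons_def)
  have finT: "finite ?T" using T fin finite_subset by blast
  define U where "U X \<longleftrightarrow> X \<subseteq> ?T \<and> (\<forall>v\<in>X. \<forall>w\<in>V. c v = c w \<longrightarrow> w \<in> X) \<and>
     (\<forall>x\<in>X. \<forall>y\<in>?T - X. ?b y \<le> ?b x) \<and> s \<le> 2 * card X" for X
  have "U ?T"
    unfolding U_def
  proof (intro conjI ballI impI)
    show "w \<in> ?T" if "v \<in> ?T" "w \<in> V" "c v = c w" for v w
      using that colour_class_eq[of c v w V] by (simp add: nonsingletons_def)
    show "?b y \<le> ?b x" if "y \<in> ?T - ?T" for x y using that by simp
  qed (use s in simp_all)
  then obtain X where X: "U X" and min: "\<And>X'. U X' \<Longrightarrow> card X \<le> card X'"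
    using arg_min_nat_lemma[of U ?T card] by blast
  have finX: "finite X" and XT: "X \<subseteq> ?T" using X finT finite_subset unfolding U_def by blast+
  have "X \<noteq> {}" using X s by (auto simp: U_def)
  then obtain q where q: "q \<in> X" "\<And>x. x \<in> X \<Longrightarrow> ?b q \<le> ?b x"
    using finX ex_min_if_finite[of "?b ` X"] by (metis (no_types, lifting) arg_min_if_finite(1) arg_min_least)
  define \<beta> where "\<beta> = ?b q"
  let ?Q = "colour_class V c q"
  have QX: "?Q \<subseteq> X" using X q(1) unfolding U_def colour_class_def by auto
  have Qb: "?b w = \<beta>" if "w \<in> ?Q" for w
    using that colour_class_eq[of c w q V] by (simp add: \<beta>_def colour_class_def)
  have "card ?Q > 0" using q(1) XT T card_colour_class_pos by blast
  then have less: "card (X - ?Q) < card X"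
    using QX finX by (intro psubset_card_mono) (auto simp: card_gt_0_iff)
  have "\<not> s \<le> 2 * card (X - ?Q)"
  proof
    assume "s \<le> 2 * card (X - ?Q)"
    have "U (X - ?Q)"
      unfolding U_def
    proof (intro conjI ballI impI)
      show "X - ?Q \<subseteq> ?T" using XT by blast
      show "w \<in> X - ?Q" if "v \<in> X - ?Q" "w \<in> V" "c v = c w" for v w
        using that X XT T unfolding U_def colour_class_def by auto
      show "?b y \<le> ?b x" if "x \<in> X - ?Q" "y \<in> ?T - (X - ?Q)" for x y
      proof (cases "y \<in> X")
        case True
        then have "?b y = \<beta>" using that Qb by blast
        then show ?thesis using q(2) that by (simp add: \<beta>_def)
      next
        case False
        then show ?thesis using X that unfolding U_def by blast
      qed
    qed fact
    then show False using min less by force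
  qed
  moreover have "card (X - ?Q) = card X - \<beta>" "\<beta> \<le> card X"
    using QX finX unfolding \<beta>_def by (auto simp: card_Diff_subset finite_subset card_mono)
  ultimately have lt: "2 * card X < s + 2 * \<beta>" by linarith
  have "\<beta> < B"
  proof (rule ccontr)
    assume "\<not> \<beta> < B"
    then have "X \<subseteq> {v\<in>?T. B \<le> ?b v}" using XT q(2) unfolding \<beta>_def by fastforce
    then have "card X \<le> card {v\<in>?T. B \<le> ?b v}" using finT by (intro card_mono) auto
    then show False using few X by (auto simp: U_def)
  qed
  moreover have "2 \<le> \<beta>" using q(1) XT by (auto simp: \<beta>_def nonsingletons_def)
  ultimately show thesis
    using that[of X \<beta>] X XT q lt unfolding U_def \<beta>_def by blast
qed

text \<open>Labels 1 to M name the classes inside \<open>X\<close>, of which there are at most M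
  because each has at least \<beta> elements. Labels M + 1 to 2 M + 1 are the bins into which the
  smaller classes are packed.\<close>

lemma ex_labelling:
  assumes X: "X \<subseteq> nonsingletons V c" "\<And>v w. v \<in> X \<Longrightarrow> w \<in> V \<Longrightarrow> c v = c w \<Longrightarrow> w \<in> X"
    and \<beta>: "0 < \<beta>" "card V \<le> M * \<beta>"
    and big: "\<And>v. v \<in> X \<Longrightarrow> \<beta> \<le> card (colour_class V c v)"
    and small: "\<And>v. v \<in> nonsingletons V c - X \<Longrightarrow> card (colour_class V c v) \<le> \<beta>"
  obtains lab where "lab \<in> V \<rightarrow>\<^sub>E {0..2 * M + 1}" "\<And>v. v \<in> V \<Longrightarrow> lab v = 0 \<longleftrightarrow> v \<notin> nonsingletons V c"
    "\<And>v. v \<in> V \<Longrightarrow> v \<in> X \<longleftrightarrow> 1 \<le> lab v \<and> lab v \<le> M"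
    "\<And>v w. v \<in> V \<Longrightarrow> w \<in> V \<Longrightarrow> c v = c w \<Longrightarrow> lab v = lab w"
    "\<And>v w. v \<in> X \<Longrightarrow> w \<in> V \<Longrightarrow> lab v = lab w \<Longrightarrow> c v = c w"
    "\<And>l. M < l \<Longrightarrow> card {v\<in>V. lab v = l} \<le> 2 * \<beta>"
proof -
  let ?T = "nonsingletons V c" and ?C = "colour_class V c"
  have T: "?T \<subseteq> V" by (auto simp: nonsingletons_def)
  have finX: "finite X" using X T fin finite_subset by (meson subset_trans)
  have XV: "X \<subseteq> V" using X T by blast
  have disj: "?C ` S \<subseteq> Pow V \<and> disjoint (?C ` S)" for S
    by (auto simp: disjoint_def disjnt_def colour_class_def)
  have self: "v \<in> ?C v" if "v \<in> V" for v using that by (simp add: colour_class_def)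
  have UnX: "\<Union>(?C ` X) = X" using X(2) XV self by (auto simp: colour_class_def)
  have "card (?C ` X) * \<beta> \<le> card X"
  proof -
    have "card (?C ` X) * \<beta> = (\<Sum>Q\<in>?C ` X. \<beta>)" by simp
    also have "\<dots> \<le> (\<Sum>Q\<in>?C ` X. card Q)" using big by (intro sum_mono) auto
    also have "\<dots> = card (\<Union>(?C ` X))"
      using disj[of X] fin finX
      by (intro card_Union_disjoint[symmetric]) (auto simp: colour_class_def)
    finally show ?thesis unfolding UnX .
  qed
  also have "card X \<le> M * \<beta>" using card_mono[OF fin XV] \<beta>(2) by simp
  finally have "card (?C ` X) \<le> M" using \<beta>(1) by simp
  moreover obtain e where e: "bij_betw e (?C ` X) {0..<card (?C ` X)}"
    using ex_bij_betw_finite_nat[of "?C ` X"] finX by blast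
  ultimately have eM: "e Q < M" if "Q \<in> ?C ` X" for Q
    using that bij_betwE[OF e] by fastforce
  let ?W = "?T - X"
  have UnW: "\<Union>(?C ` ?W) = ?W"
  proof
    show "\<Union>(?C ` ?W) \<subseteq> ?W"
    proof
      fix w assume "w \<in> \<Union>(?C ` ?W)"
      then obtain v where v: "v \<in> ?W" "w \<in> V" "c w = c v" by (auto simp: colour_class_def)
      then have "w \<in> ?T" using colour_class_eq[of c w v V] by (auto simp: nonsingletons_def)
      moreover have "w \<notin> X" using X(2)[of w v] v T by auto
      ultimately show "w \<in> ?W" by blast
    qed
    show "?W \<subseteq> \<Union>(?C ` ?W)" using self T by blast
  qed
  obtain bin k where bin: "1 \<le> k" "\<forall>Q\<in>?C ` ?W. \<forall>x\<in>Q. \<forall>y\<in>Q. bin x = bin y" "\<forall>x\<in>\<Union>(?C ` ?W). bin x < k"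
     "\<forall>j. card {x\<in>\<Union>(?C ` ?W). bin x = j} \<le> 2 * \<beta>" "(k - 1) * \<beta> \<le> card (\<Union>(?C ` ?W))"
  proof -
    have "\<exists>bin k. 1 \<le> k \<and> (\<forall>Q\<in>?C ` ?W. \<forall>x\<in>Q. \<forall>y\<in>Q. bin x = bin y) \<and> (\<forall>x\<in>\<Union>(?C ` ?W). bin x < k) \<and>
     (\<forall>j. card {x\<in>\<Union>(?C ` ?W). bin x = j} \<le> 2 * \<beta>) \<and> (k - 1) * \<beta> \<le> card (\<Union>(?C ` ?W))"
    proof (rule ex_bins)
      show "finite (?C ` ?W)" using finite_subset[OF T fin] by simp
      show "disjoint (?C ` ?W)" using disj[of ?W] by simp
      show "\<forall>Q\<in>?C ` ?W. finite Q \<and> card Q \<le> \<beta>" using small fin by (simp add: colour_class_def)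
    qed
    then show thesis by (elim exE conjE) (rule that; assumption)
  qed
  have "card ?W \<le> card V" using fin T by (intro card_mono) auto
  then have "(k - 1) * \<beta> \<le> M * \<beta>" using bin(5) \<beta>(2) unfolding UnW by linarith
  then have kM: "k \<le> M + 1" using \<beta>(1) bin(1) by auto
  define lab where "lab v = (if v \<notin> V then undefined else if v \<in> X then Suc (e (?C v))
     else if v \<in> ?T then M + 1 + bin v else 0)" for v
  have binM: "bin v \<le> M" if "v \<in> ?W" for v
  proof -
    have "bin v < k" using bin(3) that unfolding UnW by blast
    then show ?thesis using kM by simp
  qed
  have labX: "lab v = Suc (e (?C v))" "1 \<le> lab v" "lab v \<le> M" if "v \<in> X" for v
  proof -
    show "lab v = Suc (e (?C v))" using that XV by (auto simp: lab_def)
    then show "1 \<le> lab v" "lab v \<le> M" using eM[of "?C v"] that by auto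
  qed
  have labW: "lab v = M + 1 + bin v" if "v \<in> ?W" for v using that T by (auto simp: lab_def)
  have labS: "lab v = 0" if "v \<in> V - ?T" for v using that X by (auto simp: lab_def)
  have same_T: "v \<in> ?T \<longleftrightarrow> w \<in> ?T" if "v \<in> V" "w \<in> V" "c v = c w" for v w
    using that colour_class_eq[of c v w V] by (simp add: nonsingletons_def)
  have same_X: "v \<in> X \<longleftrightarrow> w \<in> X" if "v \<in> V" "w \<in> V" "c v = c w" for v w
    using that X(2)[of v w] X(2)[of w v] by auto
  show thesis
  proof (rule that[of lab])
    have "lab v \<in> {0..2 * M + 1}" if v: "v \<in> V" for v
    proof -
      consider "v \<in> X" | "v \<in> ?W" | "v \<in> V - ?T" using v by blast
      then show ?thesis using labX[of v] labW[of v] binM[of v] labS[of v] by cases auto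
    qed
    then show "lab \<in> V \<rightarrow>\<^sub>E {0..2 * M + 1}" by (auto simp: lab_def)
    show "lab v = 0 \<longleftrightarrow> v \<notin> ?T" if "v \<in> V" for v
      using that X(1) by (auto simp: lab_def)
    show "v \<in> X \<longleftrightarrow> 1 \<le> lab v \<and> lab v \<le> M" if v: "v \<in> V" for v
    proof -
      consider "v \<in> X" | "v \<in> ?W" | "v \<in> V - ?T" using v by blast
      then show ?thesis using labX[of v] labW[of v] labS[of v] X(1) by cases auto
    qed
    show "lab v = lab w" if vw: "v \<in> V" "w \<in> V" "c v = c w" for v w
    proof -
      consider "v \<in> X" | "v \<in> ?W" | "v \<in> V - ?T" using vw by blast
      then show ?thesis
      proof cases
        case 1
        then have "w \<in> X" "?C v = ?C w" using same_X[OF vw] colour_class_eq[of c v w V] vw(3) by blast+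
        then show ?thesis using labX(1)[OF 1] labX(1)[of w] by metis
      next
        case 2
        then have "w \<in> ?W" using same_X[OF vw] same_T[OF vw] by blast
        moreover have "bin v = bin w"
        proof -
          have "v \<in> ?C v" "w \<in> ?C v" using vw by (simp_all add: colour_class_def)
          then show ?thesis using bin(2) 2 by blast
        qed
        ultimately show ?thesis using labW 2 by simp
      next
        case 3
        then show ?thesis using labS[of v] labS[of w] same_T[OF vw] vw by auto
      qed
    qed
    show "c v = c w" if vw: "v \<in> X" "w \<in> V" "lab v = lab w" for v w
    proof -
      have "w \<in> X"
      proof (rule ccontr)
        assume "w \<notin> X"
        then consider "w \<in> ?W" | "w \<in> V - ?T" using vw by blast
        then show False using labX[of v] labW[of w] labS[of w] vw by cases auto
      qed
      then have "e (?C v) = e (?C w)" using labX(1) vw by simp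
      then have "?C v = ?C w" using bij_betw_imp_inj_on[OF e] vw \<open>w \<in> X\<close> by (auto dest: inj_onD)
      then show ?thesis using self[of v] vw XV by (auto simp: colour_class_def)
    qed
    show "card {v\<in>V. lab v = l} \<le> 2 * \<beta>" if l: "M < l" for l
    proof -
      have "{v\<in>V. lab v = l} \<subseteq> {x\<in>?W. bin x = l - (M + 1)}"
      proof
        fix v assume v: "v \<in> {v\<in>V. lab v = l}"
        then consider "v \<in> X" | "v \<in> ?W" | "v \<in> V - ?T" by blast
        then show "v \<in> {x\<in>?W. bin x = l - (M + 1)}"
          using labX[of v] labW[of v] labS[of v] v l by cases auto
      qed
      then have "card {v\<in>V. lab v = l} \<le> card {x\<in>?W. bin x = l - (M + 1)}"
        using finite_subset[OF T fin] by (intro card_mono) auto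
      also have "\<dots> \<le> 2 * \<beta>" using bin(4) unfolding UnW by blast
      finally show ?thesis .
    qed
  qed
qed

text \<open>Every fibre of \<open>separate_zero lab\<close> is a union of colour classes, so a
  degree into it is a sum of degrees into classes.\<close>

lemma labelled_degrees_agree:
  assumes eq: "\<And>u v \<omega>. u \<in> V \<Longrightarrow> v \<in> V \<Longrightarrow> c u = c v \<Longrightarrow>
      card {w\<in>V. adj u w \<and> c w = \<omega>} = card {w\<in>V. adj v w \<and> c w = \<omega>}"
    and lab: "\<And>v w. v \<in> V \<Longrightarrow> w \<in> V \<Longrightarrow> c v = c w \<Longrightarrow> lab v = lab w"
    and zero: "\<And>v. v \<in> V \<Longrightarrow> lab v = 0 \<Longrightarrow> v \<notin> nonsingletons V c"
    and uv: "u \<in> V" "v \<in> V" "c u = c v"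
  shows "card {w\<in>V. separate_zero lab w = l \<and> adj u w} = card {w\<in>V. separate_zero lab w = l \<and> adj v w}"
proof -
  let ?F = "{w\<in>V. separate_zero lab w = l}"
  have closed: "separate_zero lab w = separate_zero lab w'" if w: "w \<in> V" "w' \<in> V" "c w = c w'" for w w'
  proof (cases "lab w = 0")
    case True
    then have "\<not> 2 \<le> card (colour_class V c w)" using zero[OF w(1)] w by (simp add: nonsingletons_def)
    then have "card (colour_class V c w) = 1" using card_colour_class_pos[OF w(1)] by simp
    moreover have "w \<in> colour_class V c w" "w' \<in> colour_class V c w" using w by (auto simp: colour_class_def)
    ultimately have "w = w'" by (auto simp: card_1_singleton_iff)
    then show ?thesis by simp
  next
    case False
    then show ?thesis using lab[OF w] by (simp add: separate_zero_def)
  qed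
  have "card {w\<in>V. separate_zero lab w = l \<and> adj x w} = (\<Sum>\<omega>\<in>c ` ?F. card {w\<in>V. adj x w \<and> c w = \<omega>})" for x
  proof -
    have "{w\<in>V. separate_zero lab w = l \<and> adj x w} = (\<Union>\<omega>\<in>c ` ?F. {w\<in>V. adj x w \<and> c w = \<omega>})"
    proof (intro set_eqI iffI)
      fix y assume "y \<in> (\<Union>\<omega>\<in>c ` ?F. {w\<in>V. adj x w \<and> c w = \<omega>})"
      then obtain w where w: "w \<in> ?F" "y \<in> V" "adj x y" "c y = c w" by blast
      then show "y \<in> {w\<in>V. separate_zero lab w = l \<and> adj x w}" using closed[of y w] by simp
    qed blast
    also have "card \<dots> = (\<Sum>\<omega>\<in>c ` ?F. card {w\<in>V. adj x w \<and> c w = \<omega>})"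
      using fin by (intro card_UN_disjoint) auto
    finally show ?thesis .
  qed
  then show ?thesis using eq[OF uv] by simp
qed

end

subsection \<open>Elementary estimates\<close>

text \<open>On x >= 0 the product exp (- x^2 / 2) cosh x is nonincreasing, because sinh x <= x cosh
  x.\<close>

lemma cosh_le_exp_half_square: "cosh x \<le> exp (x\<^sup>2 / 2)" for x :: real
proof -
  have sinh_le: "sinh x \<le> x * cosh x" if "0 \<le> x" for x :: real
  proof -
    have "0 * cosh 0 - sinh 0 \<le> x * cosh x - sinh (x :: real)"
    proof (rule DERIV_nonneg_imp_nondecreasing[OF that])
      fix y :: real assume "0 \<le> y" "y \<le> x"
      then show "\<exists>d. ((\<lambda>x. x * cosh x - sinh x) has_real_derivative d) (at y) \<and> 0 \<le> d"
        by (intro exI[of _ "y * sinh y"] conjI) (auto intro!: derivative_eq_intros)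
    qed
    then show ?thesis by simp
  qed
  have le: "cosh x \<le> exp (x\<^sup>2 / 2)" if "0 \<le> x" for x :: real
  proof -
    have "exp (- (x\<^sup>2 / 2)) * cosh x \<le> exp (- (0\<^sup>2 / 2)) * cosh (0 :: real)"
    proof (rule DERIV_nonpos_imp_nonincreasing[OF that])
      fix y :: real assume y: "0 \<le> y" "y \<le> x"
      have "((\<lambda>x. exp (- (x\<^sup>2 / 2)) * cosh x) has_real_derivative exp (- (y\<^sup>2 / 2)) * (sinh y - y * cosh y)) (at y)"
        by (auto intro!: derivative_eq_intros simp: algebra_simps)
      moreover have "exp (- (y\<^sup>2 / 2)) * (sinh y - y * cosh y) \<le> 0"
        using sinh_le[OF y(1)] by (simp add: mult_le_0_iff)
      ultimately show "\<exists>d. ((\<lambda>x. exp (- (x\<^sup>2 / 2)) * cosh x) has_real_derivative d) (at y) \<and> d \<le> 0" by blast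
    qed
    then have "exp (x\<^sup>2 / 2) * (exp (- (x\<^sup>2 / 2)) * cosh x) \<le> exp (x\<^sup>2 / 2) * 1" by (intro mult_left_mono) auto
    then show ?thesis by (simp add: mult.assoc[symmetric] exp_add[symmetric])
  qed
  show ?thesis using le[of x] le[of "- x"] by (cases "0 \<le> x") auto
qed

text \<open>Bounding 1 + a by exp a makes the mean of the two powers equal to exp (- p y) cosh (p y
  z).\<close>

lemma parity_part_le:
  fixes p z :: real
  assumes "0 \<le> p" "0 \<le> 1 - p - p * z" "0 \<le> z"
  shows "((1 - p + p * z) ^ y + (1 - p - p * z) ^ y) / 2 \<le> exp (- (p * y) + (p * y * z)\<^sup>2 / 2)"
proof -
  have "0 \<le> p * z" using assms by simp
  then have "(1 - p + p * z) ^ y \<le> exp (- p + p * z) ^ y"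
    using exp_ge_add_one_self[of "- p + p * z"] assms by (intro power_mono; linarith)
  moreover have "(1 - p - p * z) ^ y \<le> exp (- p - p * z) ^ y"
    using exp_ge_add_one_self[of "- p - p * z"] assms by (intro power_mono; linarith)
  ultimately have "((1 - p + p * z) ^ y + (1 - p - p * z) ^ y) / 2 \<le> (exp (y * (- p + p * z)) + exp (y * (- p - p * z))) / 2"
    by (simp add: exp_of_nat_mult)
  also have "\<dots> = exp (- (p * y)) * cosh (p * y * z)"
    by (simp add: cosh_def exp_add[symmetric] algebra_simps)
  also have "\<dots> \<le> exp (- (p * y)) * exp ((p * y * z)\<^sup>2 / 2)"
    using cosh_le_exp_half_square by (intro mult_left_mono) auto
  finally show ?thesis by (simp add: exp_add[symmetric])
qed

section \<open>Counting labellings and bounding logarithms\<close>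

lemma binomial_le_exp: "0 < s \<Longrightarrow> s \<le> n \<Longrightarrow> real (n choose s) \<le> exp (s * (1 + ln (n / s)))"
proof -
  assume s: "0 < s" "s \<le> n"
  have "(real s) ^ s \<le> exp (real s) * fact s"
  proof -
    have "(real s) ^ s / fact s \<le> exp (real s)"
    proof -
      have "(\<Sum>k\<in>{s}. (real s) ^ k /\<^sub>R fact k) \<le> (\<Sum>k. (real s) ^ k /\<^sub>R fact k)"
        using summable_exp_generic[of "real s"] by (intro sum_le_suminf) auto
      then show ?thesis by (simp add: exp_def divide_inverse mult.commute)
    qed
    then show ?thesis by (simp add: field_simps)
  qed
  then have f: "1 / fact s \<le> exp (real s) / (real s) ^ s" using s by (simp add: field_simps)
  have "real ((n choose s) * fact s) \<le> real (n ^ s)" using binomial_fact_pow of_nat_le_iff by blast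
  then have "real (n choose s) * fact s \<le> real n ^ s" by simp
  then have "real (n choose s) \<le> real n ^ s * (1 / fact s)" by (simp add: field_simps)
  also have "\<dots> \<le> real n ^ s * (exp (real s) / (real s) ^ s)" using f by (intro mult_left_mono) auto
  also have "\<dots> = exp (real s) * (real n / real s) ^ s" by (simp add: power_divide)
  also have "real n / real s = exp (ln (n / s))" using s by simp
  also have "exp (real s) * exp (ln (n / s)) ^ s = exp (s * (1 + ln (n / s)))"
    by (simp add: exp_of_nat_mult[symmetric] exp_add[symmetric] algebra_simps)
  finally show ?thesis .
qed

text \<open>A labelling is determined by its support and its nonzero values there.\<close>

lemma card_labellings:
  assumes "finite V"
  shows "card {f \<in> V \<rightarrow>\<^sub>E {0..m :: nat}. card {v\<in>V. f v \<noteq> 0} = s} \<le> (card V choose s) * m ^ s"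
proof -
  let ?S = "{S. S \<subseteq> V \<and> card S = s}"
  let ?\<Phi> = "\<lambda>f. ({v\<in>V. f v \<noteq> 0}, restrict f {v\<in>V. f v \<noteq> 0})"
  let ?L = "{f \<in> V \<rightarrow>\<^sub>E {0..m :: nat}. card {v\<in>V. f v \<noteq> 0} = s}"
  have finS: "finite ?S" using assms by auto
  have finP: "finite (S \<rightarrow>\<^sub>E {1..m})" if "S \<in> ?S" for S
    using that finite_subset[OF _ assms] by (intro finite_PiE) auto
  have "inj_on ?\<Phi> ?L"
  proof (rule inj_onI)
    fix f g assume f: "f \<in> ?L" and g: "g \<in> ?L" and eq: "?\<Phi> f = ?\<Phi> g"
    show "f = g"
    proof
      fix v
      show "f v = g v"
      proof (cases "v \<in> V")
        case False
        then show ?thesis using f g by (auto simp: PiE_def extensional_def)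
      next
        case True
        have e: "{v\<in>V. f v \<noteq> 0} = {v\<in>V. g v \<noteq> 0}"
          "restrict f {v\<in>V. f v \<noteq> 0} = restrict g {v\<in>V. g v \<noteq> 0}"
          using arg_cong[OF eq, of fst] arg_cong[OF eq, of snd] unfolding fst_conv snd_conv .
        have "f v \<noteq> 0 \<longleftrightarrow> g v \<noteq> 0" using e(1) True by blast
        moreover have "restrict f {v\<in>V. f v \<noteq> 0} v = restrict g {v\<in>V. g v \<noteq> 0} v" by (rule fun_cong[OF e(2)])
        ultimately show ?thesis using True by (auto simp: restrict_def split: if_splits)
      qed
    qed
  qed
  moreover have "?\<Phi> ` ?L \<subseteq> (SIGMA S:?S. S \<rightarrow>\<^sub>E {1..m})" by (auto simp: PiE_def Pi_def)
  moreover have "finite (SIGMA S:?S. S \<rightarrow>\<^sub>E {1..m})" using finS finP by (intro finite_SigmaI) auto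
  ultimately have "card ?L \<le> card (SIGMA S:?S. S \<rightarrow>\<^sub>E {1..m})" by (rule card_inj_on_le)
  also have "\<dots> = (\<Sum>S\<in>?S. card (S \<rightarrow>\<^sub>E {1..m}))" using finS finP by (intro card_SigmaI) auto
  also have "\<dots> = (\<Sum>S\<in>?S. m ^ s)"
    using finite_subset[OF _ assms] by (intro sum.cong) (auto simp: card_PiE)
  also have "\<dots> = (card V choose s) * m ^ s" using n_subsets[OF assms] by simp
  finally show ?thesis .
qed

text \<open>A rational certificate for upper bounds on logarithms, from 1 + c + c^2 / 2 <= exp c
  raised to the power k. Its uses below pick k and c so that k c is the bound wanted.\<close>

lemma ln_le_steps: "0 < x \<Longrightarrow> 0 \<le> c \<Longrightarrow> x \<le> (1 + c + c\<^sup>2 / 2) ^ k \<Longrightarrow> ln x \<le> real k * c" for x c :: real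
proof -
  assume x: "0 < x" "0 \<le> c" "x \<le> (1 + c + c\<^sup>2 / 2) ^ k"
  have "x \<le> exp c ^ k"
    using x(3) exp_lower_Taylor_quadratic[OF x(2)] x(2) by (meson order_trans power_mono add_nonneg_nonneg zero_le_one zero_le_power2 divide_nonneg_nonneg zero_le_numeral)
  then have "x \<le> exp (real k * c)" by (simp add: exp_of_nat_mult)
  then show ?thesis using x(1) by (metis exp_gt_zero ln_exp ln_le_cancel_iff)
qed

text \<open>Lower bounds on logarithms need an upper bound on e instead, here e < 2.72. The value is
  nearly sharp since \<open>heavy_exponent\<close> has little slack.\<close>

lemma ln_1000_ge: "69 / 10 \<le> ln (1000 :: real)"
proof -
  have "exp (69 / 10) * exp (1 / 10) = (exp 1 :: real) ^ 7" by (simp add: exp_add[symmetric] exp_of_nat_mult[symmetric])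
  also have "\<dots> \<le> (272 / 100 :: real) ^ 7" using e_less_272 by (intro power_mono) auto
  finally have a: "exp (69 / 10) * exp (1 / 10) \<le> (272 / 100 :: real) ^ 7" .
  have "1105 / 1000 \<le> exp (1 / 10 :: real)"
    using exp_lower_Taylor_quadratic[of "1 / 10"] by (simp add: power2_eq_square)
  then have "exp (69 / 10) * (1105 / 1000) \<le> exp (69 / 10) * exp (1 / 10 :: real)" by (intro mult_left_mono) auto
  moreover have "(272 / 100 :: real) ^ 7 \<le> 1000 * (1105 / 1000)" by (simp add: power_divide)
  ultimately have "exp (69 / 10 :: real) \<le> 1000" using a by linarith
  then show ?thesis by (metis exp_gt_zero ln_exp ln_le_cancel_iff zero_less_numeral)
qed

subsection \<open>Labellings with small classes\<close>

text \<open>A choice made by the labelling alone, so that rows and the vertices they are compared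
  with are fixed before any random edge is exposed.\<close>

definition class_rep :: "nat set \<Rightarrow> (nat \<Rightarrow> nat) \<Rightarrow> nat \<Rightarrow> nat" where
  "class_rep V lab v = Min {w\<in>V. lab w = lab v}"

definition class_rows :: "nat set \<Rightarrow> nat \<Rightarrow> (nat \<Rightarrow> nat) \<Rightarrow> nat set" where
  "class_rows V M lab = {v\<in>V. 1 \<le> lab v \<and> lab v \<le> M \<and> class_rep V lab v \<noteq> v}"

definition inner_part :: "nat set \<Rightarrow> nat \<Rightarrow> (nat \<Rightarrow> nat) \<Rightarrow> nat set" where
  "inner_part V M lab = {v\<in>V. 1 \<le> lab v \<and> lab v \<le> M}"

definition parities_agree ::
  "nat set \<Rightarrow> nat set set \<Rightarrow> (nat set \<Rightarrow> bool) \<Rightarrow> nat set \<Rightarrow> nat set \<Rightarrow> (nat \<Rightarrow> nat) \<Rightarrow> bool" where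
  "parities_agree V G0 b A Y lab \<longleftrightarrow> (\<forall>v\<in>A. \<forall>l\<in>separate_zero lab ` Y.
     odd (card {w\<in>V. separate_zero lab w = l \<and> xor_adj G0 b v w}) =
     odd (card {w\<in>V. separate_zero lab w = l \<and> xor_adj G0 b (class_rep V lab v) w}))"

definition cross_edges :: "(nat set \<Rightarrow> bool) \<Rightarrow> nat set \<Rightarrow> nat set \<Rightarrow> nat" where
  "cross_edges b A Y = (\<Sum>v\<in>A. card {w\<in>Y. b {v, w}})"

lemma class_rep_props:
  assumes "finite V" "v \<in> V"
  shows "class_rep V lab v \<in> V" "lab (class_rep V lab v) = lab v" "class_rep V lab (class_rep V lab v) = class_rep V lab v"
proof -
  have "Min {w\<in>V. lab w = lab v} \<in> {w\<in>V. lab w = lab v}" using assms by (intro Min_in) auto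
  then show 1: "class_rep V lab v \<in> V" "lab (class_rep V lab v) = lab v" by (auto simp: class_rep_def)
  show "class_rep V lab (class_rep V lab v) = class_rep V lab v" using 1(2) by (simp add: class_rep_def)
qed

lemma card_separate_zero_fibre:
  assumes "finite V" "Y \<subseteq> V" "l \<in> separate_zero lab ` Y" "1 \<le> K"
    and "\<And>l. l \<in> lab ` Y \<Longrightarrow> 0 < l \<Longrightarrow> card {v\<in>Y. lab v = l} \<le> K"
  shows "card {w\<in>Y. separate_zero lab w = l} \<le> K"
proof -
  obtain v where v: "v \<in> Y" "l = separate_zero lab v" using assms(3) by blast
  show ?thesis
  proof (cases "lab v = 0")
    case True
    then have "{w\<in>Y. separate_zero lab w = l} \<subseteq> {v}" using v by (auto simp: separate_zero_def split: if_splits)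
    then have "card {w\<in>Y. separate_zero lab w = l} \<le> card {v}" by (intro card_mono) auto
    then show ?thesis using assms(4) by simp
  next
    case False
    then have "{w\<in>Y. separate_zero lab w = l} = {w\<in>Y. lab w = lab v}"
      using v by (auto simp: separate_zero_def split: if_splits)
    then show ?thesis using assms(5)[of "lab v"] v False by simp
  qed
qed

context
  fixes V :: "nat set" and n :: nat and p :: real
  assumes fin: "finite V" and n: "n = card V" "1000 \<le> n" and p: "p = 100 / real n"
begin

lemma p01: "0 \<le> p" "p \<le> 1"
  using n(2) by (auto simp: p)

text \<open>One weighted parity estimate gives two gains. Even with the weight z, prescribed
  parities cost each row exp (- 3/4 p y) for a fibre of size y; and more than \<Lambda> / 4 cross
  edges, where \<Lambda> is their expected number, gain the factor z to the power - \<Lambda> /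
  4.\<close>

lemma prob_rows_outer:
  fixes lab :: "nat \<Rightarrow> nat"
  assumes \<beta>: "1 \<le> \<beta>" "1000 * \<beta> \<le> n"
    and fib: "\<And>l. M < l \<Longrightarrow> card {v\<in>V. lab v = l} \<le> 2 * \<beta>"
  defines "A \<equiv> class_rows V M lab" and "Y \<equiv> V - inner_part V M lab"
  defines "\<Lambda> \<equiv> p * card Y * card A"
  shows "bern_prob (all_edges V) p (\<lambda>b. parities_agree V G0 b A Y lab \<and> \<Lambda> / 4 < cross_edges b A Y)
    \<le> exp (- \<Lambda> * (3 / 4 + ln (n / (400 * \<beta>)) / 8))"
proof -
  \<comment> \<open>The largest reward for which the quadratic term in \<open>parity_part_le\<close>
    stays below a quarter of the linear one: fibres have at most 2 \<beta> elements, and p (2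
    \<beta>) z^2 / 2 = 1/4.\<close>
  define z where "z = sqrt (n / (400 * \<beta>))"
  define N0 where "N0 = nat \<lfloor>\<Lambda> / 4\<rfloor> + 1"
  have ratio: "1 \<le> n / (400 * \<beta>)" using \<beta> by (simp add: field_simps)
  then have z1: "1 \<le> z" by (simp add: z_def)
  have z2: "z\<^sup>2 = n / (400 * \<beta>)" using \<beta> by (simp add: z_def)
  have sub: "A \<subseteq> V" "Y \<subseteq> V" "A \<inter> Y = {}"
    by (auto simp: A_def Y_def class_rows_def inner_part_def)
  have finY: "finite Y" using sub fin finite_subset by blast
  have \<Lambda>0: "0 \<le> \<Lambda>" using p01 by (simp add: \<Lambda>_def)
  have pz: "0 \<le> 1 - p - p * z"
  proof -
    have z20: "z \<le> sqrt n / 20"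
    proof -
      have "z \<le> sqrt (n / 400)"
        unfolding z_def using \<beta> by (intro real_sqrt_le_mono) (simp add: field_simps)
      also have "\<dots> = sqrt n / sqrt (20\<^sup>2)" by (simp add: real_sqrt_divide)
      finally show ?thesis by (simp only: real_sqrt_abs)
    qed
    have "p * z \<le> p * (sqrt n / 20)" using z20 p01(1) by (intro mult_left_mono) auto
    also have "\<dots> = 5 / sqrt n" using real_sqrt_mult_self[of n] n(2) unfolding p by (simp add: field_simps)
    also have "\<dots> \<le> 5 / 25"
    proof (rule divide_left_mono)
      have "sqrt (25\<^sup>2) \<le> sqrt n" using n(2) by (intro real_sqrt_le_mono) simp
      then show "25 \<le> sqrt n" by (simp only: real_sqrt_abs)
    qed (use n(2) in auto)
    finally have "p * z \<le> 1 / 5" by simp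
    moreover have "p \<le> 1 / 10" using n(2) by (simp add: p)
    ultimately show ?thesis by simp
  qed
  have rep: "class_rep V lab v \<notin> A \<union> Y" if "v \<in> A" for v
  proof -
    have v: "v \<in> V" "1 \<le> lab v" "lab v \<le> M" using that by (auto simp: A_def class_rows_def)
    note r = class_rep_props[OF fin v(1), of lab]
    show ?thesis using r v by (auto simp: A_def Y_def class_rows_def inner_part_def)
  qed
  let ?P = "bern_prob (all_edges V) p (\<lambda>b. parities_agree V G0 b A Y lab \<and> N0 \<le> cross_edges b A Y)"
  let ?y = "\<lambda>l. card {w\<in>Y. separate_zero lab w = l}"
  have "?P * z ^ N0 \<le> (\<Prod>l\<in>separate_zero lab ` Y. ((1 - p + p * z) ^ ?y l + (1 - p - p * z) ^ ?y l) / 2) ^ card A"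
    unfolding parities_agree_def cross_edges_def
    by (rule prob_parities_agree[OF fin p01 sub(1,2,3) rep z1 pz]) 
  also have "\<dots> \<le> exp (- (3 / 4) * (p * card Y)) ^ card A"
  proof (rule power_mono)
    have nonneg: "0 \<le> ((1 - p + p * z) ^ ?y l + (1 - p - p * z) ^ ?y l) / 2" for l
      using pz p01 z1 by (intro divide_nonneg_nonneg add_nonneg_nonneg zero_le_power) auto
    then show "0 \<le> (\<Prod>l\<in>separate_zero lab ` Y. ((1 - p + p * z) ^ ?y l + (1 - p - p * z) ^ ?y l) / 2)"
      by (intro prod_nonneg) auto
    have "(\<Prod>l\<in>separate_zero lab ` Y. ((1 - p + p * z) ^ ?y l + (1 - p - p * z) ^ ?y l) / 2)
       \<le> (\<Prod>l\<in>separate_zero lab ` Y. exp (- (3 / 4) * (p * ?y l)))"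
    proof (intro prod_mono conjI nonneg)
      fix l assume l: "l \<in> separate_zero lab ` Y"
      have y: "?y l \<le> 2 * \<beta>"
      proof (rule card_separate_zero_fibre[OF fin sub(2) l])
        show "1 \<le> 2 * \<beta>" using \<beta> by simp
        fix l' assume l': "l' \<in> lab ` Y" "0 < l'"
        then have "M < l'" by (auto simp: Y_def inner_part_def)
        then have "card {v\<in>V. lab v = l'} \<le> 2 * \<beta>" by (rule fib)
        moreover have "card {v\<in>Y. lab v = l'} \<le> card {v\<in>V. lab v = l'}"
          using sub fin by (intro card_mono) auto
        ultimately show "card {v\<in>Y. lab v = l'} \<le> 2 * \<beta>" by simp
      qed
      have "(p * ?y l * z)\<^sup>2 / 2 = p * ?y l * (p * ?y l * z\<^sup>2 / 2)" by (simp add: power2_eq_square)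
      also have "\<dots> \<le> p * ?y l * (p * (2 * \<beta>) * z\<^sup>2 / 2)"
        using y p01 by (intro mult_left_mono divide_right_mono mult_right_mono) auto
      also have "p * (2 * \<beta>) * z\<^sup>2 / 2 = 1 / 4" using \<beta> n(2) unfolding z2 p by (simp add: field_simps)
      finally have sq: "(p * ?y l * z)\<^sup>2 / 2 \<le> p * ?y l * (1 / 4)" .
      have "((1 - p + p * z) ^ ?y l + (1 - p - p * z) ^ ?y l) / 2 \<le> exp (- (p * ?y l) + (p * ?y l * z)\<^sup>2 / 2)"
        using p01 pz z1 by (intro parity_part_le) auto
      also have "\<dots> \<le> exp (- (3 / 4) * (p * ?y l))" using sq by simp
      finally show "((1 - p + p * z) ^ ?y l + (1 - p - p * z) ^ ?y l) / 2 \<le> exp (- (3 / 4) * (p * ?y l))" .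
    qed
    also have "\<dots> = exp (\<Sum>l\<in>separate_zero lab ` Y. - (3 / 4) * (p * ?y l))"
      using finY by (simp add: exp_sum)
    also have "(\<Sum>l\<in>separate_zero lab ` Y. - (3 / 4) * (p * ?y l)) = - (3 / 4) * (p * (\<Sum>l\<in>separate_zero lab ` Y. ?y l))"
      by (simp add: sum_distrib_left)
    also have "(\<Sum>l\<in>separate_zero lab ` Y. ?y l) = card Y"
    proof -
      have "card Y = card (\<Union>l\<in>separate_zero lab ` Y. {w\<in>Y. separate_zero lab w = l})" by (rule arg_cong[of _ _ card]) auto
      also have "\<dots> = (\<Sum>l\<in>separate_zero lab ` Y. ?y l)" using finY by (intro card_UN_disjoint) auto
      finally show ?thesis by simp
    qed
    finally show "(\<Prod>l\<in>separate_zero lab ` Y. ((1 - p + p * z) ^ ?y l + (1 - p - p * z) ^ ?y l) / 2) \<le> exp (- (3 / 4) * (p * card Y))" .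
  qed
  also have "\<dots> = exp (- (3 / 4) * \<Lambda>)" by (simp add: exp_of_nat_mult[symmetric] \<Lambda>_def algebra_simps)
  finally have 1: "?P * z ^ N0 \<le> exp (- (3 / 4) * \<Lambda>)" .
  have lnz: "ln z = ln (n / (400 * \<beta>)) / 2" unfolding z_def using ratio by (intro ln_sqrt) linarith
  have "exp (\<Lambda> / 4 * ln z) \<le> exp (N0 * ln z)"
  proof -
    have "\<Lambda> / 4 \<le> N0" using \<Lambda>0 unfolding N0_def by linarith
    moreover have "0 \<le> ln z" using z1 by simp
    ultimately have "\<Lambda> / 4 * ln z \<le> N0 * ln z" by (rule mult_right_mono)
    then show ?thesis by (rule iffD2[OF exp_le_cancel_iff])
  qed
  also have "\<dots> = z ^ N0" using z1 by (simp add: exp_of_nat_mult)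
  finally have "?P * exp (\<Lambda> / 4 * ln z) \<le> ?P * z ^ N0" by (intro mult_left_mono) auto
  with 1 have "?P * exp (\<Lambda> / 4 * ln z) \<le> exp (- (3 / 4) * \<Lambda>)" by linarith
  then have "?P * exp (\<Lambda> / 4 * ln z) * exp (- (\<Lambda> / 4 * ln z)) \<le> exp (- (3 / 4) * \<Lambda>) * exp (- (\<Lambda> / 4 * ln z))"
    by (intro mult_right_mono) auto
  then have "?P \<le> exp (- (3 / 4) * \<Lambda> - \<Lambda> / 4 * ln z)" by (simp add: mult.assoc exp_add[symmetric])
  also have "- (3 / 4) * \<Lambda> - \<Lambda> / 4 * ln z = - \<Lambda> * (3 / 4 + ln (n / (400 * \<beta>)) / 8)"
    unfolding lnz by (simp add: algebra_simps)
  finally have 2: "?P \<le> exp (- \<Lambda> * (3 / 4 + ln (n / (400 * \<beta>)) / 8))" .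
  have "bern_prob (all_edges V) p (\<lambda>b. parities_agree V G0 b A Y lab \<and> \<Lambda> / 4 < cross_edges b A Y) \<le> ?P"
  proof (rule bern_prob_mono_supp[OF finite_all_edges[OF fin]])
    fix b assume "parities_agree V G0 b A Y lab \<and> \<Lambda> / 4 < cross_edges b A Y"
    moreover have "N0 \<le> cross_edges b A Y" if "\<Lambda> / 4 < cross_edges b A Y"
      using that \<Lambda>0 unfolding N0_def by linarith
    ultimately show "parities_agree V G0 b A Y lab \<and> N0 \<le> cross_edges b A Y" by blast
  qed
  with 2 show ?thesis by simp
qed

text \<open>The binomials for the choice of \<open>X\<close> and the \<open>2 ^ card X\<close> for that of \<open>A\<close> are beaten by the Chernoff bound.\<close>

lemma prob_atypical:
  "bern_prob (all_edges V) p (\<lambda>b. \<exists>X A. X \<subseteq> V \<and> A \<subseteq> X \<and> n \<le> 600 * card X \<and> 1000 * card X \<le> 501 * n \<and> card X \<le> 2 * card A \<and>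
      cross_edges b A (V - X) \<le> p * card (V - X) * card A / 4) \<le> (n + 1) * exp (- real n / 400)"
proof -
  let ?\<P> = "\<lambda>x. {(X, A). X \<subseteq> V \<and> A \<subseteq> X \<and> card X = x \<and> x \<le> 2 * card A}"
  let ?Q = "\<lambda>XA b. cross_edges b (snd XA) (V - fst XA) \<le> p * card (V - fst XA) * card (snd XA) / 4"
  let ?xs = "{x\<in>{0..n}. n \<le> 600 * x \<and> 1000 * x \<le> 501 * n}"
  have finE: "finite (all_edges V)" using finite_all_edges[OF fin] .
  have finP: "finite (?\<P> x)" for x
    using fin by (intro finite_subset[of "?\<P> x" "Pow V \<times> Pow V"]) auto
  have one: "bern_prob (all_edges V) p (?Q XA) \<le> exp (- (998 / 100) * x)" if x: "x \<in> ?xs" and XA: "XA \<in> ?\<P> x" for x XA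
  proof -
    define X A where "X = fst XA" and "A = snd XA"
    have h: "X \<subseteq> V" "A \<subseteq> X" "card X = x" "x \<le> 2 * card A" using XA by (auto simp: X_def A_def)
    have finX: "finite X" using h fin finite_subset by blast
    define \<Lambda> where "\<Lambda> = p * card (V - X) * card A"
    have \<Lambda>0: "0 \<le> \<Lambda>" using p01 by (simp add: \<Lambda>_def)
    have cV: "real (card (V - X)) = real n - real x"
      using h finX card_mono[OF fin h(1)] by (simp add: card_Diff_subset n of_nat_diff)
    \<comment> \<open>At least 499/1000 of the vertices lie outside \<open>X\<close>, and
      \<open>card A\<close> is at least x / 2. The Chernoff exponent is (3/4 - 7/20) \<Lambda> = 2/5
      \<Lambda>, hence at least 9.98 x.\<close>
    have "499 / 10 \<le> p * card (V - X)"
      using x n(2) unfolding cV p by (simp add: field_simps)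
    moreover have "x / 2 \<le> card A" using h(4) by simp
    ultimately have "499 / 10 * (x / 2) \<le> \<Lambda>" unfolding \<Lambda>_def by (intro mult_mono) auto
    then have \<Lambda>x: "998 / 100 * x \<le> 2 / 5 * \<Lambda>" by simp
    define K where "K = nat \<lfloor>\<Lambda> / 4\<rfloor>"
    have "bern_prob (all_edges V) p (?Q XA) \<le> bern_prob (all_edges V) p (\<lambda>b. (\<Sum>v\<in>A. card {w\<in>V - X. b {v, w}}) \<le> K)"
    proof (rule bern_prob_mono_supp[OF finE])
      fix b assume "?Q XA b"
      then show "(\<Sum>v\<in>A. card {w\<in>V - X. b {v, w}}) \<le> K"
        unfolding cross_edges_def K_def X_def[symmetric] A_def[symmetric] \<Lambda>_def[symmetric] by linarith
    qed
    also have "\<dots> \<le> 4 ^ K * exp (- (3 / 4) * p * (real (card A) * real (card (V - X))))"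
      using h by (intro prob_few_cross_edges[OF fin p01]) auto
    also have "\<dots> = 4 ^ K * exp (- (3 / 4) * \<Lambda>)" by (simp add: \<Lambda>_def mult_ac)
    also have "(4 :: real) ^ K = exp (K * ln 4)" by (simp add: exp_of_nat_mult)
    also have "exp (K * ln 4) * exp (- (3 / 4) * \<Lambda>) \<le> exp (\<Lambda> / 4 * (7 / 5)) * exp (- (3 / 4) * \<Lambda>)"
    proof -
      have "ln 4 \<le> real 14 * (1 / 10 :: real)"
        by (rule ln_le_steps) (simp_all add: power2_eq_square power_divide)
      moreover have "K \<le> \<Lambda> / 4" using \<Lambda>0 unfolding K_def by linarith
      ultimately have "K * ln 4 \<le> \<Lambda> / 4 * (7 / 5)" using \<Lambda>0 by (intro mult_mono) auto
      then show ?thesis by simp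
    qed
    also have "\<dots> = exp (- (2 / 5) * \<Lambda>)" by (simp add: exp_add[symmetric])
    also have "\<dots> \<le> exp (- (998 / 100) * x)" using \<Lambda>x by simp
    finally show ?thesis .
  qed
  \<comment> \<open>1 + ln 600 + ln 2 is at most 1 + 6.5 + 0.7 = 8.2, less than 9.98; the difference
    1.78 x exceeds n / 400 since x >= n / 600.\<close>
  have cnt: "real (card (?\<P> x)) \<le> exp (x * (82 / 10))" if x: "x \<in> ?xs" for x
  proof -
    have x0: "0 < x" "x \<le> n" using x n(2) by auto
    have "?\<P> x \<subseteq> (SIGMA X:{X. X \<subseteq> V \<and> card X = x}. Pow X)" by blast
    moreover have finS: "finite {X. X \<subseteq> V \<and> card X = x}" "\<And>X. X \<subseteq> V \<Longrightarrow> finite X" using fin finite_subset by auto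
    ultimately have "card (?\<P> x) \<le> card (SIGMA X:{X. X \<subseteq> V \<and> card X = x}. Pow X)"
      by (intro card_mono finite_SigmaI) (blast | simp)+
    also have "\<dots> = (\<Sum>X\<in>{X. X \<subseteq> V \<and> card X = x}. card (Pow X))" using finS by (intro card_SigmaI) auto
    also have "\<dots> = (\<Sum>X\<in>{X. X \<subseteq> V \<and> card X = x}. 2 ^ x)" using finS by (intro sum.cong) (auto simp: card_Pow)
    also have "\<dots> = (n choose x) * 2 ^ x" using n_subsets[OF fin] n by simp
    finally have "real (card (?\<P> x)) \<le> real ((n choose x) * 2 ^ x)" by (rule of_nat_mono)
    then have "real (card (?\<P> x)) \<le> real (n choose x) * 2 ^ x"
      by (simp only: of_nat_mult of_nat_power of_nat_numeral)
    also have "\<dots> \<le> exp (x * (1 + ln (n / x))) * exp (7 / 10) ^ x"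
    proof (intro mult_mono power_mono)
      show "real (n choose x) \<le> exp (x * (1 + ln (n / x)))" using binomial_le_exp[OF x0] by simp
      have "ln 2 \<le> real 7 * (1 / 10 :: real)" by (rule ln_le_steps) (simp_all add: power2_eq_square power_divide)
      then show "2 \<le> exp (7 / 10 :: real)" by (metis exp_le_cancel_iff exp_ln zero_less_numeral of_nat_numeral times_divide_eq_right mult.right_neutral)
    qed auto
    also have "\<dots> = exp (x * (1 + ln (n / x) + 7 / 10))" by (simp add: exp_of_nat_mult[symmetric] exp_add[symmetric] algebra_simps)
    also have "\<dots> \<le> exp (x * (82 / 10))"
    proof -
      have "ln (n / x) \<le> real 26 * (1 / 4)"
        using x x0 by (intro ln_le_steps) (simp_all add: power2_eq_square power_divide field_simps)
      then show ?thesis using x0 by simp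
    qed
    finally show ?thesis .
  qed
  have "bern_prob (all_edges V) p (\<lambda>b. \<exists>X A. X \<subseteq> V \<and> A \<subseteq> X \<and> n \<le> 600 * card X \<and> 1000 * card X \<le> 501 * n \<and> card X \<le> 2 * card A \<and>
      cross_edges b A (V - X) \<le> p * card (V - X) * card A / 4)
    \<le> (\<Sum>x\<in>?xs. bern_prob (all_edges V) p (\<lambda>b. \<exists>XA\<in>?\<P> x. ?Q XA b))"
  proof (rule bern_prob_union[OF finE])
    fix b assume "\<exists>X A. X \<subseteq> V \<and> A \<subseteq> X \<and> n \<le> 600 * card X \<and> 1000 * card X \<le> 501 * n \<and> card X \<le> 2 * card A \<and>
      cross_edges b A (V - X) \<le> p * card (V - X) * card A / 4"
    then obtain X A where h: "X \<subseteq> V" "A \<subseteq> X" "n \<le> 600 * card X" "1000 * card X \<le> 501 * n" "card X \<le> 2 * card A"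
      "cross_edges b A (V - X) \<le> p * card (V - X) * card A / 4" by blast
    have "card X \<le> n" using card_mono[OF fin h(1)] n by simp
    then have "card X \<in> ?xs" using h by simp
    moreover have "(X, A) \<in> ?\<P> (card X)" using h by simp
    moreover have "?Q (X, A) b" using h by simp
    ultimately show "\<exists>x\<in>?xs. \<exists>XA\<in>?\<P> x. ?Q XA b" by blast
  qed auto
  also have "\<dots> \<le> (\<Sum>x\<in>?xs. exp (- real n / 400))"
  proof (rule sum_mono)
    fix x assume x: "x \<in> ?xs"
    have "bern_prob (all_edges V) p (\<lambda>b. \<exists>XA\<in>?\<P> x. ?Q XA b) \<le> (\<Sum>XA\<in>?\<P> x. bern_prob (all_edges V) p (?Q XA))"
      by (rule bern_prob_union[OF finE _ finP]) blast
    also have "\<dots> \<le> (\<Sum>XA\<in>?\<P> x. exp (- (998 / 100) * x))" using one[OF x] by (intro sum_mono) auto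
    also have "\<dots> = real (card (?\<P> x)) * exp (- (998 / 100) * x)" by simp
    also have "\<dots> \<le> exp (x * (82 / 10)) * exp (- (998 / 100) * x)" using cnt[OF x] by (intro mult_right_mono) auto
    also have "\<dots> = exp (- (178 / 100) * x)" by (simp add: exp_add[symmetric])
    also have "\<dots> \<le> exp (- real n / 400)" using x by simp
    finally show "bern_prob (all_edges V) p (\<lambda>b. \<exists>XA\<in>?\<P> x. ?Q XA b) \<le> exp (- real n / 400)" .
  qed
  also have "\<dots> = card ?xs * exp (- real n / 400)" by simp
  also have "\<dots> \<le> (n + 1) * exp (- real n / 400)"
  proof (rule mult_right_mono)
    have "card ?xs \<le> card {0..n}" by (intro card_mono) auto
    then show "real (card ?xs) \<le> real (n + 1)" by simp
  qed simp
  finally show ?thesis .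
qed

end

text \<open>What is kept of the colouring: conditions on sizes alone, so that the union bound can
  run over all functions satisfying them.\<close>

definition small_class_labelling :: "nat set \<Rightarrow> nat \<Rightarrow> nat \<Rightarrow> (nat \<Rightarrow> nat) \<Rightarrow> bool" where
  "small_class_labelling V \<beta> M lab \<longleftrightarrow> 1 \<le> \<beta> \<and> 1000 * \<beta> \<le> card V \<and> M = card V div \<beta> + 1 \<and>
     lab \<in> V \<rightarrow>\<^sub>E {0..2 * M + 1} \<and> card V \<le> 300 * card {v\<in>V. lab v \<noteq> 0} \<and>
     (\<forall>l>M. card {v\<in>V. lab v = l} \<le> 2 * \<beta>) \<and>
     card {v\<in>V. lab v \<noteq> 0} \<le> 2 * card (inner_part V M lab) \<and>
     2 * card (inner_part V M lab) \<le> card {v\<in>V. lab v \<noteq> 0} + 2 * \<beta> \<and>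
     card (inner_part V M lab) \<le> 2 * card (class_rows V M lab)"

context
  fixes V :: "nat set" and n :: nat and p :: real
  assumes fin: "finite V" and n: "n = card V" "1000 \<le> n" and p: "p = 100 / real n"
begin

text \<open>With \<kappa> = ln (n / \<beta>) the labellings cost about s \<kappa> + s ln (n / s),
  and the parities gain about p y a \<kappa> / 8, where a >= s / 4. If s <= n / 3, then p y >= 83.2,
  which pays even for n / s = 300; otherwise only p y >= 49.9 is available, but n / s < 3.\<close>

lemma heavy_exponent:
  fixes s x y a \<beta> M :: nat
  assumes s: "n \<le> 300 * s" "s \<le> n" and \<beta>: "1 \<le> \<beta>" "1000 * \<beta> \<le> n" and M: "M = n div \<beta> + 1"
    and x: "s \<le> 2 * x" "2 * x \<le> s + 2 * \<beta>" "x \<le> 2 * a" and y: "real y = real n - real x"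
  shows "s * (1 + ln (n / s)) + s * ln (2 * M + 1) - p * y * a * (3 / 4 + ln (real n / (400 * real \<beta>)) / 8) \<le> - real n / 400"
proof -
  define \<kappa> where "\<kappa> = ln (n / \<beta>)"
  have pos: "0 < real n" "0 < real s" "0 < real \<beta>" using n(2) s \<beta> by auto
  have \<kappa>: "69 / 10 \<le> \<kappa>"
  proof -
    have "ln 1000 \<le> \<kappa>" unfolding \<kappa>_def using \<beta> pos by (subst ln_le_cancel_iff) (auto simp: field_simps)
    then show ?thesis using ln_1000_ge by linarith
  qed
  have l400: "ln (real n / (400 * real \<beta>)) \<ge> \<kappa> - 605 / 100"
  proof -
    have "ln (real n / (400 * real \<beta>)) = \<kappa> - ln 400" unfolding \<kappa>_def using pos by (simp add: ln_div ln_mult)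
    moreover have "ln 400 \<le> real 55 * (11 / 100 :: real)" by (rule ln_le_steps) (simp_all add: power2_eq_square power_divide)
    ultimately show ?thesis by simp
  qed
  have lM: "ln (2 * M + 1) \<le> \<kappa> + 3 / 4"
  proof -
    have "real (n div \<beta>) \<le> n / \<beta>" by (rule of_nat_div_le_of_nat)
    moreover have "1000 \<le> n / \<beta>" using \<beta> pos by (simp add: field_simps)
    ultimately have "real (2 * M + 1) \<le> 2003 / 1000 * (n / \<beta>)" unfolding M by simp
    then have "ln (2 * M + 1) \<le> ln (2003 / 1000 * (n / \<beta>))" using pos by (subst ln_le_cancel_iff) auto
    also have "\<dots> = ln (2003 / 1000) + \<kappa>" unfolding \<kappa>_def using pos by (subst ln_mult) auto
    also have "ln (2003 / 1000) \<le> real 1 * (3 / 4 :: real)" by (rule ln_le_steps) (simp_all add: power2_eq_square)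
    finally show ?thesis by simp
  qed
  define F where "F = 3 / 4 + ln (real n / (400 * real \<beta>)) / 8"
  \<comment> \<open>The summand 3/4 almost cancels ln 400 / 8, which is at most 6.05 / 8.\<close>
  have F: "\<kappa> / 8 - 1 / 100 \<le> F" "0 \<le> \<kappa> / 8 - 1 / 100" using l400 \<kappa> by (auto simp: F_def)
  have a4: "real s / 4 \<le> real a" using x by linarith
  have xb: "real x \<le> real s / 2 + real n / 1000" using x \<beta> by linarith
  have py: "p * y = 100 * (1 - x / n)" unfolding p y using pos by (simp add: field_simps)
  have step: "p * y * a * F \<ge> q * (s / 4) * (\<kappa> / 8 - 1 / 100)" if "0 \<le> q" "q \<le> p * y" for q
  proof -
    have "q * (s / 4) \<le> p * y * a" using that a4 by (intro mult_mono) auto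
    moreover have "0 \<le> p * y * a" using that by simp
    ultimately show ?thesis using F by (intro mult_mono[where a = "q * (s / 4)"])
  qed
  have lin: "1 + l + m + 3 / 4 \<le> Z"
    if "832 / 10 / 4 * (\<kappa> / 8 - 1 / 100) \<le> Z" "m \<le> \<kappa> + 3 / 4" "l \<le> real 29 * (1 / 5)" for l m Z :: real
  proof -
    have "13 / 5 * \<kappa> - 26 / 125 \<le> Z" using that(1) by (simp add: field_simps)
    then show ?thesis using that(2,3) \<kappa> by simp
  qed
  have lin': "1 + l + m + 3 / 4 \<le> Z"
    if "499 / 10 / 4 * (\<kappa> / 8 - 1 / 100) \<le> Z" "m \<le> \<kappa> + 3 / 4" "l \<le> real 9 * (1 / 8)" for l m Z :: real
  proof -
    have "499 / 320 * \<kappa> - 499 / 4000 \<le> Z" using that(1) by (simp add: field_simps)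
    then show ?thesis using that(2,3) \<kappa> by simp
  qed
  have "1 + ln (n / s) + ln (2 * M + 1) + 3 / 4 \<le> p * y * a * F / s"
  proof (cases "3 * s \<le> n")
    case True
    have "real x / n \<le> 1 / 6 + 1 / 1000" using xb True pos by (simp add: field_simps)
    moreover have "832 / 10 \<le> 100 * (1 - t)" if "t \<le> 1 / 6 + 1 / 1000" for t :: real using that by simp
    ultimately have "832 / 10 \<le> p * y" unfolding py by blast
    then have "832 / 10 * (s / 4) * (\<kappa> / 8 - 1 / 100) \<le> p * y * a * F" by (intro step) auto
    then have "832 / 10 / 4 * (\<kappa> / 8 - 1 / 100) \<le> p * y * a * F / s" using pos by (simp add: field_simps)
    moreover have "ln (n / s) \<le> real 29 * (1 / 5)"
      using s pos by (intro ln_le_steps) (simp_all add: power2_eq_square power_divide field_simps)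
    ultimately show ?thesis using lM by (intro lin)
  next
    case False
    have "real x / n \<le> 1 / 2 + 1 / 1000" using xb s pos by (simp add: field_simps)
    moreover have "499 / 10 \<le> 100 * (1 - t)" if "t \<le> 1 / 2 + 1 / 1000" for t :: real using that by simp
    ultimately have "499 / 10 \<le> p * y" unfolding py by blast
    then have "499 / 10 * (s / 4) * (\<kappa> / 8 - 1 / 100) \<le> p * y * a * F" by (intro step) auto
    then have "499 / 10 / 4 * (\<kappa> / 8 - 1 / 100) \<le> p * y * a * F / s" using pos by (simp add: field_simps)
    moreover have "ln (n / s) \<le> real 9 * (1 / 8)"
      using False pos by (intro ln_le_steps) (simp_all add: power2_eq_square power_divide field_simps)
    ultimately show ?thesis using lM by (intro lin')
  qed
  then have "s * (1 + ln (n / s) + ln (2 * M + 1) + 3 / 4) \<le> s * (p * y * a * F / s)" using pos by (intro mult_left_mono) auto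
  then have "s * (1 + ln (n / s)) + s * ln (2 * M + 1) - p * y * a * F \<le> - (3 / 4 * s)" using pos by (simp add: algebra_simps)
  also have "\<dots> \<le> - real n / 400" using s by linarith
  finally show ?thesis unfolding F_def .
qed

text \<open>For fixed \<beta> and s, \<open>heavy_exponent\<close> absorbs the number of labellings;
  there are n^2 such pairs. Having few cross edges depends only on the inner part and the rows, so
  it is split off once for all labellings.\<close>

lemma prob_small_class_labelling:
  "bern_prob (all_edges V) p (\<lambda>b. \<exists>\<beta> lab M. small_class_labelling V \<beta> M lab \<and>
      parities_agree V G0 b (class_rows V M lab) (V - inner_part V M lab) lab)
   \<le> 3 * (real n)\<^sup>2 * exp (- real n / 400)"
proof -
  define good where "good \<beta> s M lab \<longleftrightarrow> 1 \<le> \<beta> \<and> 1000 * \<beta> \<le> n \<and> M = n div \<beta> + 1 \<and> n \<le> 300 * s \<and> s \<le> n \<and>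
    lab \<in> V \<rightarrow>\<^sub>E {0..2 * M + 1} \<and> card {v\<in>V. lab v \<noteq> 0} = s \<and> (\<forall>l>M. card {v\<in>V. lab v = l} \<le> 2 * \<beta>) \<and>
    s \<le> 2 * card (inner_part V M lab) \<and> 2 * card (inner_part V M lab) \<le> s + 2 * \<beta> \<and>
    card (inner_part V M lab) \<le> 2 * card (class_rows V M lab)" for \<beta> s M :: nat and lab
  define \<Lambda> where "\<Lambda> M lab = p * card (V - inner_part V M lab) * card (class_rows V M lab)" for M lab
  define R where "R M lab b \<longleftrightarrow> parities_agree V G0 b (class_rows V M lab) (V - inner_part V M lab) lab \<and>
     \<Lambda> M lab / 4 < cross_edges b (class_rows V M lab) (V - inner_part V M lab)" for M lab b
  define At where "At b \<longleftrightarrow> (\<exists>X A. X \<subseteq> V \<and> A \<subseteq> X \<and> n \<le> 600 * card X \<and> 1000 * card X \<le> 501 * n \<and> card X \<le> 2 * card A \<and>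
      cross_edges b A (V - X) \<le> p * card (V - X) * card A / 4)" for b
  let ?P = "bern_prob (all_edges V) p" and ?M = "\<lambda>\<beta>. n div \<beta> + 1"
  have finE: "finite (all_edges V)" using finite_all_edges[OF fin] .
  have finL: "finite (V \<rightarrow>\<^sub>E {0..2 * M + 1})" for M :: nat using fin by (intro finite_PiE) auto
  have one: "?P (\<lambda>b. \<exists>lab. good \<beta> s (?M \<beta>) lab \<and> R (?M \<beta>) lab b) \<le> exp (- real n / 400)" for \<beta> s
  proof (cases "\<exists>lab. good \<beta> s (?M \<beta>) lab")
    case False
    then show ?thesis by simp
  next
    case True
    then have h: "1 \<le> \<beta>" "1000 * \<beta> \<le> n" "n \<le> 300 * s" "s \<le> n" by (auto simp: good_def)
    have s0: "0 < s" using h n(2) by auto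
    let ?L = "{lab. good \<beta> s (?M \<beta>) lab}"
    have L: "?L \<subseteq> {f \<in> V \<rightarrow>\<^sub>E {0..2 * ?M \<beta> + 1}. card {v\<in>V. f v \<noteq> 0} = s}" by (auto simp: good_def)
    have finL': "finite {f \<in> V \<rightarrow>\<^sub>E {0..2 * ?M \<beta> + 1}. card {v\<in>V. f v \<noteq> 0} = s}"
      using finL[of "?M \<beta>"] by simp
    define N where "N = (n choose s) * (2 * ?M \<beta> + 1) ^ s"
    have "card ?L \<le> card {f \<in> V \<rightarrow>\<^sub>E {0..2 * ?M \<beta> + 1}. card {v\<in>V. f v \<noteq> 0} = s}"
      using L finL' by (rule card_mono[rotated])
    also have "\<dots> \<le> N" unfolding N_def n(1) by (rule card_labellings[OF fin])
    finally have cL: "card ?L \<le> N" .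
    have each: "?P (R (?M \<beta>) lab) \<le> exp (- real n / 400) / N" if lab: "lab \<in> ?L" for lab
    proof -
      let ?X = "inner_part V (?M \<beta>) lab" and ?A = "class_rows V (?M \<beta>) lab"
      have g: "good \<beta> s (?M \<beta>) lab" using lab by simp
      have "?X \<subseteq> V" by (auto simp: inner_part_def)
      then have y: "real (card (V - ?X)) = real n - real (card ?X)"
        using fin finite_subset[of ?X V] card_mono[of V ?X] by (simp add: card_Diff_subset n of_nat_diff)
      have "?P (R (?M \<beta>) lab) \<le> exp (- \<Lambda> (?M \<beta>) lab * (3 / 4 + ln (real n / (400 * real \<beta>)) / 8))"
        unfolding R_def \<Lambda>_def using g by (intro prob_rows_outer[OF fin n p]) (auto simp: good_def)
      also have "\<dots> \<le> exp (- real n / 400 - (s * (1 + ln (n / s)) + s * ln (2 * ?M \<beta> + 1)))"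
        using heavy_exponent[of s \<beta> "?M \<beta>" "card ?X" "card ?A" "card (V - ?X)"] g y h
        unfolding \<Lambda>_def good_def by simp
      also have "\<dots> = exp (- real n / 400) / (exp (s * (1 + ln (n / s))) * exp (s * ln (2 * ?M \<beta> + 1)))"
        by (simp only: exp_diff exp_add)
      also have "exp (s * ln (2 * ?M \<beta> + 1)) = real (2 * ?M \<beta> + 1) ^ s"
        by (simp add: exp_of_nat_mult)
      also have "exp (- real n / 400) / (exp (s * (1 + ln (n / s))) * real (2 * ?M \<beta> + 1) ^ s) \<le> exp (- real n / 400) / N"
      proof (rule divide_left_mono)
        have "real (n choose s) * real (2 * ?M \<beta> + 1) ^ s \<le> exp (s * (1 + ln (n / s))) * real (2 * ?M \<beta> + 1) ^ s"
          using binomial_le_exp[OF s0 h(4)] by (intro mult_right_mono) auto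
        then show "real N \<le> exp (s * (1 + ln (n / s))) * real (2 * ?M \<beta> + 1) ^ s" by (simp add: N_def)
        have "0 < real N" using h(4) by (simp add: N_def)
        then show "0 < exp (s * (1 + ln (n / s))) * real (2 * ?M \<beta> + 1) ^ s * real N"
          by (intro mult_pos_pos) auto
      qed simp
      finally show ?thesis .
    qed
    have "?P (\<lambda>b. \<exists>lab. good \<beta> s (?M \<beta>) lab \<and> R (?M \<beta>) lab b) \<le> (\<Sum>lab\<in>?L. ?P (R (?M \<beta>) lab))"
      by (rule bern_prob_union[OF finE _ finite_subset[OF L finL']]) blast
    also have "\<dots> \<le> (\<Sum>lab\<in>?L. exp (- real n / 400) / N)" using each by (rule sum_mono)
    also have "\<dots> = card ?L * (exp (- real n / 400) / N)" by simp
    also have "\<dots> \<le> N * (exp (- real n / 400) / N)" using cL by (intro mult_right_mono) auto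
    also have "\<dots> \<le> exp (- real n / 400)" by (cases "N = 0") auto
    finally show ?thesis .
  qed
  let ?I = "{1..n} \<times> {1..n}"
  have "?P (\<lambda>b. \<exists>\<beta> lab M. small_class_labelling V \<beta> M lab \<and>
      parities_agree V G0 b (class_rows V M lab) (V - inner_part V M lab) lab)
    \<le> ?P At + ?P (\<lambda>b. \<exists>i\<in>?I. \<exists>lab. good (fst i) (snd i) (?M (fst i)) lab \<and> R (?M (fst i)) lab b)"
  proof (rule bern_prob_union2[OF finE])
    fix b assume "\<exists>\<beta> lab M. small_class_labelling V \<beta> M lab \<and>
      parities_agree V G0 b (class_rows V M lab) (V - inner_part V M lab) lab"
    then obtain \<beta> lab M where sl: "small_class_labelling V \<beta> M lab"
      and par: "parities_agree V G0 b (class_rows V M lab) (V - inner_part V M lab) lab" by blast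
    from sl have b: "1 \<le> \<beta>" "1000 * \<beta> \<le> n" "M = n div \<beta> + 1" "lab \<in> V \<rightarrow>\<^sub>E {0..2 * M + 1}"
      "n \<le> 300 * card {v\<in>V. lab v \<noteq> 0}" "\<forall>l>M. card {v\<in>V. lab v = l} \<le> 2 * \<beta>"
      "card {v\<in>V. lab v \<noteq> 0} \<le> 2 * card (inner_part V M lab)"
      "2 * card (inner_part V M lab) \<le> card {v\<in>V. lab v \<noteq> 0} + 2 * \<beta>"
      "card (inner_part V M lab) \<le> 2 * card (class_rows V M lab)"
      unfolding small_class_labelling_def n(1)[symmetric] by - (elim conjE, assumption)+
    define s where "s = card {v\<in>V. lab v \<noteq> 0}"
    let ?X = "inner_part V M lab" and ?A = "class_rows V M lab"
    have sn: "s \<le> n" unfolding s_def n(1) using fin by (intro card_mono) auto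
    have g: "good \<beta> s M lab" unfolding good_def s_def[symmetric] using b sn unfolding s_def by blast
    show "At b \<or> (\<exists>i\<in>?I. \<exists>lab. good (fst i) (snd i) (?M (fst i)) lab \<and> R (?M (fst i)) lab b)"
    proof (cases "\<Lambda> M lab / 4 < cross_edges b ?A (V - ?X)")
      case True
      then have "R M lab b" using par by (simp add: R_def)
      moreover have "(\<beta>, s) \<in> ?I" using b(1,2,5) sn n(2) unfolding s_def[symmetric] by auto
      ultimately show ?thesis using g b(3) by (intro disjI2 bexI[of _ "(\<beta>, s)"]) auto
    next
      case False
      have "?X \<subseteq> V" "?A \<subseteq> ?X" by (auto simp: inner_part_def class_rows_def)
      moreover have "n \<le> 600 * card ?X" using b(5,7) by linarith
      moreover have "1000 * card ?X \<le> 501 * n" using b(2,8) sn unfolding s_def by linarith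
      moreover have "cross_edges b ?A (V - ?X) \<le> p * card (V - ?X) * card ?A / 4" using False by (simp add: \<Lambda>_def)
      ultimately show ?thesis using b(9) unfolding At_def by blast
    qed
  qed
  also have "?P At \<le> (n + 1) * exp (- real n / 400)"
    unfolding At_def by (rule prob_atypical[OF fin n p])
  also have "?P (\<lambda>b. \<exists>i\<in>?I. \<exists>lab. good (fst i) (snd i) (?M (fst i)) lab \<and> R (?M (fst i)) lab b)
     \<le> (\<Sum>i\<in>?I. ?P (\<lambda>b. \<exists>lab. good (fst i) (snd i) (?M (fst i)) lab \<and> R (?M (fst i)) lab b))"
    by (rule bern_prob_union[OF finE]) auto
  also have "\<dots> \<le> (\<Sum>i\<in>?I. exp (- real n / 400))" using one by (rule sum_mono)
  also have "\<dots> = (real n)\<^sup>2 * exp (- real n / 400)" by (simp add: card_cartesian_product power2_eq_square)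
  also have "(n + 1) * exp (- real n / 400) + (real n)\<^sup>2 * exp (- real n / 400) \<le> 3 * (real n)\<^sup>2 * exp (- real n / 400)"
  proof -
    have "1 * real n \<le> real n * real n" using n(2) by (intro mult_right_mono) auto
    then have "real (n + 1) + (real n)\<^sup>2 \<le> 3 * (real n)\<^sup>2" using n(2) unfolding power2_eq_square by linarith
    then have "(real (n + 1) + (real n)\<^sup>2) * exp (- real n / 400) \<le> 3 * (real n)\<^sup>2 * exp (- real n / 400)"
      by (intro mult_right_mono) auto
    then show ?thesis by (simp add: distrib_right)
  qed
  finally show ?thesis by simp
qed

end

subsection \<open>Labellings with large classes\<close>

text \<open>The right-hand side is the tangent of slope L to the concave function - y ln y; it
  touches at y = exp (- L - 1).\<close>

lemma minus_x_ln_le: "0 \<le> y \<Longrightarrow> - (y * ln y) \<le> L * y + exp (- L - 1)" for y L :: real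
proof (cases "y = 0")
  case False
  assume "0 \<le> y"
  with False have y: "0 < y" by simp
  have "ln (exp (- L - 1) / y) \<le> exp (- L - 1) / y - 1" using y by (intro ln_le_minus_one) simp
  also have "ln (exp (- L - 1) / y) = - L - 1 - ln y" using y by (simp add: ln_div)
  finally have "y * (- L - 1 - ln y) \<le> y * (exp (- L - 1) / y - 1)" using y by (intro mult_left_mono) auto
  then show ?thesis using y by (simp add: algebra_simps)
qed simp

lemma ln_1001_le: "ln 1001 \<le> (7 :: real)"
proof -
  have "ln 1001 \<le> real 28 * (1 / 4 :: real)" by (rule ln_le_steps) (simp_all add: power2_eq_square power_divide)
  then show ?thesis by simp
qed

text \<open>In a class occupying the fraction \<open>x\<close> of all vertices, roughly a fifth of the vertices serve as
  columns and at least 79\% as rows, so the parity of the number of random edges into it costs each row a factor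
  \<open>(1 + exp (-38 x)) / 2\<close>. This outweighs the entropy of the class.\<close>

lemma class_parity_beats_entropy:
  fixes x :: real
  assumes "1 / 1000 \<le> x" "x \<le> 1"
  shows "79 / 100 * ln ((1 + exp (- 38 * x)) / 2) \<le> x * ln x - x / 20"
proof (cases "1 / 20 \<le> x")
  \<comment> \<open>For a large class the parity factor is at most 23/40, so the left side is at
    most - 0.434, whereas - x ln x <= 1/e and x / 20 together stay below 0.422.\<close>
  case True
  have e: "exp (19 / 10 :: real) \<ge> 20 / 3"
  proof -
    have "ln (20 / 3) \<le> real 38 * (1 / 20 :: real)" by (rule ln_le_steps) (simp_all add: power2_eq_square power_divide)
    then have "exp (ln (20 / 3)) \<le> exp (19 / 10 :: real)" by (subst exp_le_cancel_iff) simp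
    then show ?thesis by simp
  qed
  have "exp (- 38 * x) \<le> exp (- (19 / 10))" using True by simp
  also have "\<dots> = 1 / exp (19 / 10)" by (simp add: exp_minus inverse_eq_divide)
  also have "\<dots> \<le> 1 / (20 / 3)" using e by (intro divide_left_mono) auto
  finally have "(1 + exp (- 38 * x)) / 2 \<le> 23 / 40" by simp
  moreover have "0 < 1 + exp (- 38 * x)" by (simp add: add_pos_pos)
  ultimately have "ln ((1 + exp (- 38 * x)) / 2) \<le> ln (23 / 40)" by (subst ln_le_cancel_iff) auto
  also have "ln (23 / 40) \<le> - (11 / 20 :: real)"
  proof -
    have "exp (11 / 20 :: real) ^ 20 = exp 1 ^ 11" by (simp add: exp_of_nat_mult[symmetric])
    also have "\<dots> \<le> (272 / 100) ^ 11" using e_less_272 by (intro power_mono) auto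
    also have "\<dots> \<le> (40 / 23) ^ 20" by (simp add: power_divide)
    finally have "exp (11 / 20 :: real) \<le> 40 / 23" by (rule power_le_imp_le_base[where n = 19, simplified]) simp
    then have "ln (exp (11 / 20)) \<le> ln (40 / 23 :: real)" by (subst ln_le_cancel_iff) auto
    then have "11 / 20 \<le> ln (40 / 23 :: real)" by simp
    also have "ln (40 / 23 :: real) = - ln (23 / 40)" by (simp add: ln_div)
    finally show ?thesis by simp
  qed
  finally have 1: "ln ((1 + exp (- 38 * x)) / 2) \<le> - (11 / 20)" .
  have "- (x * ln x) \<le> 0 * x + exp (- 0 - 1)" using assms by (intro minus_x_ln_le) simp
  also have "\<dots> = 1 / exp 1" by (simp add: exp_minus inverse_eq_divide)
  also have "\<dots> \<le> 1 / (269 / 100)"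
  proof (rule divide_left_mono)
    have "ln (269 / 100) \<le> real 4 * (1 / 4 :: real)" by (rule ln_le_steps) (simp_all add: power2_eq_square power_divide)
    then have "exp (ln (269 / 100)) \<le> exp (1 :: real)" by (subst exp_le_cancel_iff) simp
    then show "269 / 100 \<le> exp (1 :: real)" by simp
  qed auto
  finally have "- (x * ln x) \<le> 100 / 269" by simp
  then show ?thesis using 1 assms by linarith
next
  \<comment> \<open>For a small class the cosh bound makes the left side at most - 0.79 * 9.975 x,
    and - ln x <= 7 since x >= 1/1000.\<close>
  case False
  have "(1 + exp (- 38 * x)) / 2 = exp (- 19 * x) * cosh (19 * x)"
    by (simp add: cosh_def exp_add[symmetric] algebra_simps)
  also have "\<dots> \<le> exp (- 19 * x) * exp ((19 * x)\<^sup>2 / 2)"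
    by (intro mult_left_mono cosh_le_exp_half_square) auto
  also have "\<dots> = exp (- 19 * x + (19 * x)\<^sup>2 / 2)" by (simp only: exp_add)
  finally have "ln ((1 + exp (- 38 * x)) / 2) \<le> ln (exp (- 19 * x + (19 * x)\<^sup>2 / 2))"
    by (subst ln_le_cancel_iff) (simp_all add: add_pos_pos)
  then have 1: "ln ((1 + exp (- 38 * x)) / 2) \<le> - 19 * x + (19 * x)\<^sup>2 / 2" by simp
  have "(19 * x)\<^sup>2 / 2 = 361 / 2 * x * x" by (simp add: power2_eq_square)
  also have "\<dots> \<le> 361 / 2 * x * (1 / 20)" using False assms by (intro mult_left_mono) auto
  finally have 2: "ln ((1 + exp (- 38 * x)) / 2) \<le> - (399 / 40) * x" using 1 by simp
  have "ln (1 / 1001) \<le> ln x" using assms by (subst ln_le_cancel_iff) auto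
  then have "- 7 \<le> ln x" using ln_1001_le by (simp add: ln_div)
  then have "- 7 * x \<le> ln x * x" using assms by (intro mult_right_mono) auto
  then show ?thesis using 2 assms by (simp add: mult.commute)
qed

text \<open>Here x l, t and u are the fractions of vertices in the intact class l, in bins, and
  alone in their colour. Summing \<open>class_parity_beats_entropy\<close> leaves a factor \<rho> =
  1 - q with q = t + u; the resulting loss 7 \<rho> q is charged to the outer columns, where 0.79 *
  89 - 7 > 63. The rest has to pay for the entropy of t and u.\<close>

lemma light_exponent:
  fixes x :: "'a \<Rightarrow> real"
  assumes fin: "finite B" and x: "\<And>l. l \<in> B \<Longrightarrow> 1 / 1000 \<le> x l \<and> x l \<le> 1"
    and tu: "0 \<le> t" "0 \<le> u" "sum x B + t + u = 1" "t \<le> sum x B" and \<rho>: "1 / 600 \<le> sum x B"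
  shows "79 / 100 * sum x B * ((\<Sum>l\<in>B. ln ((1 + exp (- 38 * x l)) / 2)) - 89 * (t + u))
     \<le> (\<Sum>l\<in>B. x l * ln (x l)) + t * ln (t / 1001) + u * ln u - 1 / 100"
proof -
  define \<rho> where "\<rho> = sum x B"
  define q where "q = t + u"
  define S where "S = (\<Sum>l\<in>B. x l * ln (x l))"
  have \<rho>q: "\<rho> = 1 - q" using tu by (simp add: \<rho>_def q_def)
  have \<rho>0: "1 / 600 \<le> \<rho>" and q0: "0 \<le> q" using \<rho> tu by (auto simp: \<rho>_def q_def)
  have "79 / 100 * (\<Sum>l\<in>B. ln ((1 + exp (- 38 * x l)) / 2)) = (\<Sum>l\<in>B. 79 / 100 * ln ((1 + exp (- 38 * x l)) / 2))"
    by (rule sum_distrib_left)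
  also have "\<dots> \<le> (\<Sum>l\<in>B. x l * ln (x l) - x l / 20)"
    using x by (intro sum_mono class_parity_beats_entropy) auto
  also have "\<dots> = S - \<rho> / 20" by (simp add: S_def \<rho>_def sum_subtractf sum_divide_distrib)
  finally have 1: "79 / 100 * (\<Sum>l\<in>B. ln ((1 + exp (- 38 * x l)) / 2)) \<le> S - \<rho> / 20" .
  have "S \<ge> (\<Sum>l\<in>B. - 7 * x l)"
    unfolding S_def
  proof (rule sum_mono)
    fix l assume l: "l \<in> B"
    have "ln (1 / 1001) \<le> ln (x l)" using x[OF l] by (subst ln_le_cancel_iff) auto
    then have "- 7 \<le> ln (x l)" using ln_1001_le by (simp add: ln_div)
    then have "- 7 * x l \<le> ln (x l) * x l" using x[OF l] by (intro mult_right_mono) auto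
    then show "- 7 * x l \<le> x l * ln (x l)" by (simp add: mult.commute)
  qed
  then have S7: "- 7 * \<rho> \<le> S" by (simp add: \<rho>_def sum_distrib_left)
  have "79 / 100 * \<rho> * ((\<Sum>l\<in>B. ln ((1 + exp (- 38 * x l)) / 2)) - 89 * q)
      = \<rho> * (79 / 100 * (\<Sum>l\<in>B. ln ((1 + exp (- 38 * x l)) / 2)) - 7031 / 100 * q)" by (simp add: algebra_simps)
  also have "\<dots> \<le> \<rho> * (S - \<rho> / 20 - 7031 / 100 * q)" using 1 \<rho>0 by (intro mult_left_mono) auto
  also have "\<dots> = S - q * S - \<rho> * \<rho> / 20 - 7031 / 100 * (\<rho> * q)" by (simp add: \<rho>q algebra_simps)
  also have "\<dots> \<le> S + 7 * (\<rho> * q) - \<rho> * \<rho> / 20 - 7031 / 100 * (\<rho> * q)"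
  proof -
    have "q * (- 7 * \<rho>) \<le> q * S" using S7 q0 by (intro mult_left_mono)
    then show ?thesis by (simp add: algebra_simps)
  qed
  finally have main: "79 / 100 * \<rho> * ((\<Sum>l\<in>B. ln ((1 + exp (- 38 * x l)) / 2)) - 89 * q)
      \<le> S - \<rho> * \<rho> / 20 - 63 * (\<rho> * q)"
    using mult_nonneg_nonneg[of \<rho> q] \<rho>0 q0 by linarith
  have tl: "- (t * ln (t / 1001)) \<le> 7 * t - t * ln t"
  proof (cases "t = 0")
    case False
    then have "t * ln (t / 1001) = t * ln t - t * ln 1001" using tu by (simp add: ln_div algebra_simps)
    moreover have "t * ln 1001 \<le> t * 7" using ln_1001_le tu by (intro mult_left_mono) auto
    ultimately show ?thesis by simp
  qed simp
  have e8: "exp (- 8) \<le> (1 / 1000 :: real)"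
  proof -
    have "ln 1000 \<le> real 28 * (1 / 4 :: real)" by (rule ln_le_steps) (simp_all add: power2_eq_square power_divide)
    then have "exp (ln 1000) \<le> exp (8 :: real)" by (subst exp_le_cancel_iff) simp
    then have "1 / exp 8 \<le> 1 / (1000 :: real)" by (intro divide_left_mono) auto
    then show ?thesis by (simp add: exp_minus inverse_eq_divide)
  qed
  have "- (t * ln (t / 1001)) - u * ln u + 1 / 100 \<le> \<rho> * \<rho> / 20 + 63 * (\<rho> * q)"
  \<comment> \<open>For small \<rho> the fraction u may be close to 1, and its entropy is bounded by
    1 - u <= 2 \<rho>. For large \<rho> tangents of slope 20 suffice: they cost 27 q against 63
    \<rho> q >= 31.5 q, and \<rho>^2 / 20 >= 0.0125 covers the constants.\<close>
  proof (cases "\<rho> \<le> 1 / 2")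
    case True
    have "- (t * ln t) \<le> 7 * t + exp (- 7 - 1)" using tu by (intro minus_x_ln_le) auto
    moreover have "- (u * ln u) \<le> 1 - u"
    proof (cases "u = 0")
      case False
      then have "ln (1 / u) \<le> 1 / u - 1" using tu by (intro ln_le_minus_one) auto
      then have "u * ln (1 / u) \<le> u * (1 / u - 1)" using tu by (intro mult_left_mono) auto
      then show ?thesis using False tu by (simp add: ln_div algebra_simps)
    qed simp
    moreover have "1 - u \<le> 2 * \<rho>" using tu by (simp add: \<rho>_def)
    moreover have "t \<le> \<rho>" using tu by (simp add: \<rho>_def)
    moreover have "\<rho> * (1 / 2) \<le> \<rho> * q" using True \<rho>0 by (intro mult_left_mono) (auto simp: \<rho>q)
    moreover have "0 \<le> \<rho> * \<rho> / 20" by simp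
    moreover have "exp (- 7 - 1) = (exp (- 8) :: real)" by simp
    ultimately show ?thesis using tl e8 \<rho>0 by linarith
  next
    case False
    have e21: "exp (- 20 - 1) \<le> (1 / 1000 :: real)"
      by (rule order_trans[OF _ e8]) simp
    have "- (t * ln t) \<le> 20 * t + exp (- 20 - 1)" using tu by (intro minus_x_ln_le) auto
    moreover have "- (u * ln u) \<le> 20 * u + exp (- 20 - 1)" using tu by (intro minus_x_ln_le) auto
    moreover have "1 / 2 * q \<le> \<rho> * q" using False q0 by (intro mult_right_mono) auto
    moreover have "1 / 2 * (1 / 2) \<le> \<rho> * \<rho>" using False by (intro mult_mono) auto
    moreover have "7 * t \<le> 7 * q" "20 * t + 20 * u = 20 * q" using tu by (auto simp: q_def)
    ultimately show ?thesis using tl e21 q0 by linarith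
  qed
  then show ?thesis using main unfolding \<rho>_def[symmetric] q_def[symmetric] S_def[symmetric] by linarith
qed

text \<open>The intact classes may be all of \<open>V\<close>, so columns are also taken inside
  them: a fifth of each class, while its least vertex is the representative and the others are rows.
  From size 100 on, rounding the fifth down costs the columns at most 1 percent of the class, and
  removing the representative costs the rows at most as much.\<close>

lemma split_big_classes:
  assumes fin: "finite V" and big: "\<And>v. v \<in> I \<Longrightarrow> 100 \<le> card {w\<in>V. lab w = lab v}"
    and I: "I \<subseteq> V" "\<forall>v\<in>I. \<forall>w\<in>V. lab v = lab w \<longrightarrow> w \<in> I"
  obtains sel A where "A \<subseteq> I" "\<forall>l\<in>lab ` I. sel l \<subseteq> {v\<in>V. lab v = l} - A"
    "\<forall>l\<in>lab ` I. 19 / 100 * card {v\<in>V. lab v = l} \<le> card (sel l)"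
    "\<forall>v\<in>A. \<forall>l\<in>lab ` I. class_rep V lab v \<notin> A \<union> sel l"
    "79 / 100 * card I \<le> card A"
proof -
  define F where "F l = {v\<in>V. lab v = l}" for l
  have finF: "finite (F l)" for l using fin by (simp add: F_def)
  have FI: "F l = {v\<in>I. lab v = l}" if "l \<in> lab ` I" for l using I that by (auto simp: F_def)
  have big': "100 \<le> card (F l)" if "l \<in> lab ` I" for l using big that by (auto simp: F_def)
  have Min_F: "Min (F l) \<in> F l" if "l \<in> lab ` I" for l
    using big'[OF that] finF by (intro Min_in) auto
  have "\<exists>S. S \<subseteq> F l - {Min (F l)} \<and> card S = card (F l) div 5" if "l \<in> lab ` I" for l
  proof -
    have "card (F l) div 5 \<le> card (F l - {Min (F l)})"
      using big'[OF that] Min_F[OF that] finF by (simp add: card_Diff_singleton)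
    then show ?thesis by (metis obtain_subset_with_card_n)
  qed
  then obtain sel where sel: "\<And>l. l \<in> lab ` I \<Longrightarrow> sel l \<subseteq> F l - {Min (F l)}"
    "\<And>l. l \<in> lab ` I \<Longrightarrow> card (sel l) = card (F l) div 5" by metis
  define A where "A = (\<Union>l\<in>lab ` I. F l - sel l - {Min (F l)})"
  have finI: "finite I" using I fin finite_subset by blast
  show ?thesis
  proof
    show "A \<subseteq> I" using FI by (auto simp: A_def)
    show "\<forall>l\<in>lab ` I. sel l \<subseteq> {v\<in>V. lab v = l} - A"
      using sel(1) by (fastforce simp: A_def F_def)
    show "\<forall>l\<in>lab ` I. 19 / 100 * card {v\<in>V. lab v = l} \<le> card (sel l)"
    proof
      fix l assume l: "l \<in> lab ` I"
      show "19 / 100 * card {v\<in>V. lab v = l} \<le> card (sel l)"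
        using sel(2)[OF l] big'[OF l] unfolding F_def[symmetric] by linarith
    qed
    show "\<forall>v\<in>A. \<forall>l\<in>lab ` I. class_rep V lab v \<notin> A \<union> sel l"
    proof (intro ballI)
      fix v l assume v: "v \<in> A" and l: "l \<in> lab ` I"
      have *: "class_rep V lab v = Min (F (lab v))" by (simp add: class_rep_def F_def)
      have "lab v \<in> lab ` I" using v FI by (auto simp: A_def)
      then have "Min (F (lab v)) \<in> F (lab v)" by (rule Min_F)
      then have eq: "lab (class_rep V lab v) = lab v" by (simp add: * F_def)
      have "class_rep V lab v \<notin> A" using eq unfolding A_def * by (auto simp: F_def)
      moreover have "class_rep V lab v \<notin> sel l"
      proof
        assume "class_rep V lab v \<in> sel l"
        then have "class_rep V lab v \<in> F l - {Min (F l)}" using sel(1)[OF l] by blast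
        moreover from this have "lab v = l" using eq by (simp add: F_def)
        ultimately show False by (simp add: *)
      qed
      ultimately show "class_rep V lab v \<notin> A \<union> sel l" by simp
    qed
    have "card I = (\<Sum>l\<in>lab ` I. card (F l))"
    proof -
      have "I = (\<Union>l\<in>lab ` I. F l)" using FI by auto
      then have "card I = card (\<Union>l\<in>lab ` I. F l)" by simp
      also have "\<dots> = (\<Sum>l\<in>lab ` I. card (F l))" using finI finF by (intro card_UN_disjoint) (auto simp: F_def)
      finally show ?thesis .
    qed
    then have "79 / 100 * real (card I) = (\<Sum>l\<in>lab ` I. 79 / 100 * real (card (F l)))" by (simp add: sum_distrib_left)
    also have "\<dots> \<le> (\<Sum>l\<in>lab ` I. real (card (F l - sel l - {Min (F l)})))"
    proof (rule sum_mono)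
      fix l assume l: "l \<in> lab ` I"
      have "sel l \<subseteq> F l" using sel(1)[OF l] by blast
      then have "card (F l - sel l) = card (F l) - card (F l) div 5" using sel(2)[OF l] finF finite_subset by (subst card_Diff_subset) auto
      moreover have "card (F l - sel l) - 1 = card (F l - sel l - {Min (F l)})"
        using sel(1)[OF l] Min_F[OF l] finF by (subst card_Diff_singleton) auto
      ultimately have "card (F l - sel l - {Min (F l)}) = card (F l) - card (F l) div 5 - 1" by simp
      then show "79 / 100 * real (card (F l)) \<le> real (card (F l - sel l - {Min (F l)}))" using big'[OF l] by linarith
    qed
    also have "\<dots> = real (\<Sum>l\<in>lab ` I. card (F l - sel l - {Min (F l)}))" by simp
    also have "(\<Sum>l\<in>lab ` I. card (F l - sel l - {Min (F l)})) = card A"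
      unfolding A_def using finI finF by (intro card_UN_disjoint[symmetric]) (auto simp: F_def)
    finally show "79 / 100 * card I \<le> card A" .
  qed
qed

text \<open>A distribution on labels under which the probability of a labelling with profile
  \<open>k\<close> is its parity cost up to exp (- n / 100). The bins share their total evenly, so
  that a profile consists of only 1002 numbers.\<close>

definition label_weight :: "nat set \<Rightarrow> (nat \<Rightarrow> nat) \<Rightarrow> nat \<Rightarrow> real" where
  "label_weight V k l = (if l \<le> 1000 then k l / card V else k 1001 / (1001 * card V))"

definition label_profile :: "nat set \<Rightarrow> (nat \<Rightarrow> nat) \<Rightarrow> nat \<Rightarrow> nat" where
  "label_profile V lab = restrict (\<lambda>l. if l \<le> 1000 then card {v\<in>V. lab v = l} else card {v\<in>V. 1000 < lab v}) {0..1001}"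

text \<open>The bound 2 n + 1998 comes from bins of at most 2 B vertices with B = n / 1000 rounded
  up.\<close>

definition big_class_labelling :: "nat set \<Rightarrow> (nat \<Rightarrow> nat) \<Rightarrow> bool" where
  "big_class_labelling V lab \<longleftrightarrow> lab \<in> V \<rightarrow>\<^sub>E {0..2001} \<and> card V \<le> 300 * card {v\<in>V. lab v \<noteq> 0} \<and>
     card {v\<in>V. lab v \<noteq> 0} \<le> 2 * card (inner_part V 1000 lab) \<and>
     (\<forall>v\<in>inner_part V 1000 lab. card V \<le> 1000 * card {w\<in>V. lab w = lab v}) \<and>
     (\<forall>l>1000. 1000 * card {v\<in>V. lab v = l} \<le> 2 * card V + 1998)"

context
  fixes V :: "nat set" and n :: nat and p :: real
  assumes fin: "finite V" and n: "n = card V" "100000 \<le> n" and p: "p = 100 / real n"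
begin

lemma p01': "0 \<le> p" "p \<le> 1 / 1000"
  using n(2) by (auto simp: p)

text \<open>Here z = 1, so a fibre with y columns costs (1 + (1 - 2 p)^y) / 2. In an intact class y
  is at least 19 percent of its size, which gives exp (- 38 x). Outside, p y <= 0.22, and
  \<open>parity_part_le\<close> leaves exp (- 0.89 p y), in total 89 \<open>card (V - I)\<close> / n
  in the exponent.\<close>

lemma parity_prod_le:
  fixes lab :: "nat \<Rightarrow> nat" and I :: "nat set"
  assumes lab: "big_class_labelling V lab"
  defines "I \<equiv> inner_part V 1000 lab"
  assumes sel: "\<And>l. l \<in> lab ` I \<Longrightarrow> sel l \<subseteq> {v\<in>V. lab v = l}"
    "\<And>l. l \<in> lab ` I \<Longrightarrow> 19 / 100 * card {v\<in>V. lab v = l} \<le> card (sel l)"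
  defines "Y \<equiv> (V - I) \<union> (\<Union>l\<in>lab ` I. sel l)" and "y \<equiv> \<lambda>Y l. card {w\<in>Y. separate_zero lab w = l}"
  shows "(\<Prod>l\<in>separate_zero lab ` Y. ((1 - p + p * 1) ^ y Y l + (1 - p - p * 1) ^ y Y l) / 2)
    \<le> exp ((\<Sum>l\<in>lab ` I. ln ((1 + exp (- 38 * (card {v\<in>V. lab v = l} / n))) / 2)) - 89 * (card (V - I) / n))"
proof -
  let ?f = "\<lambda>y. ((1 - p + p * 1) ^ y + (1 - p - p * 1) ^ y) / 2"
  let ?\<phi> = "\<lambda>l. (1 + exp (- 38 * (card {v\<in>V. lab v = l} / n))) / 2"
  define O' where "O' = separate_zero lab ` (V - I)"
  have IV: "I \<subseteq> V" by (auto simp: I_def inner_part_def)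
  have finI: "finite I" using IV fin finite_subset by blast
  have I_iff: "v \<in> I \<longleftrightarrow> 1 \<le> lab v \<and> lab v \<le> 1000" if "v \<in> V" for v using that by (simp add: I_def inner_part_def)
  have labI: "1 \<le> l" "l \<le> 1000" if "l \<in> lab ` I" for l using that by (auto simp: I_def inner_part_def)
  have sel_ne: "sel l \<noteq> {}" if l: "l \<in> lab ` I" for l
  proof -
    from l obtain v where v: "v \<in> V" "lab v = l" using IV by auto
    then have "{v\<in>V. lab v = l} \<noteq> {}" by blast
    then have "0 < card {v\<in>V. lab v = l}" using fin by (simp add: card_gt_0_iff)
    then have "0 < real (card (sel l))" using sel(2)[OF l] by linarith
    then show ?thesis by auto
  qed
  have selI: "v \<in> sel l \<Longrightarrow> l \<in> lab ` I \<Longrightarrow> v \<in> V \<and> lab v = l" for v l using sel(1) by blast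
  have img: "separate_zero lab ` Y = Inr ` (lab ` I) \<union> O'"
  proof
    show "separate_zero lab ` Y \<subseteq> Inr ` (lab ` I) \<union> O'"
    proof
      fix x assume "x \<in> separate_zero lab ` Y"
      then obtain v where v: "v \<in> Y" "x = separate_zero lab v" by blast
      show "x \<in> Inr ` (lab ` I) \<union> O'"
      proof (cases "v \<in> V - I")
        case False
        then obtain l where l: "l \<in> lab ` I" "v \<in> sel l" using v by (auto simp: Y_def)
        then have "x = Inr l" using v selI[OF l(2,1)] labI[OF l(1)] by (simp add: separate_zero_def)
        then show ?thesis using l by blast
      qed (use v in \<open>auto simp: O'_def\<close>)
    qed
    show "Inr ` (lab ` I) \<union> O' \<subseteq> separate_zero lab ` Y"
    proof
      fix x :: "nat + nat" assume "x \<in> Inr ` (lab ` I) \<union> O'"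
      then consider l where "l \<in> lab ` I" "x = Inr l" | "x \<in> O'" by blast
      then show "x \<in> separate_zero lab ` Y"
      proof cases
        case 1
        then obtain v where "v \<in> sel l" using sel_ne by blast
        then have "v \<in> Y" "separate_zero lab v = x" using 1 selI[of v l] labI[OF 1(1)] by (auto simp: Y_def separate_zero_def)
        then show ?thesis by blast
      qed (auto simp: O'_def Y_def)
    qed
  qed
  have disj: "Inr ` (lab ` I) \<inter> O' = {}"
  proof -
    have False if "v \<in> V - I" "l \<in> lab ` I" "separate_zero lab v = Inr l" for v l
      using that I_iff[of v] labI[OF that(2)] by (auto simp: separate_zero_def split: if_splits)
    then show ?thesis unfolding O'_def disjoint_iff by (metis imageE)
  qed
  have nonneg: "0 \<le> ?f y" for y using p01' by (intro divide_nonneg_nonneg add_nonneg_nonneg zero_le_power) auto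
  have inner: "?f (y Y (Inr l)) \<le> ?\<phi> l" if l: "l \<in> lab ` I" for l
  proof -
    have "{w\<in>Y. separate_zero lab w = Inr l} = sel l"
    proof (intro set_eqI iffI)
      fix w assume w: "w \<in> {w\<in>Y. separate_zero lab w = Inr l}"
      then have lw: "lab w = l" by (auto simp: separate_zero_def split: if_splits)
      have "w \<notin> V - I" using lw labI[OF l] I_iff[of w] by auto
      then obtain l' where "l' \<in> lab ` I" "w \<in> sel l'" using w by (auto simp: Y_def)
      then show "w \<in> sel l" using selI[of w l'] lw by auto
    next
      fix w assume "w \<in> sel l"
      then show "w \<in> {w\<in>Y. separate_zero lab w = Inr l}" using l selI[of w l] labI[OF l] by (auto simp: Y_def separate_zero_def)
    qed
    then have yl: "y Y (Inr l) = card (sel l)" by (simp add: y_def)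
    have "(1 - 2 * p) ^ card (sel l) \<le> exp (- (2 * p)) ^ card (sel l)"
      using p01' exp_ge_add_one_self[of "- (2 * p)"] by (intro power_mono) auto
    also have "\<dots> = exp (- (2 * p * card (sel l)))" by (simp add: exp_of_nat_mult[symmetric] mult_ac)
    also have "\<dots> \<le> exp (- 38 * (card {v\<in>V. lab v = l} / n))"
    proof -
      have "2 * p * (19 / 100 * card {v\<in>V. lab v = l}) \<le> 2 * p * card (sel l)"
        using sel(2)[OF l] p01' by (intro mult_left_mono) auto
      then show ?thesis by (simp add: p)
    qed
    finally show ?thesis by (simp add: yl)
  qed
  have outer: "?f (y Y l) \<le> exp (- (89 / 100) * (p * y (V - I) l))" if l: "l \<in> O'" for l
  proof -
    have eq: "{w\<in>Y. separate_zero lab w = l} = {w\<in>V - I. separate_zero lab w = l}"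
    proof -
      have False if "w \<in> sel l'" "l' \<in> lab ` I" "separate_zero lab w = l" for w l'
      proof -
        have "separate_zero lab w = Inr l'" using that(1,2) selI[OF that(1,2)] labI[OF that(2)] by (simp add: separate_zero_def)
        then show False using that disj l by auto
      qed
      then show ?thesis by (auto simp: Y_def)
    qed
    have "1000 * card {w\<in>V - I. separate_zero lab w = l} \<le> 2 * card V + 1998"
    proof -
      have "card {w\<in>V - I. separate_zero lab w = l} \<le> (2 * card V + 1998) div 1000"
      proof (rule card_separate_zero_fibre[OF fin _ l[unfolded O'_def]])
        show "1 \<le> (2 * card V + 1998) div 1000" using n by simp
        fix l' assume l': "l' \<in> lab ` (V - I)" "0 < l'"
        then have "1000 < l'" using I_iff by force
        then have "1000 * card {v\<in>V. lab v = l'} \<le> 2 * card V + 1998" using lab by (simp add: big_class_labelling_def)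
        moreover have "card {v\<in>V - I. lab v = l'} \<le> card {v\<in>V. lab v = l'}" using fin by (intro card_mono) auto
        ultimately have "card {v\<in>V - I. lab v = l'} * 1000 \<le> 2 * card V + 1998" by simp
        then show "card {v\<in>V - I. lab v = l'} \<le> (2 * card V + 1998) div 1000" by (simp add: less_eq_div_iff_mult_less_eq)
      qed auto
      then show ?thesis by simp
    qed
    then have "1000 * real (y (V - I) l) \<le> 2 * n + 1998" by (simp add: y_def n flip: of_nat_le_iff[where 'a = real])
    then have "p * y (V - I) l \<le> 22 / 100" using n(2) by (simp add: p field_simps)
    then have "(p * y (V - I) l) * (p * y (V - I) l) \<le> (p * y (V - I) l) * (22 / 100)" using p01' by (intro mult_left_mono) auto
    then have "(p * y (V - I) l * 1)\<^sup>2 / 2 \<le> 11 / 100 * (p * y (V - I) l)" unfolding power2_eq_square mult_1_right by linarith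
    moreover have "?f (y (V - I) l) \<le> exp (- (p * y (V - I) l) + (p * y (V - I) l * 1)\<^sup>2 / 2)"
      using p01' by (intro parity_part_le) auto
    ultimately have "?f (y (V - I) l) \<le> exp (- (89 / 100) * (p * y (V - I) l))"
      by (elim order_trans) simp
    then show ?thesis unfolding y_def eq .
  qed
  have "(\<Prod>l\<in>separate_zero lab ` Y. ?f (y Y l)) = (\<Prod>l\<in>lab ` I. ?f (y Y (Inr l))) * (\<Prod>l\<in>O'. ?f (y Y l))"
    unfolding img using finI fin disj by (subst prod.union_disjoint) (auto simp: O'_def prod.reindex)
  also have "\<dots> \<le> (\<Prod>l\<in>lab ` I. ?\<phi> l) * (\<Prod>l\<in>O'. exp (- (89 / 100) * (p * y (V - I) l)))"
    using inner outer nonneg by (intro mult_mono prod_mono prod_nonneg conjI) (auto simp: add_nonneg_nonneg)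
  also have "(\<Prod>l\<in>lab ` I. ?\<phi> l) = exp (\<Sum>l\<in>lab ` I. ln (?\<phi> l))"
    using finI by (simp add: exp_sum add_pos_pos)
  also have "(\<Prod>l\<in>O'. exp (- (89 / 100) * (p * y (V - I) l))) = exp (\<Sum>l\<in>O'. - (89 / 100) * (p * y (V - I) l))"
    using fin by (simp add: exp_sum O'_def)
  also have "(\<Sum>l\<in>O'. - (89 / 100) * (p * y (V - I) l)) = - (89 / 100) * (p * (\<Sum>l\<in>O'. y (V - I) l))"
    by (simp add: sum_distrib_left)
  also have "(\<Sum>l\<in>O'. y (V - I) l) = card (V - I)"
    using sum.image_gen[of "V - I" "\<lambda>_. 1 :: nat" "separate_zero lab"] fin unfolding O'_def y_def by simp
  also have "- (89 / 100) * (p * card (V - I)) = - 89 * (card (V - I) / n)" by (simp add: p)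
  finally show ?thesis by (simp only: exp_add[symmetric] diff_conv_add_uminus minus_mult_left)
qed

text \<open>The bound is written with weights so that it can be summed over labellings: by
  \<open>light_exponent\<close> the parities beat the entropy of the profile, and exp of minus n
  times that entropy is the product of the weights over all vertices.\<close>

lemma prob_one_big_class_labelling:
  fixes lab :: "nat \<Rightarrow> nat"
  assumes lab: "big_class_labelling V lab"
  shows "bern_prob (all_edges V) p (\<lambda>b. parities_agree V G0 b (inner_part V 1000 lab) V lab)
    \<le> exp (- real n / 100) * (\<Prod>v\<in>V. label_weight V (label_profile V lab) (lab v))"
proof -
  define I where "I = inner_part V 1000 lab"
  define x where "x l = card {v\<in>V. lab v = l} / n" for l
  define t where "t = card {v\<in>V. 1000 < lab v} / n"
  define u where "u = card {v\<in>V. lab v = 0} / n"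
  define S where "S = (\<Sum>l\<in>lab ` I. ln ((1 + exp (- 38 * x l)) / 2)) - 89 * (t + u)"
  note L = lab[unfolded big_class_labelling_def I_def[symmetric]]
  have n0: "0 < n" using n by simp
  have IV: "I \<subseteq> V" by (auto simp: I_def inner_part_def)
  have finI: "finite I" using IV fin finite_subset by blast
  have I_iff: "v \<in> I \<longleftrightarrow> 1 \<le> lab v \<and> lab v \<le> 1000" if "v \<in> V" for v using that by (simp add: I_def inner_part_def)
  have labI: "1 \<le> l" "l \<le> 1000" if "l \<in> lab ` I" for l using that by (auto simp: I_def inner_part_def)
  have fibI: "{v\<in>V. lab v = l} = {v\<in>I. lab v = l}" if "l \<in> lab ` I" for l
    using labI[OF that] I_iff IV by auto
  have big: "100 \<le> card {w\<in>V. lab w = lab v}" if "v \<in> I" for v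
    using L that n by fastforce
  have closed: "\<forall>v\<in>I. \<forall>w\<in>V. lab v = lab w \<longrightarrow> w \<in> I"
    using I_iff IV by (metis subsetD)
  obtain sel A where sA: "A \<subseteq> I" "\<forall>l\<in>lab ` I. sel l \<subseteq> {v\<in>V. lab v = l} - A"
    "\<forall>l\<in>lab ` I. 19 / 100 * card {v\<in>V. lab v = l} \<le> card (sel l)"
    "\<forall>v\<in>A. \<forall>l\<in>lab ` I. class_rep V lab v \<notin> A \<union> sel l"
    "79 / 100 * card I \<le> card A"
    by (rule split_big_classes[OF fin big IV closed])
  define Y where "Y = (V - I) \<union> (\<Union>l\<in>lab ` I. sel l)"
  have AV: "A \<subseteq> V" using sA(1) IV by blast
  have YV: "Y \<subseteq> V" using sA(2) by (auto simp: Y_def)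
  have AY: "A \<inter> Y = {}" using sA(1,2) by (auto simp: Y_def)
  have rep: "class_rep V lab v \<notin> A \<union> Y" if v: "v \<in> A" for v
  proof -
    have vV: "v \<in> V" "v \<in> I" using v AV sA(1) by auto
    have "class_rep V lab v \<in> I" using class_rep_props[OF fin vV(1), of lab] I_iff vV by simp
    moreover have "class_rep V lab v \<notin> sel l" if "l \<in> lab ` I" for l using sA(4) v that by blast
    moreover have "class_rep V lab v \<notin> A" using sA(4) v vV by blast
    ultimately show ?thesis unfolding Y_def by blast
  qed
  let ?P = "bern_prob (all_edges V) p"
  let ?f = "\<lambda>l. ((1 - p + p * 1) ^ card {w\<in>Y. separate_zero lab w = l} + (1 - p - p * 1) ^ card {w\<in>Y. separate_zero lab w = l}) / 2"
  have nonneg: "0 \<le> ?f l" for l using p01' by (intro divide_nonneg_nonneg add_nonneg_nonneg zero_le_power) auto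
  have cIn: "card (V - I) / n = t + u"
  proof -
    have "V - I = {v\<in>V. 1000 < lab v} \<union> {v\<in>V. lab v = 0}" using I_iff by auto
    then have "card (V - I) = card {v\<in>V. 1000 < lab v} + card {v\<in>V. lab v = 0}"
      using fin by (simp only:) (intro card_Un_disjoint, auto)
    then show ?thesis by (simp add: t_def u_def add_divide_distrib)
  qed
  have cI: "(\<Sum>l\<in>lab ` I. card {v\<in>V. lab v = l}) = card I"
    using sum.image_gen[OF finI, of "\<lambda>_. 1 :: nat" lab] fibI by simp
  have xI: "sum x (lab ` I) = card I / n"
    unfolding x_def sum_divide_distrib[symmetric] of_nat_sum[symmetric] cI ..
  have "?P (\<lambda>b. parities_agree V G0 b I V lab) \<le> ?P (\<lambda>b. (\<forall>v\<in>A. \<forall>l\<in>separate_zero lab ` Y.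
       odd (card {w\<in>V. separate_zero lab w = l \<and> xor_adj G0 b v w}) =
       odd (card {w\<in>V. separate_zero lab w = l \<and> xor_adj G0 b (class_rep V lab v) w})) \<and> 0 \<le> (\<Sum>v\<in>A. card {w\<in>Y. b {v, w}}))"
    using sA(1) YV by (intro bern_prob_mono_supp finite_all_edges[OF fin]) (auto simp: parities_agree_def subset_iff)
  also have "\<dots> \<le> (\<Prod>l\<in>separate_zero lab ` Y. ?f l) ^ card A"
    using prob_parities_agree[where ?G0.0 = G0 and L = "separate_zero lab" and ?N0.0 = 0 and z = 1, OF fin p01'(1) _ AV YV AY rep order_refl] p01' by simp
  also have "\<dots> \<le> exp S ^ card A"
  proof (intro power_mono prod_nonneg ballI nonneg)
    show "(\<Prod>l\<in>separate_zero lab ` Y. ?f l) \<le> exp S"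
      using parity_prod_le[OF lab, folded I_def, of sel] sA(2,3) unfolding S_def x_def cIn[symmetric] Y_def by blast
  qed
  also have "\<dots> = exp (card A * S)" by (simp add: exp_of_nat_mult)
  also have "\<dots> \<le> exp (79 / 100 * card I * S)"
  proof -
    have "S \<le> 0"
    proof -
      have "ln ((1 + exp (- 38 * x l)) / 2) \<le> 0" for l
        by (rule ln_le_zero_iff[THEN iffD2]) (auto simp: x_def add_pos_pos)
      then have "(\<Sum>l\<in>lab ` I. ln ((1 + exp (- 38 * x l)) / 2)) \<le> 0" by (intro sum_nonpos) auto
      moreover have "0 \<le> t + u" by (simp add: t_def u_def)
      ultimately show ?thesis by (simp add: S_def)
    qed
    with sA(5) have "card A * S \<le> 79 / 100 * card I * S" by (rule mult_right_mono_neg)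
    then show ?thesis by (simp only: exp_le_cancel_iff)
  qed
  also have "79 / 100 * card I * S = n * (79 / 100 * sum x (lab ` I) * S)" using n0 by (simp add: xI)
  also have "exp \<dots> \<le> exp (n * ((\<Sum>l\<in>lab ` I. x l * ln (x l)) + t * ln (t / 1001) + u * ln u - 1 / 100))"
  proof -
    have "79 / 100 * sum x (lab ` I) * S \<le> (\<Sum>l\<in>lab ` I. x l * ln (x l)) + t * ln (t / 1001) + u * ln u - 1 / 100"
      unfolding S_def
    proof (rule light_exponent)
      show "finite (lab ` I)" using finI by simp
      show "1 / 1000 \<le> x l \<and> x l \<le> 1" if "l \<in> lab ` I" for l
      proof -
        have "card V \<le> 1000 * card {w\<in>V. lab w = l}" using that L by auto
        moreover have "card {w\<in>V. lab w = l} \<le> card V" using fin by (intro card_mono) auto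
        ultimately show ?thesis using n0 by (simp add: x_def n field_simps)
      qed
      show "0 \<le> t" "0 \<le> u" by (auto simp: t_def u_def)
      have "card I + card (V - I) = n"
        using IV fin finI card_mono[OF fin IV] by (simp add: card_Diff_subset n)
      then have "real (card I) + real (card (V - I)) = n" by linarith
      then have "card I / n + card (V - I) / n = 1" using n0 by (simp add: field_simps)
      then show "sum x (lab ` I) + t + u = 1" using cIn xI by simp
      have "{v\<in>V. lab v \<noteq> 0} = I \<union> {v\<in>V. 1000 < lab v}" using I_iff IV by auto
      then have "card {v\<in>V. lab v \<noteq> 0} = card I + card {v\<in>V. 1000 < lab v}"
        using fin finI I_iff by (simp only:) (intro card_Un_disjoint, auto simp: I_def inner_part_def)
      then have "card {v\<in>V. 1000 < lab v} \<le> card I" using L by linarith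
      then show "t \<le> sum x (lab ` I)" unfolding t_def xI by (simp add: divide_right_mono)
      have "n \<le> 600 * card I" using L n by linarith
      then show "1 / 600 \<le> sum x (lab ` I)" unfolding xI using n0 by (simp add: field_simps)
    qed
    then show ?thesis using n0 by simp
  qed
  also have "\<dots> = exp (- real n / 100) * exp (n * ((\<Sum>l\<in>lab ` I. x l * ln (x l)) + t * ln (t / 1001) + u * ln u))"
    by (simp add: exp_add[symmetric] algebra_simps)
  also have "exp (n * ((\<Sum>l\<in>lab ` I. x l * ln (x l)) + t * ln (t / 1001) + u * ln u)) = (\<Prod>v\<in>V. label_weight V (label_profile V lab) (lab v))"
  proof -
    let ?w = "\<lambda>v. label_weight V (label_profile V lab) (lab v)"
    have w: "?w v = (if lab v = 0 then u else if v \<in> I then x (lab v) else t / 1001)" if "v \<in> V" for v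
      using I_iff[OF that] by (auto simp: label_weight_def label_profile_def u_def x_def t_def n)
    have pos: "0 < card {w\<in>V. lab w = lab v}" if "v \<in> V" for v using that fin by (auto simp: card_gt_0_iff)
    have prodI: "prod ?w I = exp (n * (\<Sum>l\<in>lab ` I. x l * ln (x l)))"
    proof -
      have "prod ?w I = (\<Prod>v\<in>I. exp (ln (x (lab v))))"
      proof (rule prod.cong)
        fix v assume v: "v \<in> I"
        then have vV: "v \<in> V" using IV by blast
        have "0 < x (lab v)" using pos[OF vV] n0 by (simp add: x_def)
        then show "?w v = exp (ln (x (lab v)))" using w[OF vV] v I_iff[OF vV] by simp
      qed simp
      also have "\<dots> = exp (\<Sum>v\<in>I. ln (x (lab v)))" using finI by (simp add: exp_sum)
      also have "(\<Sum>v\<in>I. ln (x (lab v))) = (\<Sum>l\<in>lab ` I. \<Sum>v\<in>{v\<in>I. lab v = l}. ln (x (lab v)))"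
        by (rule sum.image_gen[OF finI])
      also have "\<dots> = (\<Sum>l\<in>lab ` I. n * (x l * ln (x l)))"
      proof (rule sum.cong)
        fix l assume l: "l \<in> lab ` I"
        have "(\<Sum>v\<in>{v\<in>I. lab v = l}. ln (x (lab v))) = card {v\<in>I. lab v = l} * ln (x l)" by simp
        also have "real (card {v\<in>I. lab v = l}) = n * x l" using fibI[OF l] n0 by (simp add: x_def)
        finally show "(\<Sum>v\<in>{v\<in>I. lab v = l}. ln (x (lab v))) = n * (x l * ln (x l))" by simp
      qed simp
      finally show ?thesis by (simp only: sum_distrib_left)
    qed
    have prodT: "prod ?w {v\<in>V. 1000 < lab v} = exp (n * (t * ln (t / 1001)))"
    proof (cases "{v\<in>V. 1000 < lab v} = {}")
      case True
      then show ?thesis by (simp only: t_def) simp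
    next
      case False
      then have "0 < card {v\<in>V. 1000 < lab v}" using fin by (simp add: card_gt_0_iff)
      then have t0: "0 < t" using n0 by (simp add: t_def)
      have "prod ?w {v\<in>V. 1000 < lab v} = (\<Prod>v\<in>{v\<in>V. 1000 < lab v}. t / 1001)"
        using w I_iff by (intro prod.cong) auto
      also have "\<dots> = (t / 1001) ^ card {v\<in>V. 1000 < lab v}" by simp
      also have "\<dots> = exp (card {v\<in>V. 1000 < lab v} * ln (t / 1001))" using t0 by (simp add: exp_of_nat_mult)
      also have "real (card {v\<in>V. 1000 < lab v}) = n * t" using n0 by (simp add: t_def)
      finally show ?thesis by (simp add: mult.assoc)
    qed
    have prodU: "prod ?w {v\<in>V. lab v = 0} = exp (n * (u * ln u))"
    proof (cases "{v\<in>V. lab v = 0} = {}")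
      case True
      then show ?thesis by (simp only: u_def) simp
    next
      case False
      then have "0 < card {v\<in>V. lab v = 0}" using fin by (simp add: card_gt_0_iff)
      then have u0: "0 < u" using n0 by (simp add: u_def)
      have "prod ?w {v\<in>V. lab v = 0} = (\<Prod>v\<in>{v\<in>V. lab v = 0}. u)"
        by (rule prod.cong) (simp_all add: label_weight_def label_profile_def u_def n)
      also have "\<dots> = u ^ card {v\<in>V. lab v = 0}" by simp
      also have "\<dots> = exp (card {v\<in>V. lab v = 0} * ln u)" using u0 by (simp add: exp_of_nat_mult)
      also have "real (card {v\<in>V. lab v = 0}) = n * u" using n0 by (simp add: u_def)
      finally show ?thesis by (simp add: mult.assoc)
    qed
    have un: "(I \<union> {v\<in>V. 1000 < lab v}) \<union> {v\<in>V. lab v = 0} = V"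
      and dis: "(I \<union> {v\<in>V. 1000 < lab v}) \<inter> {v\<in>V. lab v = 0} = {}" "I \<inter> {v\<in>V. 1000 < lab v} = {}"
      using IV I_iff by auto
    have "prod ?w V = prod ?w (I \<union> {v\<in>V. 1000 < lab v}) * prod ?w {v\<in>V. lab v = 0}"
      using prod.union_disjoint[OF _ _ dis(1), of ?w] fin finI unfolding un by simp
    also have "prod ?w (I \<union> {v\<in>V. 1000 < lab v}) = prod ?w I * prod ?w {v\<in>V. 1000 < lab v}"
      using prod.union_disjoint[OF _ _ dis(2), of ?w] fin finI by simp
    finally show ?thesis unfolding prodI prodT prodU by (simp add: exp_add distrib_left)
  qed
  finally show ?thesis unfolding I_def .
qed

text \<open>Once the class sizes are fixed, the weights make the product a probability distribution on labellings.\<close>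

lemma prob_big_class_labelling:
  "bern_prob (all_edges V) p (\<lambda>b. \<exists>lab. big_class_labelling V lab \<and> parities_agree V G0 b (inner_part V 1000 lab) V lab)
   \<le> (real n + 1) ^ 1002 * exp (- real n / 100)"
proof -
  let ?P = "bern_prob (all_edges V) p"
  define \<P> where "\<P> = {k \<in> {0..1001} \<rightarrow>\<^sub>E {0..n}. (\<Sum>l\<in>{0..2001}. label_weight V k l) = 1}"
  have finE: "finite (all_edges V)" using finite_all_edges[OF fin] .
  have finK: "finite ({0..1001 :: nat} \<rightarrow>\<^sub>E {0..n})" by (intro finite_PiE) auto
  then have finP: "finite \<P>" by (simp add: \<P>_def)
  have finL: "finite (V \<rightarrow>\<^sub>E {0..2001 :: nat})" using fin by (intro finite_PiE) auto
  let ?L = "\<lambda>k. {lab. big_class_labelling V lab \<and> label_profile V lab = k}"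
  have L: "?L k \<subseteq> V \<rightarrow>\<^sub>E {0..2001}" for k by (auto simp: big_class_labelling_def)
  have prof: "label_profile V lab \<in> \<P>" if lab: "big_class_labelling V lab" for lab
  proof -
    have 1: "label_profile V lab \<in> {0..1001} \<rightarrow>\<^sub>E {0..n}"
      using fin by (auto simp: label_profile_def n intro!: card_mono)
    have n0: "0 < card V" using n by simp
    have split: "{0..2001} = {0..1000} \<union> {1001..2001 :: nat}" by auto
    have "(\<Sum>l\<in>{0..2001}. label_weight V (label_profile V lab) l)
      = (\<Sum>l\<in>{0..1000}. label_weight V (label_profile V lab) l) + (\<Sum>l\<in>{1001..2001}. label_weight V (label_profile V lab) l)"
      unfolding split by (rule sum.union_disjoint) auto
    also have "(\<Sum>l\<in>{0..1000}. label_weight V (label_profile V lab) l) = (\<Sum>l\<in>{0..1000}. card {v\<in>V. lab v = l} / card V)"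
      by (intro sum.cong) (auto simp: label_weight_def label_profile_def)
    also have "\<dots> = real (\<Sum>l\<in>{0..1000}. card {v\<in>V. lab v = l}) / card V" by (simp add: sum_divide_distrib)
    also have "(\<Sum>l\<in>{0..1000}. card {v\<in>V. lab v = l}) = card {v\<in>V. lab v \<le> 1000}"
    proof -
      have "{v\<in>V. lab v \<le> 1000} = (\<Union>l\<in>{0..1000}. {v\<in>V. lab v = l})" by auto
      then show ?thesis using fin by (simp only:) (intro card_UN_disjoint[symmetric], auto)
    qed
    also have "(\<Sum>l\<in>{1001..2001}. label_weight V (label_profile V lab) l) = (\<Sum>l\<in>{1001..2001 :: nat}. card {v\<in>V. 1000 < lab v} / (1001 * card V))"
      by (intro sum.cong) (auto simp: label_weight_def label_profile_def)
    also have "\<dots> = card {v\<in>V. 1000 < lab v} / card V" by simp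
    also have "card {v\<in>V. lab v \<le> 1000} / card V + card {v\<in>V. 1000 < lab v} / card V
        = real (card {v\<in>V. lab v \<le> 1000} + card {v\<in>V. 1000 < lab v}) / card V" by (simp add: add_divide_distrib)
    also have "card {v\<in>V. lab v \<le> 1000} + card {v\<in>V. 1000 < lab v} = card V"
    proof -
      have "V = {v\<in>V. lab v \<le> 1000} \<union> {v\<in>V. 1000 < lab v}" by auto
      then have "card V = card ({v\<in>V. lab v \<le> 1000} \<union> {v\<in>V. 1000 < lab v})" by simp
      also have "\<dots> = card {v\<in>V. lab v \<le> 1000} + card {v\<in>V. 1000 < lab v}" using fin by (intro card_Un_disjoint) auto
      finally show ?thesis by simp
    qed
    finally show ?thesis using 1 n0 by (simp add: \<P>_def)
  qed
  have "?P (\<lambda>b. \<exists>lab. big_class_labelling V lab \<and> parities_agree V G0 b (inner_part V 1000 lab) V lab)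
     \<le> (\<Sum>k\<in>\<P>. ?P (\<lambda>b. \<exists>lab\<in>?L k. parities_agree V G0 b (inner_part V 1000 lab) V lab))"
    by (rule bern_prob_union[OF finE _ finP]) (use prof in blast)
  also have "\<dots> \<le> (\<Sum>k\<in>\<P>. exp (- real n / 100))"
  proof (rule sum_mono)
    fix k assume k: "k \<in> \<P>"
    have w0: "0 \<le> label_weight V k l" for l by (simp add: label_weight_def)
    have "?P (\<lambda>b. \<exists>lab\<in>?L k. parities_agree V G0 b (inner_part V 1000 lab) V lab)
      \<le> (\<Sum>lab\<in>?L k. ?P (\<lambda>b. parities_agree V G0 b (inner_part V 1000 lab) V lab))"
      by (rule bern_prob_union[OF finE _ finite_subset[OF L finL]]) blast
    also have "\<dots> \<le> (\<Sum>lab\<in>?L k. exp (- real n / 100) * (\<Prod>v\<in>V. label_weight V k (lab v)))"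
      using prob_one_big_class_labelling by (intro sum_mono) auto
    also have "\<dots> \<le> (\<Sum>lab\<in>V \<rightarrow>\<^sub>E {0..2001}. exp (- real n / 100) * (\<Prod>v\<in>V. label_weight V k (lab v)))"
      by (rule sum_mono2[OF finL L]) (intro mult_nonneg_nonneg prod_nonneg ballI w0 exp_ge_zero)
    also have "\<dots> = exp (- real n / 100) * (\<Prod>v\<in>V. \<Sum>l\<in>{0..2001}. label_weight V k l)"
      using fin by (simp only: sum_distrib_left[symmetric]) (subst prod_sum_PiE, auto)
    also have "\<dots> = exp (- real n / 100)" using k by (simp add: \<P>_def)
    finally show "?P (\<lambda>b. \<exists>lab\<in>?L k. parities_agree V G0 b (inner_part V 1000 lab) V lab) \<le> exp (- real n / 100)" .
  qed
  also have "\<dots> = card \<P> * exp (- real n / 100)" by simp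
  also have "\<dots> \<le> (real n + 1) ^ 1002 * exp (- real n / 100)"
  proof (rule mult_right_mono)
    have "card \<P> \<le> card ({0..1001 :: nat} \<rightarrow>\<^sub>E {0..n})" using finK by (intro card_mono) (auto simp: \<P>_def)
    also have "\<dots> = (n + 1) ^ 1002" by (simp add: card_funcsetE)
    finally have "real (card \<P>) \<le> real ((n + 1) ^ 1002)" by (simp only: of_nat_le_iff)
    then show "real (card \<P>) \<le> (real n + 1) ^ 1002" by (simp only: of_nat_power of_nat_add of_nat_1)
  qed simp
  finally show ?thesis .
qed

end

subsection \<open>Large components\<close>

text \<open>T is the closure in the disparity graph of the pair from
  \<open>component_in_pair_closure\<close>. Seen from a third vertex, two like-coloured vertices
  have their adjacencies in \<open>E\<close> and in the disparity graph related by the same flip, so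
  closedness and generation carry over to \<open>E\<close>.\<close>

lemma large_component_in_generated_set:
  assumes fin: "finite V" and E: "E \<subseteq> all_edges V" and eq: "equitable V E c"
    and C: "C \<in> connected_comps V (disparity_graph V E c)" "2 \<le> card C"
  obtains a a' T where "a \<in> V" "a' \<in> V" "C \<subseteq> T" "T \<subseteq> nonsingletons V c"
    "generated_set V (\<lambda>u v. {u, v} \<in> E) a a' T"
proof -
  define D where "D u v \<longleftrightarrow> {u, v} \<in> disparity_graph V E c" for u v
  have sub: "disparity_graph V E c \<subseteq> all_edges V" by (rule disparity_subset_all_edges[OF E])
  have sym: "D v u" if "D u v" for u v using that by (simp add: D_def insert_commute)
  have dom: "u \<in> V" if "D u v" for u v using that sub by (auto simp: D_def all_edges_def)
  have "equitable V (disparity_graph V E c) c" by (rule disparity_graph_equitable[OF fin E eq])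
  then have reg: "card {w\<in>V. D u w \<and> c w = \<omega>} = card {w\<in>V. D v w \<and> c w = \<omega>}" if "u \<in> V" "v \<in> V" "c u = c v" for u v \<omega>
    using that unfolding equitable_def D_def by blast
  have half: "2 * card {w\<in>V. D v w \<and> c w = \<omega>} \<le> card {w\<in>V. c w = \<omega>}" if "v \<in> V" for v \<omega>
    unfolding D_def by (rule disparity_graph_half[OF fin E eq that])
  have D_iff: "D u v \<longleftrightarrow> ({u, v} \<in> E) \<noteq> majority_pair V E c (c u) (c v)" if "u \<in> V" "v \<in> V" "u \<noteq> v" for u v
    unfolding D_def by (rule disparity_graph_iff[OF that])
  obtain r where r: "r \<in> V" "C = {w\<in>V. (r, w) \<in> {(x, y). D x y}\<^sup>*}"
    using C(1) by (auto simp: connected_comps_def connected_comp_def D_def)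
  have CV: "C \<subseteq> V" using r by auto
  have closed: "v \<in> C" if "u \<in> C" "D u v" for u v
    using that dom[OF sym[OF that(2)]] unfolding r(2) by (auto intro: rtrancl_into_rtrancl)
  have reach_back: "(w, r) \<in> {(x, y). D x y}\<^sup>*" if "(r, w) \<in> {(x, y). D x y}\<^sup>*" for w
  proof -
    have "sym ({(x, y). D x y}\<^sup>*)" using sym by (intro sym_rtrancl symI) auto
    then show ?thesis using that by (rule symD)
  qed
  have conn: "Y = C" if Y: "Y \<subseteq> C" "Y \<noteq> {}" and Ycl: "\<And>u v. u \<in> Y \<Longrightarrow> D u v \<Longrightarrow> v \<in> Y" for Y
  proof -
    have step: "v \<in> Y" if "(u, v) \<in> {(x, y). D x y}\<^sup>*" "u \<in> Y" for u v
      using that by induction (auto intro: Ycl)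
    obtain y where y: "y \<in> Y" using Y by blast
    then have "r \<in> Y" using step[OF reach_back[of y]] Y(1) r(2) by blast
    then have "C \<subseteq> Y" using step r(2) by blast
    then show ?thesis using Y(1) by blast
  qed
  obtain x where x: "x \<in> C" "x \<noteq> r"
  proof -
    have "\<not> C \<subseteq> {r}" using C(2) card_mono[of "{r}" C] by auto
    then show thesis using that by blast
  qed
  then have "(r, x) \<in> {(x, y). D x y}\<^sup>*" using r by blast
  then obtain y where y: "D r y" using x(2) by (cases rule: converse_rtranclE) auto
  have rC: "r \<in> C" using r by auto
  have "\<exists>a a'. a \<in> C \<and> a' \<in> V \<and> a \<noteq> a' \<and> c a = c a' \<and> C \<subseteq> pair_closure V D c a a'"
    by (rule component_in_pair_closure[where V = V and D = D and c = c and X = C, OF fin]; fact)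
  then obtain a a' where a: "a \<in> C" "a' \<in> V" "a \<noteq> a'" "c a = c a'" "C \<subseteq> pair_closure V D c a a'"
    by blast
  have aV: "a \<in> V" using a CV by blast
  define T where "T = pair_closure V D c a a'"
  note T = pair_closure_props[OF aV a(2), of D c, folded T_def]
  have mate: "\<exists>v'\<in>T. v' \<noteq> v \<and> c v' = c v" if "v \<in> T" for v
    using mate_in_pair_closure[where V = V and D = D and c = c, OF fin sym dom reg half aV a(2,4,3) that[unfolded T_def]] unfolding T_def .
  show thesis
  proof (rule that[OF aV a(2)])
    show "C \<subseteq> T" using a by (simp add: T_def)
    show "T \<subseteq> nonsingletons V c"
    proof
      fix v assume v: "v \<in> T"
      then obtain v' where v': "v' \<in> T" "v' \<noteq> v" "c v' = c v" using mate by blast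
      then have "card {v, v'} \<le> card (colour_class V c v)"
        using fin v T(1) by (intro card_mono) (auto simp: colour_class_def)
      then show "v \<in> nonsingletons V c" using v v' T(1) by (auto simp: nonsingletons_def)
    qed
    have outside: "{w, v} \<in> E \<longleftrightarrow> {w, v'} \<in> E" if "w \<in> V - T" "v \<in> T" "v' \<in> T" "c v = c v'" for w v v'
    proof -
      have "D v w = D v' w" using T(4) that unfolding colour_closed_def by blast
      then have "D w v = D w v'" using sym by blast
      moreover have "w \<noteq> v" "w \<noteq> v'" "v \<in> V" "v' \<in> V" using that T(1) by auto
      ultimately show ?thesis using D_iff[of w v] D_iff[of w v'] that by auto
    qed
    have generates: "I = T"
      if I: "I \<subseteq> T" "a \<in> I" "a' \<in> I" and cl: "\<forall>v\<in>I. \<forall>v'\<in>I. c v = c v' \<longrightarrow> (\<forall>u\<in>T - I. ({u, v} \<in> E) = ({u, v'} \<in> E))" for I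
    proof -
      have "colour_closed V D c I"
        unfolding colour_closed_def
      proof (intro ballI impI)
        fix v v' u assume v: "v \<in> I" "v' \<in> I" "c v = c v'" and u: "u \<in> V - I"
        show "D v u = D v' u"
        proof (cases "u \<in> T")
          case True
          then have "({u, v} \<in> E) = ({u, v'} \<in> E)" using cl v u by blast
          moreover have "u \<noteq> v" "u \<noteq> v'" "v \<in> V" "v' \<in> V" using v u I T(1) by auto
          ultimately have "D u v = D u v'" using D_iff[of u v] D_iff[of u v'] v u by auto
          then show ?thesis using sym by blast
        next
          case False
          then show ?thesis using T(4) v u I unfolding colour_closed_def by blast
        qed
      qed
      then have "T \<subseteq> I" unfolding T_def using I T(1) by (intro pair_closure_least) auto
      then show ?thesis using I by blast
    qed
    show "generated_set V (\<lambda>u v. {u, v} \<in> E) a a' T"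
      unfolding generated_set_def
    proof (intro conjI exI[of _ "\<lambda>v v'. c v = c v'"])
      show "T \<subseteq> V" "a \<in> T" "a' \<in> T" by (rule T)+
      show "\<forall>v\<in>T. \<exists>v'\<in>T. v' \<noteq> v \<and> c v = c v'" using mate by metis
      show "\<forall>w\<in>V - T. \<forall>v\<in>T. \<forall>v'\<in>T. c v = c v' \<longrightarrow> ({w, v} \<in> E) = ({w, v'} \<in> E)" using outside by blast
      show "\<forall>I\<subseteq>T. a \<in> I \<longrightarrow> a' \<in> I \<longrightarrow>
        (\<forall>v\<in>I. \<forall>v'\<in>I. c v = c v' \<longrightarrow> (\<forall>u\<in>T - I. ({u, v} \<in> E) = ({u, v'} \<in> E))) \<longrightarrow> I = T"
        using generates by blast
    qed
  qed
qed

text \<open>Every representative has a mate that is a row, and distinct representatives have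
  distinct mates.\<close>

lemma card_inner_part_le_class_rows:
  assumes fin: "finite V" and mate: "\<And>v. v \<in> inner_part V M lab \<Longrightarrow> \<exists>w\<in>V. w \<noteq> v \<and> lab w = lab v"
  shows "card (inner_part V M lab) \<le> 2 * card (class_rows V M lab)"
proof -
  let ?X = "inner_part V M lab" and ?A = "class_rows V M lab"
  let ?R = "{v\<in>?X. class_rep V lab v = v}"
  obtain f where f: "\<And>v. v \<in> ?X \<Longrightarrow> f v \<in> V \<and> f v \<noteq> v \<and> lab (f v) = lab v" using mate by metis
  have finX: "finite ?X" using fin by (simp add: inner_part_def)
  have finA: "finite ?A" using fin by (simp add: class_rows_def)
  have rep_f: "class_rep V lab (f v) = v" if "v \<in> ?R" for v
    using that f[of v] by (auto simp: class_rep_def)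
  have "card ?R \<le> card ?A"
  proof (rule card_inj_on_le)
    show "inj_on f ?R" using rep_f by (rule inj_on_inverseI)
    show "f ` ?R \<subseteq> ?A"
    proof
      fix w assume "w \<in> f ` ?R"
      then obtain v where v: "v \<in> ?R" "w = f v" by blast
      then show "w \<in> ?A" using f[of v] rep_f[OF v(1)] by (auto simp: class_rows_def inner_part_def)
    qed
  qed (rule finA)
  moreover have "?X = ?R \<union> ?A" by (auto simp: class_rows_def inner_part_def)
  then have "card ?X \<le> card ?R + card ?A" by (metis card_Un_le)
  ultimately show ?thesis by linarith
qed

text \<open>The threshold B is n / 1000 rounded up. If classes of size at least B cover half of the
  \<open>nonsingletons\<close>, these are kept intact and M = 1000 labels suffice for them;
  otherwise \<open>ex_upper_set\<close> supplies X and some \<beta> < B.\<close>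

lemma ex_labelling_of_equitable:
  fixes V :: "nat set" and c :: "nat \<Rightarrow> 'c"
  assumes fin: "finite V" and n: "n = card V" "0 < n" "n \<le> 300 * card (nonsingletons V c)"
    and eq: "\<And>u v \<omega>. u \<in> V \<Longrightarrow> v \<in> V \<Longrightarrow> c u = c v \<Longrightarrow>
      card {w\<in>V. xor_adj G0 b u w \<and> c w = \<omega>} = card {w\<in>V. xor_adj G0 b v w \<and> c w = \<omega>}"
  shows "(\<exists>lab. big_class_labelling V lab \<and> parities_agree V G0 b (inner_part V 1000 lab) V lab) \<or>
    (\<exists>\<beta> lab M. small_class_labelling V \<beta> M lab \<and>
      parities_agree V G0 b (class_rows V M lab) (V - inner_part V M lab) lab)"
proof -
  define B where "B = (n + 999) div 1000"
  define s where "s = card (nonsingletons V c)"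
  have s0: "0 < s" using n by (simp add: s_def)
  have B: "0 < B" "n \<le> 1000 * B" "1000 * B \<le> n + 999" using n(2) by (auto simp: B_def)
  have main: "\<exists>lab. lab \<in> V \<rightarrow>\<^sub>E {0..2 * M + 1} \<and> (\<forall>l>M. card {v\<in>V. lab v = l} \<le> 2 * \<beta>) \<and>
      {v\<in>V. lab v \<noteq> 0} = nonsingletons V c \<and> inner_part V M lab = X \<and>
      (\<forall>v\<in>X. {w\<in>V. lab w = lab v} = colour_class V c v) \<and>
      (\<forall>A Y. A \<subseteq> X \<longrightarrow> parities_agree V G0 b A Y lab)"
    if X: "X \<subseteq> nonsingletons V c" "\<forall>v\<in>X. \<forall>w\<in>V. c v = c w \<longrightarrow> w \<in> X"
      and \<beta>: "0 < \<beta>" "card V \<le> M * \<beta>"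
      and big: "\<forall>v\<in>X. \<beta> \<le> card (colour_class V c v)"
      and small: "\<forall>v\<in>nonsingletons V c - X. card (colour_class V c v) \<le> \<beta>" for X M \<beta>
  proof (rule ex_labelling[where V = V and c = c and X = X and \<beta> = \<beta> and M = M, OF fin X(1) _ \<beta>])
    show "\<And>v w. v \<in> X \<Longrightarrow> w \<in> V \<Longrightarrow> c v = c w \<Longrightarrow> w \<in> X" using X(2) by blast
    show "\<And>v. v \<in> X \<Longrightarrow> \<beta> \<le> card (colour_class V c v)" using big by blast
    show "\<And>v. v \<in> nonsingletons V c - X \<Longrightarrow> card (colour_class V c v) \<le> \<beta>" using small by blast
    fix lab :: "nat \<Rightarrow> nat"
    assume lab0: "lab \<in> V \<rightarrow>\<^sub>E {0..2 * M + 1}" and l: "\<And>v. v \<in> V \<Longrightarrow> lab v = 0 \<longleftrightarrow> v \<notin> nonsingletons V c"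
      "\<And>v. v \<in> V \<Longrightarrow> v \<in> X \<longleftrightarrow> 1 \<le> lab v \<and> lab v \<le> M"
      "\<And>v w. v \<in> V \<Longrightarrow> w \<in> V \<Longrightarrow> c v = c w \<Longrightarrow> lab v = lab w"
      "\<And>v w. v \<in> X \<Longrightarrow> w \<in> V \<Longrightarrow> lab v = lab w \<Longrightarrow> c v = c w"
      and bins: "\<And>l. M < l \<Longrightarrow> card {v\<in>V. lab v = l} \<le> 2 * \<beta>"
    show ?thesis
    proof (intro exI[of _ lab] conjI ballI allI impI lab0 bins)
      have XV: "X \<subseteq> V" using X by (auto simp: nonsingletons_def)
      show "{v\<in>V. lab v \<noteq> 0} = nonsingletons V c"
      proof (rule set_eqI)
        show "v \<in> {v\<in>V. lab v \<noteq> 0} \<longleftrightarrow> v \<in> nonsingletons V c" for v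
          using l(1)[of v] unfolding nonsingletons_def mem_Collect_eq by argo
      qed
      show "inner_part V M lab = X" using l(2) XV by (auto simp: inner_part_def)
      show "{w\<in>V. lab w = lab v} = colour_class V c v" if v: "v \<in> X" for v
      proof -
        have "lab w = lab v \<longleftrightarrow> c w = c v" if "w \<in> V" for w
        proof -
          have "v \<in> V" using v XV by blast
          then show ?thesis using l(3)[OF that, of v] l(4)[OF v that] by argo
        qed
        then show ?thesis unfolding colour_class_def by blast
      qed
      fix A Y assume A: "A \<subseteq> X"
      show "parities_agree V G0 b A Y lab"
        unfolding parities_agree_def
      proof (intro ballI)
        fix v l' assume "v \<in> A"
        then have v: "v \<in> X" "v \<in> V" using A XV by auto
        note rep = class_rep_props[OF fin v(2), of lab]
        have cv: "c v = c (class_rep V lab v)" using l(4)[OF v(1) rep(1)] rep(2) by simp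
        have zero: "w \<notin> nonsingletons V c" if "w \<in> V" "lab w = 0" for w using l(1)[OF that(1)] that(2) by blast
        have "card {w\<in>V. separate_zero lab w = l' \<and> xor_adj G0 b v w} =
            card {w\<in>V. separate_zero lab w = l' \<and> xor_adj G0 b (class_rep V lab v) w}"
          by (rule labelled_degrees_agree[where c = c and V = V, OF fin]; fact eq l(3) zero v(2) rep(1) cv)
        then show "odd (card {w\<in>V. separate_zero lab w = l' \<and> xor_adj G0 b v w}) =
            odd (card {w\<in>V. separate_zero lab w = l' \<and> xor_adj G0 b (class_rep V lab v) w})" by simp
      qed
    qed
  qed
  let ?X = "{v\<in>nonsingletons V c. B \<le> card (colour_class V c v)}"
  show ?thesis
  proof (cases "s \<le> 2 * card ?X")
    case True
    have "w \<in> ?X" if "v \<in> ?X" "w \<in> V" "c v = c w" for v w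
      using that(1,2) unfolding nonsingletons_def mem_Collect_eq colour_class_eq[where c = c and V = V, OF that(3)] by blast
    then have Xcl: "\<forall>v\<in>?X. \<forall>w\<in>V. c v = c w \<longrightarrow> w \<in> ?X" by blast
    have Xsub: "?X \<subseteq> nonsingletons V c" by blast
    have cV: "card V \<le> 1000 * B" using B(2) n(1) by simp
    have size: "\<forall>v\<in>?X. B \<le> card (colour_class V c v)"
      "\<forall>v\<in>nonsingletons V c - ?X. card (colour_class V c v) \<le> B" by auto
    obtain lab where lab: "lab \<in> V \<rightarrow>\<^sub>E {0..2 * 1000 + 1}" "\<forall>l>1000. card {v\<in>V. lab v = l} \<le> 2 * B"
      and m: "{v\<in>V. lab v \<noteq> 0} = nonsingletons V c" "inner_part V 1000 lab = ?X"
      "\<forall>v\<in>?X. {w\<in>V. lab w = lab v} = colour_class V c v"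
      "\<forall>A Y. A \<subseteq> ?X \<longrightarrow> parities_agree V G0 b A Y lab"
      using main[OF Xsub Xcl B(1) cV size] by (elim exE conjE) (rule that)
    have "big_class_labelling V lab"
      unfolding big_class_labelling_def m(1,2)
    proof (intro conjI ballI allI impI)
      show "lab \<in> V \<rightarrow>\<^sub>E {0..2001}" using lab(1) by simp
      show "card V \<le> 300 * card (nonsingletons V c)" using n by simp
      show "card (nonsingletons V c) \<le> 2 * card ?X" using True by (simp add: s_def)
      show "card V \<le> 1000 * card {w\<in>V. lab w = lab v}" if v: "v \<in> ?X" for v
      proof -
        have "B \<le> card {w\<in>V. lab w = lab v}" using m(3) v by simp
        then show ?thesis using B(2) n(1) by linarith
      qed
      show "1000 * card {v\<in>V. lab v = l} \<le> 2 * card V + 1998" if "1000 < l" for l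
        using lab(2)[rule_format, OF that] B(3) n(1) by linarith
    qed
    moreover have "parities_agree V G0 b (inner_part V 1000 lab) V lab" unfolding m(2) using m(4)[rule_format, OF order_refl] .
    ultimately show ?thesis by (intro disjI1 exI[of _ lab] conjI)
  next
    case False
    then have few: "2 * card ?X < s" by simp
    show ?thesis
    proof (rule ex_upper_set[OF fin s_def s0 few])
      fix X \<beta>
      assume X1: "X \<subseteq> nonsingletons V c" and X2: "\<And>v w. v \<in> X \<Longrightarrow> w \<in> V \<Longrightarrow> c v = c w \<Longrightarrow> w \<in> X"
        and \<beta>: "2 \<le> \<beta>" "\<beta> < B"
        and large: "\<And>v. v \<in> X \<Longrightarrow> \<beta> \<le> card (colour_class V c v)"
        and small: "\<And>v. v \<in> nonsingletons V c - X \<Longrightarrow> card (colour_class V c v) \<le> \<beta>"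
        and half: "s \<le> 2 * card X" "2 * card X < s + 2 * \<beta>"
      have X: "X \<subseteq> nonsingletons V c" "\<forall>v\<in>X. \<forall>w\<in>V. c v = c w \<longrightarrow> w \<in> X" using X1 X2 by blast+
      have size: "\<forall>v\<in>X. \<beta> \<le> card (colour_class V c v)"
        "\<forall>v\<in>nonsingletons V c - X. card (colour_class V c v) \<le> \<beta>" using large small by blast+
      \<comment> \<open>The extra 1 guarantees n <= M * \<beta> when the division leaves a
        remainder.\<close>
      define M where "M = n div \<beta> + 1"
      have \<beta>0: "0 < \<beta>" using \<beta> by simp
      have M: "card V \<le> M * \<beta>" unfolding n(1)[symmetric] M_def using div_mult_mod_eq[of n \<beta>] mod_less_divisor[OF \<beta>0, of n] unfolding add_mult_distrib mult_1 by linarith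
      obtain lab where lab: "lab \<in> V \<rightarrow>\<^sub>E {0..2 * M + 1}" "\<forall>l>M. card {v\<in>V. lab v = l} \<le> 2 * \<beta>"
        and m: "{v\<in>V. lab v \<noteq> 0} = nonsingletons V c" "inner_part V M lab = X"
        "\<forall>v\<in>X. {w\<in>V. lab w = lab v} = colour_class V c v"
        "\<forall>A Y. A \<subseteq> X \<longrightarrow> parities_agree V G0 b A Y lab"
        using main[OF X \<beta>0 M size(1,2)] by (elim exE conjE) (rule that)
      have rows: "card (inner_part V M lab) \<le> 2 * card (class_rows V M lab)"
      proof (rule card_inner_part_le_class_rows[OF fin])
        fix v assume "v \<in> inner_part V M lab"
        then have v: "v \<in> X" by (simp add: m(2))
        then have "2 \<le> card {w\<in>V. lab w = lab v}" using m(3) bspec[OF size(1) v] \<beta>(1) by simp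
        then have "\<not> {w\<in>V. lab w = lab v} \<subseteq> {v}" using card_mono[of "{v}" "{w\<in>V. lab w = lab v}"] by auto
        then show "\<exists>w\<in>V. w \<noteq> v \<and> lab w = lab v" by blast
      qed
      have "class_rows V M lab \<subseteq> X" unfolding m(2)[symmetric] by (auto simp: class_rows_def inner_part_def)
      then have par: "parities_agree V G0 b (class_rows V M lab) (V - inner_part V M lab) lab" using m(4) by blast
      \<comment> \<open>From \<beta> + 1 <= B and 1000 B <= n + 999.\<close>
      have "1000 * \<beta> \<le> n" using \<beta> B by linarith
      moreover have "1 \<le> \<beta>" "n \<le> 300 * card {v\<in>V. lab v \<noteq> 0}"
        "card {v\<in>V. lab v \<noteq> 0} \<le> 2 * card (inner_part V M lab)"
        "2 * card (inner_part V M lab) \<le> card {v\<in>V. lab v \<noteq> 0} + 2 * \<beta>"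
        using \<beta>0 n(3) half unfolding m(1,2) s_def by linarith+
      ultimately have "small_class_labelling V \<beta> M lab"
        unfolding small_class_labelling_def n(1)[symmetric] using M_def lab rows by (intro conjI)
      with par show ?thesis by (intro disjI2 exI conjI)
    qed
  qed
qed

section \<open>Assembling the failure probability\<close>

definition large_component :: "nat set \<Rightarrow> nat set set \<Rightarrow> (nat set \<Rightarrow> bool) \<Rightarrow> bool" where
  "large_component V G0 b \<longleftrightarrow> (let G = sym_diff G0 {e\<in>all_edges V. b e} in
     \<exists>C\<in>connected_comps V (disparity_graph V G (wl_vertex_colouring V G)). ln (real (card V)) < real (card C))"

text \<open>At most n^3 triples of a, a' and s, each costing exp (- 50 s) with s > ln n; then the
  labellings with large and with small classes.\<close>

definition failure_bound :: "nat \<Rightarrow> real" where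
  "failure_bound n = real n ^ 3 * exp (- 50 * ln (real n)) + (real n + 1) ^ 1002 * exp (- real n / 100)
     + 3 * (real n)\<^sup>2 * exp (- real n / 400)"

lemma prob_large_component_sparse:
  assumes fin: "finite V" and n: "n = card V" "100000 \<le> n" and p: "p = 100 / real n" and G0: "G0 \<subseteq> all_edges V"
  shows "bern_prob (all_edges V) p (large_component V G0) \<le> failure_bound n"
proof -
  let ?P = "bern_prob (all_edges V) p"
  let ?Big = "\<lambda>b. \<exists>lab. big_class_labelling V lab \<and> parities_agree V G0 b (inner_part V 1000 lab) V lab"
  let ?Small = "\<lambda>b. \<exists>\<beta> lab M. small_class_labelling V \<beta> M lab \<and>
      parities_agree V G0 b (class_rows V M lab) (V - inner_part V M lab) lab"
  let ?I = "{(a, a', s). a \<in> V \<and> a' \<in> V \<and> s \<in> {s\<in>{1..n}. ln (real n) < real s \<and> 300 * s \<le> n}}"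
  let ?gen = "\<lambda>(a, a', s) b. \<exists>T. generated_set V (xor_adj G0 b) a a' T \<and> card T = s"
  have finE: "finite (all_edges V)" using finite_all_edges[OF fin] .
  have I_sub: "?I \<subseteq> V \<times> V \<times> {1..n}" by auto
  have finI: "finite ?I" using fin by (intro finite_subset[OF I_sub]) auto
  have ln1: "1 \<le> ln (real n)"
  proof -
    have "exp 1 \<le> real n" using n(2) e_less_272 by linarith
    then show ?thesis using n(2) by (subst ln_ge_iff) auto
  qed
  have cases: "(\<exists>i\<in>?I. ?gen i b) \<or> ?Big b \<or> ?Small b"
    if supp: "\<And>e. e \<notin> all_edges V \<Longrightarrow> \<not> b e" and large: "large_component V G0 b" for b
  proof -
    define E where "E = sym_diff G0 {e\<in>all_edges V. b e}"
    let ?c = "wl_vertex_colouring V E"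
    have EE: "E \<subseteq> all_edges V" using G0 by (auto simp: E_def)
    have adj: "(\<lambda>u v. {u, v} \<in> E) = xor_adj G0 b" using supp by (auto simp: E_def xor_adj_def fun_eq_iff)
    have adj': "{u, v} \<in> E \<longleftrightarrow> xor_adj G0 b u v" for u v using adj by metis
    have eq: "equitable V E ?c" by (rule equitable_wl_vertex_colouring[OF fin EE])
    obtain C where C: "C \<in> connected_comps V (disparity_graph V E ?c)" "ln (real n) < real (card C)"
      using large unfolding large_component_def Let_def E_def n(1) by blast
    \<comment> \<open>More than ln n >= 1 vertices, so the component contains an edge.\<close>
    have "2 \<le> card C" using C(2) ln1 by linarith
    then obtain a a' T where T: "a \<in> V" "a' \<in> V" "C \<subseteq> T" "T \<subseteq> nonsingletons V ?c"
      "generated_set V (\<lambda>u v. {u, v} \<in> E) a a' T"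
      by (rule large_component_in_generated_set[OF fin EE eq C(1)])
    have TV: "T \<subseteq> V" using T(5) by (simp add: generated_set_def)
    have finT: "finite T" using TV fin finite_subset by blast
    have "card C \<le> card T" using T(3) finT by (rule card_mono[rotated])
    then have lnT: "ln (real n) < real (card T)" using C(2) by linarith
    show ?thesis
    proof (cases "300 * card T \<le> n")
      case True
      then have "(a, a', card T) \<in> ?I" using T(1,2) lnT ln1 by auto
      moreover have "?gen (a, a', card T) b" using T(5) unfolding adj by auto
      ultimately show ?thesis by (intro disjI1 bexI)
    next
      case False
      have "card T \<le> card (nonsingletons V ?c)" using T(4) fin by (intro card_mono) (auto simp: nonsingletons_def)
      then have big: "n \<le> 300 * card (nonsingletons V ?c)" using False by linarith
      have deg: "card {w\<in>V. xor_adj G0 b u w \<and> ?c w = \<omega>} = card {w\<in>V. xor_adj G0 b v w \<and> ?c w = \<omega>}"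
        if "u \<in> V" "v \<in> V" "?c u = ?c v" for u v \<omega>
        using eq that unfolding equitable_def adj' by blast
      have "?Big b \<or> ?Small b"
        by (rule ex_labelling_of_equitable[where c = ?c, OF fin n(1) _ big deg]) (use n(2) in auto)
      then show ?thesis by (rule disjI2)
    qed
  qed
  have np: "real (card V) * p = 100" using n by (simp add: p)
  have "?P (large_component V G0) \<le> ?P (\<lambda>b. \<exists>i\<in>?I. ?gen i b) + ?P (\<lambda>b. ?Big b \<or> ?Small b)"
    by (rule bern_prob_union2[OF finE]) (rule cases)
  also have "?P (\<lambda>b. ?Big b \<or> ?Small b) \<le> ?P ?Big + ?P ?Small"
    by (rule bern_prob_union2[OF finE])
  also have "?P ?Big \<le> (real n + 1) ^ 1002 * exp (- real n / 100)" by (rule prob_big_class_labelling[OF fin n p])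
  also have "?P ?Small \<le> 3 * (real n)\<^sup>2 * exp (- real n / 400)" using n(2) by (intro prob_small_class_labelling[OF fin n(1) _ p]) auto
  also have "?P (\<lambda>b. \<exists>i\<in>?I. ?gen i b) \<le> (\<Sum>i\<in>?I. ?P (?gen i))"
    by (rule bern_prob_union[OF finE _ finI])
  also have "(\<Sum>i\<in>?I. ?P (?gen i)) \<le> (\<Sum>i\<in>?I. exp (- 50 * ln (real n)))"
  proof (rule sum_mono)
    fix i assume "i \<in> ?I"
    then obtain a a' s where i: "i = (a, a', s)" "a \<in> V" "a' \<in> V" "ln (real n) < real s" "300 * s \<le> n" by auto
    have "?P (?gen i) \<le> exp (- 50 * real s)"
      using i unfolding i(1) case_prod_conv
      by (intro prob_generated_set[OF fin _ _ np]) (use n p in auto)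
    also have "\<dots> \<le> exp (- 50 * ln (real n))" using i(4) by simp
    finally show "?P (?gen i) \<le> exp (- 50 * ln (real n))" .
  qed
  also have "\<dots> = card ?I * exp (- 50 * ln (real n))" by simp
  also have "\<dots> \<le> real n ^ 3 * exp (- 50 * ln (real n))"
  proof (rule mult_right_mono)
    have "card ?I \<le> card (V \<times> V \<times> {1..n})" using fin by (intro card_mono I_sub) auto
    also have "\<dots> = n ^ 3" by (simp add: card_cartesian_product n(1)[symmetric] power3_eq_cube)
    finally show "real (card ?I) \<le> real n ^ 3" by (simp only: of_nat_power[symmetric] of_nat_le_iff)
  qed simp
  finally show ?thesis by (simp add: failure_bound_def)
qed

text \<open>A random graph of density \<open>p\<close> is the symmetric difference of two independent ones of densities \<open>100 / n\<close> and \<open>r\<close>.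
  The denser one is absorbed into \<open>G0\<close>.\<close>

lemma prob_large_component:
  assumes fin: "finite V" and n: "n = card V" "100000 \<le> n" and p: "100 / real n \<le> p" "p \<le> 1 / 2" and G0: "G0 \<subseteq> all_edges V"
  shows "bern_prob (all_edges V) p (large_component V G0) \<le> failure_bound n"
proof -
  define q where "q = 100 / real n"
  \<comment> \<open>The solution of p = r (1 - q) + (1 - r) q, the density of a symmetric
    difference; it is a probability since q <= p <= 1/2 and q is small.\<close>
  define r where "r = (p - q) / (1 - 2 * q)"
  have q: "0 \<le> q" "q \<le> 1 / 1000" using n(2) by (auto simp: q_def field_simps)
  have qp: "q \<le> p" using p by (simp add: q_def)
  show ?thesis
  proof (rule bern_prob_xor[OF finite_all_edges[OF fin]])
    show "0 \<le> q" "q \<le> 1" using q by auto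
    show "0 \<le> r" "r \<le> 1" using q qp p by (auto simp: r_def field_simps)
    have "r * (1 - 2 * q) = p - q" using q by (simp add: r_def)
    then show "p = r * (1 - q) + (1 - r) * q" by (simp add: algebra_simps)
    fix g :: "nat set \<Rightarrow> bool"
    have "sym_diff G0 {e\<in>all_edges V. g e \<noteq> b e} = sym_diff (sym_diff G0 {e\<in>all_edges V. g e}) {e\<in>all_edges V. b e}" for b
      by auto
    then have "large_component V G0 (\<lambda>e. g e \<noteq> b e) = large_component V (sym_diff G0 {e\<in>all_edges V. g e}) b" for b
      by (simp only: large_component_def)
    then have "bern_prob (all_edges V) q (\<lambda>b. large_component V G0 (\<lambda>e. g e \<noteq> b e))
      = bern_prob (all_edges V) q (large_component V (sym_diff G0 {e\<in>all_edges V. g e}))" by presburger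
    also have "\<dots> \<le> failure_bound n"
      using G0 by (intro prob_large_component_sparse[OF fin n q_def]) auto
    finally show "bern_prob (all_edges V) q (\<lambda>b. large_component V G0 (\<lambda>e. g e \<noteq> b e)) \<le> failure_bound n" .
  qed
qed

lemma failure_bound_tendsto_0: "failure_bound \<longlonglongrightarrow> 0"
  unfolding failure_bound_def by real_asymp

theorem theorem6p14:
  shows "\<exists>K::real. \<forall>(p :: nat \<Rightarrow> real) (G0 :: nat \<Rightarrow> nat set set).
    (\<forall>\<^sub>F n in sequentially. 0 \<le> p n \<and> p n \<le> 1 / 2 \<and> p n \<ge> 100 / real n) \<longrightarrow>
    (\<forall>n. G0 n \<subseteq> all_edges {1..n}) \<longrightarrow>
    (\<lambda>n. measure_pmf.prob (random_graph n (p n))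
       {Grand. let G = sym_diff (G0 n) Grand in
          \<forall>C \<in> connected_comps {1..n} (disparity_graph {1..n} G (wl_vertex_colouring {1..n} G)).
            real (card C) \<le> K * ln (real n)})
      \<longlonglongrightarrow> 1"
\<comment> \<open>K = 1 works because a generated set of more than ln n vertices already costs a
  factor n^(-50), against n^3 choices.\<close>
proof (intro exI[of _ 1] allI impI)
  fix p :: "nat \<Rightarrow> real" and G0 :: "nat \<Rightarrow> nat set set"
  assume p: "\<forall>\<^sub>F n in sequentially. 0 \<le> p n \<and> p n \<le> 1 / 2 \<and> p n \<ge> 100 / real n"
    and G0: "\<forall>n. G0 n \<subseteq> all_edges {1..n}"
  define X where "X n = measure_pmf.prob (random_graph n (p n))
       {Grand. let G = sym_diff (G0 n) Grand in
          \<forall>C \<in> connected_comps {1..n} (disparity_graph {1..n} G (wl_vertex_colouring {1..n} G)).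
            real (card C) \<le> 1 * ln (real n)}" for n
  have X: "X n = 1 - bern_prob (all_edges {1..n}) (p n) (large_component {1..n} (G0 n))" for n
  proof -
    have "X n = measure_pmf.prob (bern (all_edges {1..n}) (p n)) (- {b. large_component {1..n} (G0 n) b})"
      unfolding X_def random_graph_def bern_def[symmetric] measure_map_pmf
      by (rule arg_cong2[of _ _ _ _ measure]) (auto simp: large_component_def Let_def not_less)
    then show ?thesis
      using measure_pmf.prob_compl[of "{b. large_component {1..n} (G0 n) b}" "bern (all_edges {1..n}) (p n)"]
      by (simp add: Compl_eq_Diff_UNIV)
  qed
  have "\<forall>\<^sub>F n in sequentially. 1 - failure_bound n \<le> X n"
    using p eventually_ge_at_top[of 100000]
  proof eventually_elim
    case (elim n)
    then show ?case using prob_large_component[of "{1..n}" n "p n" "G0 n"] G0 by (simp add: X)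
  qed
  moreover have "(\<lambda>n. 1 - failure_bound n) \<longlonglongrightarrow> 1"
    using tendsto_diff[OF tendsto_const failure_bound_tendsto_0, of 1] by simp
  moreover have "\<forall>\<^sub>F n in sequentially. X n \<le> 1" by (simp add: X_def)
  ultimately have "X \<longlonglongrightarrow> 1" by (intro tendsto_sandwich[of _ X sequentially "\<lambda>_. 1"]) auto
  then show "(\<lambda>n. measure_pmf.prob (random_graph n (p n))
       {Grand. let G = sym_diff (G0 n) Grand in
          \<forall>C \<in> connected_comps {1..n} (disparity_graph {1..n} G (wl_vertex_colouring {1..n} G)).
            real (card C) \<le> 1 * ln (real n)}) \<longlonglongrightarrow> 1"
    unfolding X_def .
qed

end
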